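(* Let $M\in\mathrm{Sp}(2d,\mathbb R)$ be hyperbolic. Write bases of its stable and unstable subspaces $E_s,E_u$ as the columns of $V_s=\binom{X_s}{P_s}$, $V_u=\binom{X_u}{P_u}$, with $MV_s=V_sD_s$, $MV_u=V_uD_u$. For $S=S^\top\in\mathbb R^{d\times d}$ consider the endpoint rows $$\mathsf B_0=\begin{pmatrix}I&0\\0&0\end{pmatrix},\qquad \mathsf B_T=\begin{pmatrix}0&0\\-S&I\end{pmatrix},$$ which impose $x_0=\xi$ and $p_T-Sx_T=\pi$. Then the subspaces $E_s,E_u$ are Lagrangian, and $$\widehat\Gamma_\infty=[\mathsf B_0V_s\quad\mathsf B_TV_u]=\begin{pmatrix}X_s&0\\0&P_u-SX_u\end{pmatrix}.$$ The two diagonal blocks are nonsingular exactly when $$E_s\cap(\{0\}\times\mathbb R^d)=\{0\},\qquad E_u\cap\{(x,Sx):x\in\mathbb R^d\}=\{0\}.\tag{G}$$ Under the graph conditions (G), the uniform Green property (for $L[h,h^+]=h^+-Mh$ and the rows $\mathsf B_0,\mathsf B_T$) holds for all sufficiently large horizons. For a prescribed $T_0\ge1$, it holds for every $T\ge T_0$ if the finitely many scaled matrices $$\widehat\Gamma_T=[\ \mathsf B_0V_s+\mathsf B_TV_sD_s^{\,T}\quad \mathsf B_0V_uD_u^{-T}+\mathsf B_TV_u\ ]$$ with $T\ge T_0$ below a large-horizon cutoff are also nonsingular. These conclusions are open under small perturbations of $(M,S)$ within the hyperbolic symplectic region (with $S$ symmetric). The large-horizon conclusion is uniform on compact subsets of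 pairs $(M,S)$ satisfying the two graph conditions. Uniformity from a prescribed $T_0$ additionally requires the finitely many short-horizon matrices to remain nonsingular on the compact set.
   Context: $\mathrm{Sp}(2d,\mathbb R)=\{M:M^\top\mathbb JM=\mathbb J\}$ with $\mathbb J=\begin{pmatrix}0&I\\-I&0\end{pmatrix}$; vectors of $\mathbb R^{2d}$ are written $(x,p)$, $x,p\in\mathbb R^d$. A subspace is Lagrangian if it has dimension $d$ and $v^\top\mathbb Jw=0$ for all its elements $v,w$. Hyperbolic: no eigenvalue on the unit circle; $E_s,E_u$ are the invariant subspaces for eigenvalues of modulus $<1$ and $>1$. The superscripts on $D_s,D_u$ are powers; the subscript $T$ of $\mathsf B_T$ is a label. Uniform Green property. Fix norms on finite-dimensional spaces. For a linear $L:\mathbb R^n\times\mathbb R^n\to\mathbb R^n$ and rows $\mathsf B_0,\mathsf B_T\in\mathbb R^{n\times n}$ (here $n=2d$), the triple $(L,\mathsf B_0,\mathsf B_T)$ has the uniform Green property with constants $C_G\ge1$, $\gamma>0$, $T_0\ge1$ if for every integer $T\ge T_0$ and all $f_0,\dots,f_{T-1},b\in\mathbb R^n$ the problem $L[h_t,h_{t+1}]=f_t$ $(0\le t<T)$, $\mathsf B_0h_0+\mathsf B_Th_T=b$ has a unique solution, and it satisfies for $0\le t\le T$ $$\|h_t\|\le C_G\Bigl[(e^{-\gamma t}+e^{-\gamma(T-t)})\|b\|+\sum_{s=0}^{T-1}\kappa_T(t,s)\|f_s\|\Bigr],\quad \kappa_T(t,s)=e^{-\gamma|t-s|}+e^{-\gamma(t+T-s)}+e^{-\gamma(T-t+s)}.$$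 "Holds for all sufficiently large horizons" means that it holds with some constants $(C_G,\gamma,T_1)$; "holds for every $T\ge T_0$" means that it holds with some constants $(C_G,\gamma,T_0)$; a "large-horizon cutoff" is a finite integer, depending on $(M,S)$ and the bases, beyond which all $\widehat\Gamma_T$ are invertible with uniformly bounded inverses; "uniform" means that the constants (and the initial horizon) can be chosen common to the set. *)

theory Defs
  imports "HOL-Analysis.Analysis"
begin

text \<open>
  The space of pairs \<open>(x, p)\<close> with \<open>x, p\<close> in \<open>real ^ 'd\<close> is \<open>real ^ ('d + 'd)\<close>, so \<open>d = CARD('d)\<close> and
  the dimension is \<open>2 d\<close>.  Since a matrix is a vector of rows, \<open>vcat\<close> serves both for
  writing \<open>(x, p)\<close> and for stacking matrices on top of each other.
\<close>

definition vcat :: "'a ^ 'm \<Rightarrow> 'a ^ 'n \<Rightarrow> 'a ^ ('m + 'n)" where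
  "vcat x p = (\<chi> i. case i of Inl j \<Rightarrow> x $ j | Inr j \<Rightarrow> p $ j)"

definition hcat :: "'a ^ 'k ^ 'n \<Rightarrow> 'a ^ 'l ^ 'n \<Rightarrow> 'a ^ ('k + 'l) ^ 'n" where
  "hcat A B = (\<chi> i. vcat (A $ i) (B $ i))"

definition block_mat ::
  "'a ^ 'k ^ 'm \<Rightarrow> 'a ^ 'l ^ 'm \<Rightarrow> 'a ^ 'k ^ 'n \<Rightarrow> 'a ^ 'l ^ 'n \<Rightarrow> 'a ^ ('k + 'l) ^ ('m + 'n)" where
  "block_mat A B C D = vcat (hcat A B) (hcat C D)"

text \<open>The operation \<open>^\<close> on the type of square matrices is the componentwise power.\<close>

definition mat_pow :: "real ^ 'n ^ 'n \<Rightarrow> nat \<Rightarrow> real ^ 'n ^ 'n" where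
  "mat_pow A k = ((\<lambda>B. A ** B) ^^ k) (mat 1)"

definition is_norm :: "('a::real_vector \<Rightarrow> real) \<Rightarrow> bool" where
  "is_norm \<nu> \<longleftrightarrow> (\<forall>x. \<nu> x = 0 \<longleftrightarrow> x = 0) \<and> (\<forall>c x. \<nu> (c *\<^sub>R x) = \<bar>c\<bar> * \<nu> x)
     \<and> (\<forall>x y. \<nu> (x + y) \<le> \<nu> x + \<nu> y)"


subsection \<open>Symplectic and hyperbolic matrices\<close>

definition symp_J :: "real ^ ('d::finite + 'd) ^ ('d + 'd)" where
  "symp_J = block_mat 0 (mat 1) (- mat 1) 0"

definition symplectic :: "real ^ ('d::finite + 'd) ^ ('d + 'd) \<Rightarrow> bool" where
  "symplectic M \<longleftrightarrow> transpose M ** symp_J ** M = symp_J"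

definition lagrangian :: "(real ^ ('d::finite + 'd)) set \<Rightarrow> bool" where
  "lagrangian W \<longleftrightarrow> subspace W \<and> dim W = CARD('d) \<and> (\<forall>v\<in>W. \<forall>w\<in>W. v \<bullet> (symp_J *v w) = 0)"

definition complex_vec :: "real ^ 'n \<Rightarrow> complex ^ 'n" where
  "complex_vec v = (\<chi> i. complex_of_real (v $ i))"

definition is_eigenvalue :: "real ^ 'n ^ 'n \<Rightarrow> complex \<Rightarrow> bool" where
  "is_eigenvalue M \<mu> \<longleftrightarrow> (\<exists>w. w \<noteq> 0 \<and> map_matrix complex_of_real M *v w = \<mu> *s w)"

definition gen_eigenspace :: "real ^ 'n ^ 'n \<Rightarrow> complex \<Rightarrow> (complex ^ 'n) set" where
  "gen_eigenspace M \<mu> =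
     {w. \<exists>k. ((\<lambda>u. map_matrix complex_of_real M *v u - \<mu> *s u) ^^ k) w = 0}"

text \<open>
  The real invariant subspace belonging to the eigenvalues that satisfy \<open>P\<close>: the real vectors in
  the complex span of the corresponding generalized eigenspaces.
\<close>

definition spectral_subspace :: "(complex \<Rightarrow> bool) \<Rightarrow> real ^ 'n ^ 'n \<Rightarrow> (real ^ 'n) set" where
  "spectral_subspace P M =
     {v. complex_vec v \<in> vec.span (\<Union>\<mu>\<in>{\<mu>. is_eigenvalue M \<mu> \<and> P \<mu>}. gen_eigenspace M \<mu>)}"

definition stable_space :: "real ^ 'n ^ 'n \<Rightarrow> (real ^ 'n) set" where
  "stable_space M = spectral_subspace (\<lambda>\<mu>. cmod \<mu> < 1) M"

definition unstable_space :: "real ^ 'n ^ 'n \<Rightarrow> (real ^ 'n) set" where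
  "unstable_space M = spectral_subspace (\<lambda>\<mu>. cmod \<mu> > 1) M"

definition hyperbolic :: "real ^ 'n ^ 'n \<Rightarrow> bool" where
  "hyperbolic M \<longleftrightarrow> (\<forall>\<mu>. is_eigenvalue M \<mu> \<longrightarrow> cmod \<mu> \<noteq> 1)"

definition columns_basis :: "real ^ 'k ^ 'n \<Rightarrow> (real ^ 'n) set \<Rightarrow> bool" where
  "columns_basis V E \<longleftrightarrow>
     inj (\<lambda>j. column j V) \<and> independent (columns V) \<and> span (columns V) = E"

definition hyperbolic_frame ::
  "real ^ 'n ^ 'n \<Rightarrow> real ^ 'k ^ 'n \<Rightarrow> real ^ 'l ^ 'n \<Rightarrow> real ^ 'k ^ 'k \<Rightarrow> real ^ 'l ^ 'l \<Rightarrow> bool" where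
  "hyperbolic_frame M Vs Vu Ds Du \<longleftrightarrow>
     columns_basis Vs (stable_space M) \<and> columns_basis Vu (unstable_space M) \<and>
     M ** Vs = Vs ** Ds \<and> M ** Vu = Vu ** Du"


subsection \<open>The uniform Green property\<close>

definition bvp_solution ::
  "((real ^ 'n) \<times> (real ^ 'n) \<Rightarrow> real ^ 'n) \<Rightarrow> real ^ 'n ^ 'n \<Rightarrow> real ^ 'n ^ 'n \<Rightarrow> nat \<Rightarrow>
   (nat \<Rightarrow> real ^ 'n) \<Rightarrow> real ^ 'n \<Rightarrow> (nat \<Rightarrow> real ^ 'n) \<Rightarrow> bool" where
  "bvp_solution L B0 BT T f b h \<longleftrightarrow>
     (\<forall>t<T. L (h t, h (Suc t)) = f t) \<and> B0 *v h 0 + BT *v h T = b"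

definition green_kernel :: "real \<Rightarrow> nat \<Rightarrow> nat \<Rightarrow> nat \<Rightarrow> real" where
  "green_kernel \<gamma> T t s =
     exp (- \<gamma> * \<bar>real t - real s\<bar>) + exp (- \<gamma> * (real t + real T - real s))
       + exp (- \<gamma> * (real T - real t + real s))"

text \<open>
  Only the values \<open>f s\<close> with \<open>s < T\<close> and \<open>h t\<close> with \<open>t \<le> T\<close> matter; restricting \<open>h\<close> to
  \<open>extensional {..T}\<close> makes it a finite sequence, so that unique existence is meaningful.
\<close>

definition uniform_green ::
  "(real ^ 'n \<Rightarrow> real) \<Rightarrow> ((real ^ 'n) \<times> (real ^ 'n) \<Rightarrow> real ^ 'n) \<Rightarrow>
   real ^ 'n ^ 'n \<Rightarrow> real ^ 'n ^ 'n \<Rightarrow> real \<Rightarrow> real \<Rightarrow> nat \<Rightarrow> bool" where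
  "uniform_green \<nu> L B0 BT C \<gamma> T0 \<longleftrightarrow>
     linear L \<and> C \<ge> 1 \<and> \<gamma> > 0 \<and> T0 \<ge> 1 \<and>
     (\<forall>T\<ge>T0. \<forall>f b.
        (\<exists>!h. h \<in> extensional {..T} \<and> bvp_solution L B0 BT T f b h) \<and>
        (\<forall>h. bvp_solution L B0 BT T f b h \<longrightarrow>
           (\<forall>t\<le>T. \<nu> (h t) \<le>
              C * ((exp (- \<gamma> * real t) + exp (- \<gamma> * (real T - real t))) * \<nu> b
                   + (\<Sum>s<T. green_kernel \<gamma> T t s * \<nu> (f s))))))"


subsection \<open>The symplectic endpoint problem\<close>

definition step_map :: "real ^ 'n ^ 'n \<Rightarrow> (real ^ 'n) \<times> (real ^ 'n) \<Rightarrow> real ^ 'n" where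
  "step_map M = (\<lambda>(h, h'). h' - M *v h)"

definition row_0 :: "real ^ ('d::finite + 'd) ^ ('d + 'd)" where
  "row_0 = block_mat (mat 1) 0 0 0"

definition row_T :: "real ^ 'd ^ 'd \<Rightarrow> real ^ ('d + 'd) ^ ('d + 'd)" where
  "row_T S = block_mat 0 0 (- S) (mat 1)"

definition green_endpoint ::
  "(real ^ ('d + 'd) \<Rightarrow> real) \<Rightarrow> (real ^ ('d + 'd) ^ ('d + 'd)) \<times> (real ^ 'd ^ 'd) \<Rightarrow>
   real \<Rightarrow> real \<Rightarrow> nat \<Rightarrow> bool" where
  "green_endpoint \<nu> = (\<lambda>(M, S). uniform_green \<nu> (step_map M) row_0 (row_T S))"

definition gamma_inf ::
  "real ^ 'd ^ 'd \<Rightarrow> real ^ 'd ^ ('d + 'd) \<Rightarrow> real ^ 'd ^ ('d + 'd) \<Rightarrow> real ^ ('d + 'd) ^ ('d + 'd)" where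
  "gamma_inf S Vs Vu = hcat (row_0 ** Vs) (row_T S ** Vu)"

text \<open>
  In a hyperbolic frame the eigenvalues of \<open>Du\<close> have modulus greater than 1, so \<open>matrix_inv Du\<close>
  is a genuine inverse.
\<close>

definition gamma_fin ::
  "real ^ 'd ^ 'd \<Rightarrow> real ^ 'd ^ ('d + 'd) \<Rightarrow> real ^ 'd ^ ('d + 'd) \<Rightarrow>
   real ^ 'd ^ 'd \<Rightarrow> real ^ 'd ^ 'd \<Rightarrow> nat \<Rightarrow> real ^ ('d + 'd) ^ ('d + 'd)" where
  "gamma_fin S Vs Vu Ds Du T =
     hcat (row_0 ** Vs + row_T S ** Vs ** mat_pow Ds T)
          (row_0 ** Vu ** mat_pow (matrix_inv Du) T + row_T S ** Vu)"

definition horizon_cutoff ::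
  "real ^ 'd ^ 'd \<Rightarrow> real ^ 'd ^ ('d + 'd) \<Rightarrow> real ^ 'd ^ ('d + 'd) \<Rightarrow>
   real ^ 'd ^ 'd \<Rightarrow> real ^ 'd ^ 'd \<Rightarrow> nat \<Rightarrow> bool" where
  "horizon_cutoff S Vs Vu Ds Du Tc \<longleftrightarrow>
     (\<forall>T\<ge>Tc. invertible (gamma_fin S Vs Vu Ds Du T)) \<and>
     bounded ((\<lambda>T. matrix_inv (gamma_fin S Vs Vu Ds Du T)) ` {Tc..})"

definition graph_cond_s :: "real ^ ('d::finite + 'd) ^ ('d + 'd) \<Rightarrow> bool" where
  "graph_cond_s M \<longleftrightarrow> stable_space M \<inter> range (\<lambda>p :: real ^ 'd. vcat 0 p) = {0}"

definition graph_cond_u :: "real ^ ('d + 'd) ^ ('d + 'd) \<Rightarrow> real ^ 'd ^ 'd \<Rightarrow> bool" where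
  "graph_cond_u M S \<longleftrightarrow> unstable_space M \<inter> range (\<lambda>x. vcat x (S *v x)) = {0}"

definition hyperbolic_region ::
  "((real ^ ('d + 'd) ^ ('d + 'd)) \<times> (real ^ 'd ^ 'd)) set" where
  "hyperbolic_region = {(M, S). symplectic M \<and> hyperbolic M \<and> transpose S = S}"

definition graph_region ::
  "((real ^ ('d + 'd) ^ ('d + 'd)) \<times> (real ^ 'd ^ 'd)) set" where
  "graph_region = {(M, S) \<in> hyperbolic_region. graph_cond_s M \<and> graph_cond_u M S}"

end

theory Submission
  imports Defs "HOL-Computational_Algebra.Fundamental_Theorem_Algebra"
begin

text \<open>
  The stable and unstable spaces consist of the vectors whose orbits under \<open>M\<close>, respectively its
  inverse, decay exponentially.  They are isotropic because the symplectic form is invariant along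
  such orbits, and they span the space, so both have dimension \<open>d\<close>.

  In a frame, a solution with zero forcing is given by a stable datum at time \<open>0\<close> and an unstable
  datum at time \<open>T\<close>, and the scaled endpoint matrix sends these two data to the boundary value.
  The Green bound from a given initial horizon is therefore equivalent to bounded invertibility of
  the scaled endpoint matrices from that horizon on.  They converge to the limit matrix, so the bound
  holds for some initial horizon exactly when the graph conditions hold.

  Openness and uniformity on compact sets do not need continuity of the spectral subspaces: the
  Green bound itself survives small perturbations of \<open>M\<close> and \<open>S\<close>, with the same initial horizon
  and slightly worse constants.
\<close>

section \<open>Exponentially decaying orbits\<close>

text \<open>Decay is a property of a single orbit, makes sense over the reals and the complex
  numbers alike, and passes through bounded linear maps that intertwine the dynamics. The spectral
  definition of the two subspaces is unfolded only in \<open>hyperbolic_splitting\<close>. The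
  equivalence between the Green bound and the scaled matrices is needed in both directions with the
  same initial horizon: one direction produces the bound, the other turns its openness into openness
  of the graph conditions and recovers nonsingularity at short horizons. The obstacle in perturbing
  the bound is that composing the kernel with itself must not enlarge it as T grows. On a cycle of
  times a single exponential of the distance is submultiplicative; giving up half of its rate leaves
  a kernel whose sum is bounded independently of T. This is the origin of the halved rate and the
  doubled constant. Since every perturbation worsens the constants, the compactness argument orders
  all of them along one index.\<close>

definition decay_space :: "('a::real_normed_vector \<Rightarrow> 'a) \<Rightarrow> 'a set" where
  "decay_space f = {w. \<exists>C r. 0 \<le> r \<and> r < 1 \<and> (\<forall>k. norm ((f ^^ k) w) \<le> C * r ^ k)}"

lemma linear_funpow:
  fixes f :: "'a::real_vector \<Rightarrow> 'a"
  assumes "linear f"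
  shows "linear (f ^^ k)"
proof (induction k)
  case 0
  show ?case by (simp add: linear_iff)
next
  case (Suc k)
  show ?case using linear_compose[OF Suc assms] by (simp only: funpow.simps)
qed

lemma decay_spaceI:
  assumes "0 \<le> r" "r < 1" "\<And>k. norm ((f ^^ k) w) \<le> C * r ^ k"
  shows "w \<in> decay_space f"
  using assms unfolding decay_space_def by blast

text \<open>Raising C and r to positive values costs nothing. A positive rate is needed later, when
  its logarithm becomes the Green exponent.\<close>

lemma decay_spaceE:
  assumes "w \<in> decay_space f"
  obtains C r where "0 < r" "r < 1" "0 < C" "\<And>k. norm ((f ^^ k) w) \<le> C * r ^ k"
proof -
  obtain C r where *: "0 \<le> r" "r < 1" "\<And>k. norm ((f ^^ k) w) \<le> C * r ^ k"
    using assms unfolding decay_space_def by blast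
  have le: "norm ((f ^^ k) w) \<le> max C 1 * max r (1/2) ^ k" for k
    by (rule order_trans[OF *(3)], rule mult_mono)
       (use *(1) in \<open>auto intro!: power_mono\<close>)
  show ?thesis
    by (rule that[OF _ _ _ le]) (use *(2) in auto)
qed

lemma decay_space_add:
  assumes f: "linear f" and v: "v \<in> decay_space f" and w: "w \<in> decay_space f"
  shows "v + w \<in> decay_space f"
proof -
  obtain C r where 1: "0 < r" "r < 1" "0 < C" "\<And>k. norm ((f ^^ k) v) \<le> C * r ^ k"
    by (rule decay_spaceE[OF v], rule that)
  obtain D q where 2: "0 < q" "q < 1" "0 < D" "\<And>k. norm ((f ^^ k) w) \<le> D * q ^ k"
    by (rule decay_spaceE[OF w], rule that)
  show ?thesis
  proof (rule decay_spaceI[of "max r q"])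
    fix k
    have "norm ((f ^^ k) (v + w)) \<le> norm ((f ^^ k) v) + norm ((f ^^ k) w)"
      by (simp add: linear_add[OF linear_funpow[OF f]] norm_triangle_ineq)
    also have "\<dots> \<le> C * r ^ k + D * q ^ k" using 1(4) 2(4) by (rule add_mono)
    also have "\<dots> \<le> C * max r q ^ k + D * max r q ^ k"
      using 1 2 by (intro add_mono mult_left_mono power_mono) auto
    finally show "norm ((f ^^ k) (v + w)) \<le> (C + D) * max r q ^ k"
      by (simp add: distrib_right)
  qed (use 1 2 in auto)
qed

text \<open>Intertwining is required only along the orbit of w, so one lemma covers real and complex
  scaling, real parts, and the passage by M or its inverse.\<close>

lemma decay_space_image:
  assumes w: "w \<in> decay_space f" and h: "bounded_linear h"
    and comm: "\<And>k. (g ^^ k) (h w) = h ((f ^^ k) w)"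
  shows "h w \<in> decay_space g"
proof -
  obtain C r where 1: "0 < r" "r < 1" "0 < C" "\<And>k. norm ((f ^^ k) w) \<le> C * r ^ k"
    by (rule decay_spaceE[OF w], rule that)
  show ?thesis
  proof (rule decay_spaceI[of r])
    fix k
    have "norm ((g ^^ k) (h w)) \<le> onorm h * norm ((f ^^ k) w)"
      using onorm[OF h] comm by simp
    also have "\<dots> \<le> onorm h * (C * r ^ k)"
      using 1(4) onorm_pos_le[OF h] by (rule mult_left_mono)
    finally show "norm ((g ^^ k) (h w)) \<le> onorm h * C * r ^ k" by simp
  qed (use 1 in auto)
qed

lemma subspace_decay_space:
  assumes f: "linear f"
  shows "subspace (decay_space f)"
  unfolding subspace_def
proof (intro conjI ballI allI)
  have "linear (f ^^ k)" for k using f by (rule linear_funpow)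
  then have z: "(f ^^ k) 0 = 0" for k by (rule linear_0)
  show "0 \<in> decay_space f"
    by (rule decay_spaceI[of 0 f 0 0]) (simp_all add: z)
  show "v + w \<in> decay_space f" if "v \<in> decay_space f" "w \<in> decay_space f" for v w
    using decay_space_add[OF f that] .
  show "c *\<^sub>R w \<in> decay_space f" if "w \<in> decay_space f" for c w
    using that bounded_linear_scaleR_right[of c] linear_scale[OF linear_funpow[OF f]]
    by (rule decay_space_image)
qed

text \<open>Each vector comes with its own C and r. Taking the worst pair over a finite orthonormal
  basis, and bounding the coordinates of w by its norm, makes the pair common to the space.\<close>

lemma decay_space_uniform:
  fixes f :: "'a::euclidean_space \<Rightarrow> 'a"
  assumes f: "linear f"
  obtains C r where "0 < C" "0 < r" "r < 1"
    "\<And>w k. w \<in> decay_space f \<Longrightarrow> norm ((f ^^ k) w) \<le> C * r ^ k * norm w"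
proof -
  obtain B where B: "B \<subseteq> decay_space f" "pairwise orthogonal B" "\<And>x. x \<in> B \<Longrightarrow> norm x = 1"
    "independent B" "span B = decay_space f"
    by (rule orthonormal_basis_subspace[OF subspace_decay_space[OF f]], rule that)
  have fin: "finite B" using B(4) by (simp add: independent_imp_finite)
  have "\<exists>C r. 0 < C \<and> 0 < r \<and> r < 1 \<and> (\<forall>b\<in>A. \<forall>k. norm ((f ^^ k) b) \<le> C * r ^ k)"
    if "finite A" "A \<subseteq> decay_space f" for A
    using that
  proof (induction A rule: finite_induct)
    case empty
    show ?case by (intro exI[of _ 1] exI[of _ "1/2"]) auto
  next
    case (insert a A)
    then obtain C r where 1: "0 < C" "0 < r" "r < 1" "\<And>b k. b \<in> A \<Longrightarrow> norm ((f ^^ k) b) \<le> C * r ^ k"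
      by auto
    obtain D q where 2: "0 < q" "q < 1" "0 < D" "\<And>k. norm ((f ^^ k) a) \<le> D * q ^ k"
      by (rule decay_spaceE[of a f]) (use insert.prems in auto)
    have a: "norm ((f ^^ k) a) \<le> max C D * max r q ^ k" for k
      by (rule order_trans[OF 2(4)], rule mult_mono) (use 1 2 in \<open>auto intro!: power_mono\<close>)
    have b: "norm ((f ^^ k) b) \<le> max C D * max r q ^ k" if "b \<in> A" for b k
      by (rule order_trans[OF 1(4)[OF that]], rule mult_mono) (use 1 2 in \<open>auto intro!: power_mono\<close>)
    show ?case
      by (rule exI[of _ "max C D"], rule exI[of _ "max r q"]) (use 1 2 a b in auto)
  qed
  from this[OF fin B(1)] obtain C r where C: "0 < C" "0 < r" "r < 1"
    "\<And>b k. b \<in> B \<Longrightarrow> norm ((f ^^ k) b) \<le> C * r ^ k"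
    by blast
  \<comment> \<open>Summing over the basis gives the factor \<open>card B\<close>; the 1 keeps the
    constant positive if the space is trivial.\<close>
  have "norm ((f ^^ k) w) \<le> (C * card B + 1) * r ^ k * norm w" if w: "w \<in> decay_space f" for w k
  proof -
    interpret linear "f ^^ k" using f by (rule linear_funpow)
    have "w = (\<Sum>b\<in>B. (w \<bullet> b) *\<^sub>R b)"
      using orthonormal_basis_expand[OF B(2) B(3) _ fin, of w] w B(5) by simp
    then have "(f ^^ k) w = (f ^^ k) (\<Sum>b\<in>B. (w \<bullet> b) *\<^sub>R b)" by simp
    also have "\<dots> = (\<Sum>b\<in>B. (w \<bullet> b) *\<^sub>R (f ^^ k) b)" by (simp add: sum scale)
    also have "norm \<dots> \<le> (\<Sum>b\<in>B. norm w * (C * r ^ k))"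
    proof (rule sum_norm_le)
      fix b assume b: "b \<in> B"
      have "\<bar>w \<bullet> b\<bar> \<le> norm w" using Cauchy_Schwarz_ineq2[of w b] B(3)[OF b] by simp
      then show "norm ((w \<bullet> b) *\<^sub>R (f ^^ k) b) \<le> norm w * (C * r ^ k)"
        using C(4)[OF b] by (simp add: mult_mono)
    qed
    also have "\<dots> = C * card B * r ^ k * norm w" by simp
    also have "\<dots> \<le> (C * card B + 1) * r ^ k * norm w"
      using C by (intro mult_right_mono) auto
    finally show ?thesis .
  qed
  with C show ?thesis
    by (intro that[of "C * card B + 1" r]) (auto intro!: add_nonneg_pos)
qed

lemma funpow_left_inverse:
  fixes f g :: "'a \<Rightarrow> 'a"
  assumes "\<And>x. f (g x) = x"
  shows "(f ^^ k) ((g ^^ k) x) = x"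
  by (induction k arbitrary: x) (simp_all add: assms funpow_swap1[of f])

text \<open>Write w as the k-th f-image of its k-th g-image. The g-image stays in the decay space of
  f, so the uniform constant applies to it, and w is bounded by two decaying factors at
  once.\<close>

lemma decay_space_inter_inverse:
  fixes f :: "'a::euclidean_space \<Rightarrow> 'a"
  assumes f: "linear f" and g: "linear g" and fg: "\<And>x. f (g x) = x" and gf: "\<And>x. g (f x) = x"
    and w: "w \<in> decay_space f" "w \<in> decay_space g"
  shows "w = 0"
proof -
  obtain C r where C: "0 < C" "0 < r" "r < 1"
    "\<And>w k. w \<in> decay_space f \<Longrightarrow> norm ((f ^^ k) w) \<le> C * r ^ k * norm w"
    by (rule decay_space_uniform[OF f], rule that)
  obtain D q where D: "0 < q" "q < 1" "0 < D" "\<And>k. norm ((g ^^ k) w) \<le> D * q ^ k"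
    by (rule decay_spaceE[OF w(2)], rule that)
  have comm: "(f ^^ n) (g x) = g ((f ^^ n) x)" for n x
    by (induction n arbitrary: x) (simp_all add: fg gf)
  have mem: "(g ^^ k) w \<in> decay_space f" for k
  proof (induction k)
    case (Suc k)
    from decay_space_image[OF Suc linear_conv_bounded_linear[THEN iffD1, OF g] comm]
    show ?case by simp
  qed (simp add: w)
  have "norm w \<le> C * D * (r * q) ^ k" for k
  proof -
    have "norm w \<le> C * r ^ k * norm ((g ^^ k) w)"
      using C(4)[OF mem, of k k] by (simp add: funpow_left_inverse[of f g, OF fg])
    also have "\<dots> \<le> C * r ^ k * (D * q ^ k)"
      using D(4) C by (intro mult_left_mono) auto
    finally show ?thesis by (simp add: power_mult_distrib algebra_simps)
  qed
  moreover have "r * q < 1" using C D by (smt (verit) mult_le_one mult_left_le)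
  then have "(\<lambda>k. C * D * (r * q) ^ k) \<longlonglongrightarrow> C * D * 0"
    using C D by (intro tendsto_intros LIMSEQ_power_zero) auto
  ultimately have "norm w \<le> C * D * 0"
    by (intro LIMSEQ_le_const[where a="norm w"]) auto
  then show ?thesis by simp
qed

text \<open>Discrete Gronwall: a contraction driven by a decaying forcing decays. If the two rates
  coincide, the orbit may pick up a polynomial factor, so a strictly slower rate is chosen.\<close>

lemma decay_space_recurrence:
  assumes u: "u \<in> decay_space f" and l: "0 \<le> l" "l < 1"
    and step: "\<And>k. norm ((f ^^ Suc k) w) \<le> l * norm ((f ^^ k) w) + norm ((f ^^ k) u)"
  shows "w \<in> decay_space f"
proof -
  obtain D q where D: "0 < q" "q < 1" "0 < D" "\<And>k. norm ((f ^^ k) u) \<le> D * q ^ k"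
    by (rule decay_spaceE[OF u], rule that)
  define r where "r = (max l q + 1) / 2"
  have r: "l < r" "q < r" "r < 1" "0 < r" using l D by (auto simp: r_def)
  \<comment> \<open>The first entry covers the start of the orbit, the second makes D at most C (r -
    l), which closes the induction.\<close>
  define C where "C = max (norm w) (D / (r - l))"
  have CD: "D \<le> C * (r - l)"
    using r unfolding C_def by (simp add: max_def field_simps)
  have C0: "0 \<le> C" unfolding C_def by (simp add: le_max_iff_disj)
  have "norm ((f ^^ k) w) \<le> C * r ^ k" for k
  proof (induction k)
    case 0
    show ?case by (simp add: C_def)
  next
    case (Suc k)
    have "norm ((f ^^ Suc k) w) \<le> l * (C * r ^ k) + D * q ^ k"
      using step[of k] mult_left_mono[OF Suc l(1)] D(4)[of k] by linarith
    also have "\<dots> \<le> l * (C * r ^ k) + C * (r - l) * r ^ k"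
      using CD D r C0 by (intro add_left_mono mult_mono power_mono) auto
    also have "\<dots> = C * r ^ Suc k" by (simp add: algebra_simps)
    finally show ?case .
  qed
  with r show ?thesis by (intro decay_spaceI[of r]) auto
qed

section \<open>Spectral decomposition\<close>

abbreviation complex_mat :: "real ^ 'n ^ 'm \<Rightarrow> complex ^ 'n ^ 'm" where
  "complex_mat \<equiv> map_matrix complex_of_real"

abbreviation eig_shift :: "real ^ 'n ^ 'n \<Rightarrow> complex \<Rightarrow> complex ^ 'n \<Rightarrow> complex ^ 'n" where
  "eig_shift M \<mu> \<equiv> \<lambda>u. complex_mat M *v u - \<mu> *s u"

lemma vec_linear_eig_shift: "Vector_Spaces.linear (*s) (*s) (eig_shift M \<mu>)"
  by unfold_locales
    (simp_all add: matrix_vector_right_distrib vector_scalar_commute vec.scale_right_distrib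
      vec.scale_right_diff_distrib mult.commute)

lemma vec_linear_eig_shift_pow: "Vector_Spaces.linear (*s) (*s) (eig_shift M \<mu> ^^ k)"
proof (induction k)
  case 0
  show ?case by unfold_locales simp_all
next
  case (Suc k)
  show ?case using Vector_Spaces.linear_compose[OF Suc vec_linear_eig_shift] by (simp only: funpow.simps)
qed

interpretation eig_shift_pow: Vector_Spaces.linear "(*s)" "(*s)" "eig_shift M \<mu> ^^ k"
  by (rule vec_linear_eig_shift_pow)

lemma gen_eigenspaceI: "(eig_shift M \<mu> ^^ k) w = 0 \<Longrightarrow> w \<in> gen_eigenspace M \<mu>"
  unfolding gen_eigenspace_def by blast

lemma gen_eigenspace_pow_mono:
  assumes "(eig_shift M \<mu> ^^ k) w = 0" "k \<le> l"
  shows "(eig_shift M \<mu> ^^ l) w = 0"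
proof -
  have "eig_shift M \<mu> ^^ l = (eig_shift M \<mu> ^^ (l - k)) \<circ> (eig_shift M \<mu> ^^ k)"
    using assms(2) by (simp add: funpow_add[symmetric])
  with assms(1) show ?thesis by (simp add: eig_shift_pow.zero)
qed

lemma vec_subspace_gen_eigenspace: "vec.subspace (gen_eigenspace M \<mu>)"
proof (rule vec.subspaceI)
  show "0 \<in> gen_eigenspace M \<mu>" by (rule gen_eigenspaceI[where k = 0]) simp
  fix x y assume "x \<in> gen_eigenspace M \<mu>" "y \<in> gen_eigenspace M \<mu>"
  then obtain k l where kl: "(eig_shift M \<mu> ^^ k) x = 0" "(eig_shift M \<mu> ^^ l) y = 0"
    unfolding gen_eigenspace_def by blast
  show "x + y \<in> gen_eigenspace M \<mu>"
    by (rule gen_eigenspaceI[where k = "max k l"])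
      (simp add: eig_shift_pow.add gen_eigenspace_pow_mono[OF kl(1)] gen_eigenspace_pow_mono[OF kl(2)])
next
  fix c x assume "x \<in> gen_eigenspace M \<mu>"
  then obtain k where "(eig_shift M \<mu> ^^ k) x = 0"
    unfolding gen_eigenspace_def by blast
  then show "c *s x \<in> gen_eigenspace M \<mu>"
    by (intro gen_eigenspaceI[where k = k]) (simp add: eig_shift_pow.scale)
qed

lemma gen_eigenspace_shiftD:
  assumes "eig_shift M \<mu> w \<in> gen_eigenspace M \<mu>"
  shows "w \<in> gen_eigenspace M \<mu>"
proof -
  obtain k where "(eig_shift M \<mu> ^^ k) (eig_shift M \<mu> w) = 0"
    using assms unfolding gen_eigenspace_def by blast
  then show ?thesis by (intro gen_eigenspaceI[where k = "Suc k"]) (simp add: funpow_Suc_right del: funpow.simps)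
qed

text \<open>On the generalized eigenspace of l the shift by \<mu> is a nilpotent map plus the
  nonzero scalar l - \<mu>, so it is onto. The induction runs on the nilpotency order.\<close>

lemma gen_eigenspace_shift_surj:
  assumes ne: "l \<noteq> \<mu>" and u: "u \<in> gen_eigenspace M l"
  shows "\<exists>g\<in>gen_eigenspace M l. eig_shift M \<mu> g = u"
proof -
  note sub = vec_subspace_gen_eigenspace[of M l]
  have "\<exists>g\<in>gen_eigenspace M l. eig_shift M \<mu> g = u" if "(eig_shift M l ^^ k) u = 0" for k
    using that
  proof (induction k arbitrary: u)
    case 0
    then show ?case using vec.subspace_0[OF sub] by (intro bexI[of _ 0]) auto
  next
    case (Suc k)
    from Suc.prems have "(eig_shift M l ^^ k) (eig_shift M l u) = 0"
      by (simp add: funpow_Suc_right del: funpow.simps)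
    from Suc.IH[OF this] obtain g where g: "g \<in> gen_eigenspace M l" "eig_shift M \<mu> g = eig_shift M l u"
      by blast
    \<comment> \<open>Since g solves the equation for \<open>eig_shift M l u\<close>, applying
      \<open>eig_shift M \<mu>\<close> to u - g leaves (l - \<mu>) u.\<close>
    let ?g = "(1 / (l - \<mu>)) *s (u - g)"
    have "?g \<in> gen_eigenspace M l"
      using gen_eigenspaceI[OF Suc.prems] g sub
      by (intro vec.subspace_scale vec.subspace_diff) auto
    moreover have "eig_shift M \<mu> ?g = u"
    proof -
      have "eig_shift M \<mu> ?g = (1 / (l - \<mu>)) *s (eig_shift M \<mu> u - eig_shift M \<mu> g)"
        by (simp add: vector_scalar_commute matrix_vector_mult_diff_distrib
          vec.scale_right_diff_distrib algebra_simps)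
      also have "eig_shift M \<mu> u - eig_shift M \<mu> g = (l - \<mu>) *s u"
        unfolding g(2) by (simp add: vec.scale_left_diff_distrib)
      also have "(1 / (l - \<mu>)) *s ((l - \<mu>) *s u) = u"
        unfolding vec.scale_scale using ne by simp
      finally show ?thesis .
    qed
    ultimately show ?case by blast
  qed
  with u show ?thesis unfolding gen_eigenspace_def by blast
qed

section \<open>Generalized eigenvectors span the complex space\<close>

definition gen_eigenvectors_span :: "real ^ 'n ^ 'n \<Rightarrow> (complex ^ 'n) set" where
  "gen_eigenvectors_span M = vec.span (\<Union>\<mu>. gen_eigenspace M \<mu>)"

text \<open>The shift by \<mu> is onto on every other generalized eigenspace, so each u in the span
  is the shift of some g in the span up to an element of the \<mu>-space. Correcting w by g moves
  the remaining defect into the \<mu>-space, where further shifts kill it.\<close>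

lemma gen_eigenvectors_span_shiftD:
  assumes "eig_shift M \<mu> w \<in> gen_eigenvectors_span M"
  shows "w \<in> gen_eigenvectors_span M"
proof -
  let ?G = "gen_eigenvectors_span M"
  have sub: "vec.subspace ?G" unfolding gen_eigenvectors_span_def by (rule vec.subspace_span)
  note subg = vec_subspace_gen_eigenspace[of M \<mu>]
  have incl: "g \<in> ?G" if "g \<in> gen_eigenspace M l" for g l
    unfolding gen_eigenvectors_span_def using that by (intro vec.span_base) auto
  have "\<exists>g\<in>?G. u - eig_shift M \<mu> g \<in> gen_eigenspace M \<mu>" if "u \<in> ?G" for u
    using that[unfolded gen_eigenvectors_span_def]
  proof (induction rule: vec.span_induct)
    case base
    show ?case
    proof (rule vec.subspaceI)
      show "0 \<in> {u. \<exists>g\<in>?G. u - eig_shift M \<mu> g \<in> gen_eigenspace M \<mu>}"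
        using vec.subspace_0[OF sub] vec.subspace_0[OF subg] by (auto intro!: bexI[of _ 0])
    next
      fix x y
      assume "x \<in> {u. \<exists>g\<in>?G. u - eig_shift M \<mu> g \<in> gen_eigenspace M \<mu>}"
        "y \<in> {u. \<exists>g\<in>?G. u - eig_shift M \<mu> g \<in> gen_eigenspace M \<mu>}"
      then obtain g h where *: "g \<in> ?G" "x - eig_shift M \<mu> g \<in> gen_eigenspace M \<mu>"
        "h \<in> ?G" "y - eig_shift M \<mu> h \<in> gen_eigenspace M \<mu>" by blast
      have "x + y - eig_shift M \<mu> (g + h) = (x - eig_shift M \<mu> g) + (y - eig_shift M \<mu> h)"
        by (simp add: algebra_simps vec.scale_right_distrib)
      then have "x + y - eig_shift M \<mu> (g + h) \<in> gen_eigenspace M \<mu>"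
        using vec.subspace_add[OF subg *(2,4)] by (simp only:)
      then show "x + y \<in> {u. \<exists>g\<in>?G. u - eig_shift M \<mu> g \<in> gen_eigenspace M \<mu>}"
        using vec.subspace_add[OF sub *(1,3)] by blast
    next
      fix c x
      assume "x \<in> {u. \<exists>g\<in>?G. u - eig_shift M \<mu> g \<in> gen_eigenspace M \<mu>}"
      then obtain g where *: "g \<in> ?G" "x - eig_shift M \<mu> g \<in> gen_eigenspace M \<mu>" by blast
      have "c *s x - eig_shift M \<mu> (c *s g) = c *s (x - eig_shift M \<mu> g)"
        by (simp add: vector_scalar_commute vec.scale_right_diff_distrib mult.commute)
      then have "c *s x - eig_shift M \<mu> (c *s g) \<in> gen_eigenspace M \<mu>"
        using vec.subspace_scale[OF subg *(2)] by (simp only:)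
      then show "c *s x \<in> {u. \<exists>g\<in>?G. u - eig_shift M \<mu> g \<in> gen_eigenspace M \<mu>}"
        using vec.subspace_scale[OF sub *(1)] by blast
    qed
  next
    case (step u)
    then obtain l where l: "u \<in> gen_eigenspace M l" by blast
    show ?case
    proof (cases "l = \<mu>")
      case True
      then show ?thesis using l vec.subspace_0[OF sub] by (intro bexI[of _ 0]) auto
    next
      case False
      from gen_eigenspace_shift_surj[OF this l] obtain g
        where "g \<in> gen_eigenspace M l" "eig_shift M \<mu> g = u" by blast
      then show ?thesis
        using incl vec.subspace_0[OF subg] by (intro bexI[of _ g]) auto
    qed
  qed
  from this[OF assms] obtain g where g: "g \<in> ?G"
    "eig_shift M \<mu> w - eig_shift M \<mu> g \<in> gen_eigenspace M \<mu>" by blast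
  have "eig_shift M \<mu> (w - g) = eig_shift M \<mu> w - eig_shift M \<mu> g"
    by (simp add: algebra_simps vec.scale_right_diff_distrib)
  with g(2) have "eig_shift M \<mu> (w - g) \<in> gen_eigenspace M \<mu>" by (simp only:)
  then have "w - g \<in> ?G" by (rule incl[OF gen_eigenspace_shiftD])
  from vec.subspace_add[OF sub this g(1)] show ?thesis by simp
qed

text \<open>This is p(A) = q(A)(A - \<mu>) for p = (X - \<mu>) q, written as sums of iterates. An
  upper bound n replaces the degree because the induction below tracks only such a bound.\<close>

lemma sum_coeff_linear_factor:
  fixes A :: "complex ^ 'n ^ 'n"
  assumes "degree q \<le> n"
  shows "(\<Sum>i\<le>Suc n. coeff ([:- \<mu>, 1:] * q) i *s ((*v) A ^^ i) w) =
         (\<Sum>i\<le>n. coeff q i *s ((*v) A ^^ i) (A *v w - \<mu> *s w))"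
proof -
  define x where "x i = ((*v) A ^^ i) w" for i
  have pow: "((*v) A ^^ i) (A *v w - \<mu> *s w) = x (Suc i) - \<mu> *s x i" for i
    by (induction i)
      (simp_all add: x_def matrix_vector_mult_diff_distrib vector_scalar_commute)
  have c: "coeff ([:- \<mu>, 1:] * q) i = (case i of 0 \<Rightarrow> 0 | Suc j \<Rightarrow> coeff q j) - \<mu> * coeff q i" for i
    by (cases i) simp_all
  have z: "coeff q (Suc n) = 0" using assms by (intro coeff_eq_0) simp
  have "(\<Sum>i\<le>Suc n. coeff ([:- \<mu>, 1:] * q) i *s x i) =
        (\<Sum>i\<le>Suc n. (case i of 0 \<Rightarrow> 0 | Suc j \<Rightarrow> coeff q j) *s x i) - (\<Sum>i\<le>Suc n. (\<mu> * coeff q i) *s x i)"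
    unfolding c by (simp only: vec.scale_left_diff_distrib sum_subtractf)
  also have "(\<Sum>i\<le>Suc n. (case i of 0 \<Rightarrow> 0 | Suc j \<Rightarrow> coeff q j) *s x i) = (\<Sum>i\<le>n. coeff q i *s x (Suc i))"
    by (subst sum.atMost_Suc_shift) simp
  also have "(\<Sum>i\<le>Suc n. (\<mu> * coeff q i) *s x i) = (\<Sum>i\<le>n. (\<mu> * coeff q i) *s x i)"
    by (simp add: z)
  finally show ?thesis
    unfolding pow x_def[symmetric]
    by (simp add: sum_subtractf vec.scale_right_diff_distrib mult.commute)
qed

text \<open>A root of p splits off a linear factor: the quotient annihilates the shifted vector, and
  the shift is then undone inside the span.\<close>

lemma annihilated_in_gen_eigenvectors_span:
  assumes "p \<noteq> 0" "degree p \<le> n" "(\<Sum>i\<le>n. coeff p i *s ((*v) (complex_mat M) ^^ i) w) = 0"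
  shows "w \<in> gen_eigenvectors_span M"
  using assms
proof (induction n arbitrary: p w)
  case 0
  then have "degree p = 0" by simp
  then obtain c where "p = [:c:]" by (rule degree_eq_zeroE)
  with 0 have "w = 0" by simp
  then show ?case unfolding gen_eigenvectors_span_def by (simp add: vec.span_zero)
next
  case (Suc n)
  show ?case
  proof (cases "degree p = 0")
    case True
    then obtain c where c: "p = [:c:]" by (rule degree_eq_zeroE)
    with Suc.prems(1) have "c \<noteq> 0" by simp
    have "(\<Sum>i\<le>Suc n. coeff p i *s ((*v) (complex_mat M) ^^ i) w) = c *s w"
      unfolding c by (subst sum.atMost_Suc_shift) simp
    with Suc.prems(3) \<open>c \<noteq> 0\<close> have "w = 0" by simp
    then show ?thesis unfolding gen_eigenvectors_span_def by (simp add: vec.span_zero)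
  next
    case False
    then have "\<not> constant (poly p)" by (simp add: constant_degree)
    then obtain \<mu> where "poly p \<mu> = 0" using fundamental_theorem_of_algebra by blast
    then obtain q where q: "p = [:- \<mu>, 1:] * q" by (metis poly_eq_0_iff_dvd dvdE)
    with Suc.prems(1) have q0: "q \<noteq> 0" by auto
    have "degree p = Suc (degree q)" unfolding q using q0 by (subst degree_mult_eq) auto
    with Suc.prems(2) have dq: "degree q \<le> n" by simp
    from Suc.prems(3) have "(\<Sum>i\<le>n. coeff q i *s ((*v) (complex_mat M) ^^ i) (eig_shift M \<mu> w)) = 0"
      unfolding q sum_coeff_linear_factor[OF dq] by simp
    from Suc.IH[OF q0 dq this] show ?thesis by (rule gen_eigenvectors_span_shiftD)
  qed
qed

text \<open>In dimension n the vectors from w up to its n-th iterate satisfy a linear relation, and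
  its coefficients form a polynomial that annihilates this one vector.\<close>

lemma gen_eigenvectors_span_UNIV: "gen_eigenvectors_span (M :: real ^ 'n ^ 'n) = UNIV"
proof -
  have "w \<in> gen_eigenvectors_span M" for w
  proof -
    define x where "x i = ((*v) (complex_mat M) ^^ i) w" for i
    let ?n = "CARD('n)"
    have "\<exists>c. (\<exists>i\<le>?n. c i \<noteq> 0) \<and> (\<Sum>i\<le>?n. c i *s x i) = 0"
    proof (cases "inj_on x {..?n}")
      case True
      then have "card (x ` {..?n}) = Suc ?n" by (simp add: card_image)
      then have "vec.dependent (x ` {..?n})"
        using vec.independent_card_le_dim[of "x ` {..?n}" UNIV] vec_dim_card[where 'a=complex and 'n='n]
        by (metis Suc_n_not_le_n subset_UNIV)
      then obtain u where u: "\<exists>v\<in>x ` {..?n}. u v \<noteq> 0" "(\<Sum>v\<in>x ` {..?n}. u v *s v) = 0"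
        using vec.dependent_finite[of "x ` {..?n}"] by auto
      from u(2) have "(\<Sum>i\<le>?n. u (x i) *s x i) = 0"
        by (simp add: sum.reindex[OF True])
      with u(1) show ?thesis by (intro exI[of _ "\<lambda>i. u (x i)"]) auto
    next
      \<comment> \<open>Dependence is a property of sets, where a repeated iterate leaves no trace;
        the repetition itself is the relation x i - x j = 0.\<close>
      case False
      then obtain i j where ij: "i \<le> ?n" "j \<le> ?n" "i \<noteq> j" "x i = x j" by (auto simp: inj_on_def)
      let ?c = "\<lambda>k. (if k = i then 1 else 0) - (if k = j then 1 else (0::complex))"
      have "(\<Sum>k\<le>?n. ?c k *s x k) =
            (\<Sum>k\<le>?n. (if k = i then x k else 0)) - (\<Sum>k\<le>?n. (if k = j then x k else 0))"
        unfolding sum_subtractf[symmetric] by (intro sum.cong) (auto simp: vec.scale_left_diff_distrib)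
      also have "\<dots> = x i - x j" using ij by (subst (1 2) sum.delta) auto
      finally show ?thesis using ij by (intro exI[of _ ?c]) auto
    qed
    then obtain c k where c: "k \<le> ?n" "c k \<noteq> 0" "(\<Sum>i\<le>?n. c i *s x i) = 0" by blast
    define p where "p = (\<Sum>i\<le>?n. monom (c i) i)"
    have cp: "coeff p i = (if i \<le> ?n then c i else 0)" for i
      unfolding p_def by (simp add: coeff_sum sum.delta)
    have "p \<noteq> 0" using cp[of k] c by auto
    moreover have "degree p \<le> ?n" by (rule degree_le) (simp add: cp)
    moreover have "(\<Sum>i\<le>?n. coeff p i *s ((*v) (complex_mat M) ^^ i) w) = 0"
      using c(3) by (simp add: cp x_def)
    ultimately show ?thesis by (rule annihilated_in_gen_eigenvectors_span)
  qed
  then show ?thesis by blast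
qed

text \<open>The last nonzero vector in the chain of shifts is an eigenvector.\<close>

lemma gen_eigenspace_eigenvalue:
  assumes "w \<in> gen_eigenspace M \<mu>" "w \<noteq> 0"
  shows "is_eigenvalue M \<mu>"
proof -
  obtain k where "(eig_shift M \<mu> ^^ k) w = 0"
    using assms unfolding gen_eigenspace_def by blast
  then show ?thesis using assms(2)
  proof (induction k arbitrary: w)
    case (Suc k)
    show ?case
    proof (cases "eig_shift M \<mu> w = 0")
      case True
      with Suc.prems show ?thesis unfolding is_eigenvalue_def by (intro exI[of _ w]) auto
    next
      case False
      from Suc.prems(1) have "(eig_shift M \<mu> ^^ k) (eig_shift M \<mu> w) = 0"
        by (simp add: funpow_Suc_right del: funpow.simps)
      from Suc.IH[OF this False] show ?thesis .
    qed
  qed simp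
qed

section \<open>Decay of generalized eigenvectors\<close>

lemma bounded_linear_vec_scale: "bounded_linear (\<lambda>w :: complex ^ 'n. c *s w)"
  by (rule linear_conv_bounded_linear[THEN iffD1], rule linearI)
    (simp_all add: vec_eq_iff algebra_simps)

lemma norm_vec_scale: "norm (c *s w) = cmod c * norm (w :: complex ^ 'n)"
  unfolding norm_vec_def by (simp add: norm_mult L2_set_right_distrib)

lemma matrix_pow_vec_scale:
  fixes A :: "'a::field ^ 'n ^ 'n"
  shows "((*v) A ^^ k) (c *s w) = c *s ((*v) A ^^ k) w"
  by (induction k) (simp_all add: vector_scalar_commute)

lemma decay_space_vec_scale:
  assumes "w \<in> decay_space ((*v) A)"
  shows "c *s w \<in> decay_space ((*v) (A :: complex ^ 'n ^ 'n))"
  using assms bounded_linear_vec_scale matrix_pow_vec_scale by (rule decay_space_image)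

lemma vec_subspace_decay_space: "vec.subspace (decay_space ((*v) (A :: complex ^ 'n ^ 'n)))"
  using subspace_decay_space[of "(*v) A"] decay_space_vec_scale
  by (auto intro!: vec.subspaceI simp: subspace_def)

text \<open>One link in a chain of generalized eigenvectors: l is the eigenvalue and u the part
  already known to decay.\<close>

lemma decay_space_eigen_recurrence:
  fixes A :: "complex ^ 'n ^ 'n"
  assumes "A *v w = l *s w + u" "cmod l < 1" "u \<in> decay_space ((*v) A)"
  shows "w \<in> decay_space ((*v) A)"
proof (rule decay_space_recurrence[OF assms(3) _ assms(2)])
  fix k
  have "((*v) A ^^ Suc k) w = ((*v) A ^^ k) (l *s w + u)"
    using assms(1) by (simp add: funpow_Suc_right del: funpow.simps)
  also have "\<dots> = l *s ((*v) A ^^ k) w + ((*v) A ^^ k) u"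
    using linear_add[OF linear_funpow[of "(*v) A" k]] by (simp add: matrix_pow_vec_scale)
  finally show "norm (((*v) A ^^ Suc k) w) \<le> cmod l * norm (((*v) A ^^ k) w) + norm (((*v) A ^^ k) u)"
    by (metis norm_triangle_ineq norm_vec_scale)
qed simp

lemma gen_eigenspace_decay:
  assumes "cmod \<mu> < 1"
  shows "gen_eigenspace M \<mu> \<subseteq> decay_space ((*v) (complex_mat M))"
proof -
  have "w \<in> decay_space ((*v) (complex_mat M))" if "(eig_shift M \<mu> ^^ k) w = 0" for w k
    using that
  proof (induction k arbitrary: w)
    case 0
    then show ?case using vec.subspace_0[OF vec_subspace_decay_space] by simp
  next
    case (Suc k)
    then have "eig_shift M \<mu> w \<in> decay_space ((*v) (complex_mat M))"
      by (simp add: funpow_Suc_right del: funpow.simps)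
    with assms show ?case
      by (rule decay_space_eigen_recurrence[rotated 1, of \<mu>]) simp
  qed
  then show ?thesis unfolding gen_eigenspace_def by blast
qed

lemma complex_mat_inverse:
  assumes "M ** N = mat 1"
  shows "complex_mat M *v (complex_mat N *v w) = w"
proof -
  have "complex_mat M ** complex_mat N = complex_mat (M ** N)"
    by (simp add: vec_eq_iff matrix_matrix_mult_def)
  also have "\<dots> = mat 1" by (simp add: assms vec_eq_iff mat_def)
  finally show ?thesis by (simp add: matrix_vector_mul_assoc)
qed

text \<open>A chain for M at \<mu> becomes a chain for the inverse at 1/\<mu>, whose modulus is
  below 1.\<close>

lemma gen_eigenspace_decay_inverse:
  assumes inv: "N ** M = mat 1" and \<mu>: "1 < cmod \<mu>"
  shows "gen_eigenspace M \<mu> \<subseteq> decay_space ((*v) (complex_mat N))"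
proof -
  let ?N = "complex_mat N"
  have "w \<in> decay_space ((*v) ?N)" if "(eig_shift M \<mu> ^^ k) w = 0" for w k
    using that
  proof (induction k arbitrary: w)
    case 0
    then show ?case using vec.subspace_0[OF vec_subspace_decay_space] by simp
  next
    case (Suc k)
    let ?u = "eig_shift M \<mu> w"
    from Suc have "?u \<in> decay_space ((*v) ?N)"
      by (simp add: funpow_Suc_right del: funpow.simps)
    then have "?N *v ?u \<in> decay_space ((*v) ?N)"
      by (rule decay_space_image)
        (auto simp: linear_conv_bounded_linear[symmetric] funpow_swap1)
    \<comment> \<open>Applying N to M w - \<mu> w = u gives N w = (1/\<mu>) w - (1/\<mu>) N u; the
      last term is the decaying input.\<close>
    then have d: "- (1 / \<mu>) *s (?N *v ?u) \<in> decay_space ((*v) ?N)"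
      by (rule decay_space_vec_scale)
    have \<mu>0: "\<mu> \<noteq> 0" using \<mu> by auto
    have "?N *v ?u = w - \<mu> *s (?N *v w)"
      using complex_mat_inverse[OF inv, of w] by (simp add: matrix_vector_mult_diff_distrib vector_scalar_commute)
    then have "- (1 / \<mu>) *s (?N *v ?u) = ?N *v w - (1 / \<mu>) *s w"
      using \<mu>0 by (simp add: vec_eq_iff field_simps)
    then have "?N *v w = (1 / \<mu>) *s w + - (1 / \<mu>) *s (?N *v ?u)" by simp
    moreover have "cmod (1 / \<mu>) < 1" using \<mu> \<mu>0 by (simp add: norm_divide divide_less_eq)
    ultimately show ?case using d by (rule decay_space_eigen_recurrence)
  qed
  then show ?thesis unfolding gen_eigenspace_def by blast
qed

section \<open>Return to real vectors and the splitting\<close>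

lemma complex_mat_pow_complex_vec:
  fixes M :: "real ^ 'n ^ 'n"
  shows "((*v) (complex_mat M) ^^ k) (complex_vec v) = complex_vec (((*v) M ^^ k) v)"
proof -
  have "complex_mat M *v complex_vec v = complex_vec (M *v v)" for v
    by (simp add: vec_eq_iff complex_vec_def matrix_vector_mult_def)
  then show ?thesis by (induction k) simp_all
qed

lemma norm_complex_vec: "norm (complex_vec v) = norm v"
  unfolding norm_vec_def complex_vec_def by simp

lemma complex_vec_decay_iff:
  fixes M :: "real ^ 'n ^ 'n"
  shows "complex_vec v \<in> decay_space ((*v) (complex_mat M)) \<longleftrightarrow> v \<in> decay_space ((*v) M)"
  unfolding decay_space_def by (simp add: complex_mat_pow_complex_vec norm_complex_vec)

lemma Re_vec_decay:
  fixes M :: "real ^ 'n ^ 'n"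
  assumes "w \<in> decay_space ((*v) (complex_mat M))"
  shows "(\<chi> i. Re (w $ i)) \<in> decay_space ((*v) M)"
proof (rule decay_space_image[OF assms, where h = "\<lambda>w. \<chi> i. Re (w $ i)"])
  show "bounded_linear (\<lambda>w :: complex ^ _. \<chi> i. Re (w $ i))"
    by (rule linear_conv_bounded_linear[THEN iffD1], rule linearI) (simp_all add: vec_eq_iff)
  have *: "M *v (\<chi> i. Re (w $ i)) = (\<chi> i. Re ((complex_mat M *v w) $ i))" for w
    by (simp add: vec_eq_iff matrix_vector_mult_def)
  show "((*v) M ^^ k) (\<chi> i. Re (w $ i)) = (\<chi> i. Re (((*v) (complex_mat M) ^^ k) w $ i))" for k
    by (induction k) (simp_all add: *)
qed

text \<open>The complex spectral spans lie in the decay spaces of M and N and together fill the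
  space. As the decay spaces meet only in 0, neither can exceed its span. The real statements follow
  because a real vector decays exactly when its complex copy does, and real parts of a complex
  splitting split a real vector.\<close>

lemma hyperbolic_splitting:
  fixes M N :: "real ^ 'n ^ 'n"
  assumes hyp: "hyperbolic M" and inv: "M ** N = mat 1" "N ** M = mat 1"
  shows stable_space_eq_decay: "stable_space M = decay_space ((*v) M)"
    and unstable_space_eq_decay: "unstable_space M = decay_space ((*v) N)"
    and decay_space_sum: "\<And>v. \<exists>s\<in>decay_space ((*v) M). \<exists>u\<in>decay_space ((*v) N). v = s + u"
proof -
  let ?A = "complex_mat M" and ?B = "complex_mat N"
  let ?gs = "\<Union>\<mu>\<in>{\<mu>. is_eigenvalue M \<mu> \<and> cmod \<mu> < 1}. gen_eigenspace M \<mu>"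
  let ?gu = "\<Union>\<mu>\<in>{\<mu>. is_eigenvalue M \<mu> \<and> cmod \<mu> > 1}. gen_eigenspace M \<mu>"
  let ?S = "vec.span ?gs" and ?U = "vec.span ?gu"
  let ?DA = "decay_space ((*v) ?A)" and ?DB = "decay_space ((*v) ?B)"
  have SA: "?S \<subseteq> ?DA"
    using gen_eigenspace_decay by (intro vec.span_minimal vec_subspace_decay_space) blast
  have UB: "?U \<subseteq> ?DB"
    using gen_eigenspace_decay_inverse[OF inv(2)]
    by (intro vec.span_minimal vec_subspace_decay_space) blast
  \<comment> \<open>The union runs over all complex \<mu>, but only a nonzero generalized
    eigenvector certifies an eigenvalue; hence the separate 0.\<close>
  have "(\<Union>\<mu>. gen_eigenspace M \<mu>) \<subseteq> insert 0 (?gs \<union> ?gu)"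
  proof
    fix w assume "w \<in> (\<Union>\<mu>. gen_eigenspace M \<mu>)"
    then obtain \<mu> where w: "w \<in> gen_eigenspace M \<mu>" by blast
    show "w \<in> insert 0 (?gs \<union> ?gu)"
    proof (cases "w = 0")
      case False
      with w have e: "is_eigenvalue M \<mu>" by (intro gen_eigenspace_eigenvalue)
      then have "cmod \<mu> < 1 \<or> 1 < cmod \<mu>" using hyp unfolding hyperbolic_def by force
      with e w show ?thesis by blast
    qed simp
  qed
  then have "gen_eigenvectors_span M \<subseteq> vec.span (insert 0 (?gs \<union> ?gu))"
    unfolding gen_eigenvectors_span_def by (rule vec.span_mono)
  then have dec: "\<exists>s\<in>?S. \<exists>u\<in>?U. w = s + u" for w
    unfolding gen_eigenvectors_span_UNIV vec.span_insert_0 vec.span_Un by blast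
  have inter: "w = 0" if "w \<in> ?DA" "w \<in> ?DB" for w
    by (rule decay_space_inter_inverse[OF _ _ complex_mat_inverse[OF inv(1)]
          complex_mat_inverse[OF inv(2)] that]) auto
  note subA = vec_subspace_decay_space[of ?A] and subB = vec_subspace_decay_space[of ?B]
  have SA': "?DA \<subseteq> ?S"
  proof
    fix w assume w: "w \<in> ?DA"
    obtain s u where su: "s \<in> ?S" "u \<in> ?U" "w = s + u" using dec by blast
    then have "u \<in> ?DA" using vec.subspace_diff[OF subA w, of s] SA by auto
    with su UB have "u = 0" by (intro inter) auto
    with su show "w \<in> ?S" by simp
  qed
  have UB': "?DB \<subseteq> ?U"
  proof
    fix w assume w: "w \<in> ?DB"
    obtain s u where su: "s \<in> ?S" "u \<in> ?U" "w = s + u" using dec by blast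
    then have "s \<in> ?DB" using vec.subspace_diff[OF subB w, of u] UB by auto
    with su SA have "s = 0" by (intro inter) auto
    with su show "w \<in> ?U" by simp
  qed
  have S: "?S = ?DA" and U: "?U = ?DB" using SA SA' UB UB' by auto
  show "stable_space M = decay_space ((*v) M)"
    unfolding stable_space_def spectral_subspace_def S complex_vec_decay_iff by simp
  show "unstable_space M = decay_space ((*v) N)"
    unfolding unstable_space_def spectral_subspace_def U complex_vec_decay_iff by simp
  fix v
  obtain s u where su: "s \<in> ?DA" "u \<in> ?DB" "complex_vec v = s + u"
    using dec S U by blast
  have "v = (\<chi> i. Re (s $ i)) + (\<chi> i. Re (u $ i))"
    using arg_cong[OF su(3), of "\<lambda>w. \<chi> i. Re (w $ i)"] by (simp add: vec_eq_iff complex_vec_def)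
  with Re_vec_decay[OF su(1)] Re_vec_decay[OF su(2)]
  show "\<exists>s\<in>decay_space ((*v) M). \<exists>u\<in>decay_space ((*v) N). v = s + u" by blast
qed

section \<open>Block vectors and matrices\<close>

lemma vcat_nth [simp]: "vcat x p $ Inl i = x $ i" "vcat x p $ Inr j = p $ j"
  by (simp_all add: vcat_def)

lemma vec_sum_eq_iff: "v = w \<longleftrightarrow> (\<forall>i. v $ Inl i = w $ Inl i) \<and> (\<forall>j. v $ Inr j = w $ Inr j)"
  by (metis vec_eq_iff sum.exhaust)

lemma vcat_eq_iff [simp]: "vcat x p = vcat y q \<longleftrightarrow> x = y \<and> p = q"
  by (subst vec_sum_eq_iff) (simp add: vec_eq_iff[of x] vec_eq_iff[of p])

lemma vcat_split: obtains x p where "v = vcat x p"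
proof
  show "v = vcat (\<chi> i. v $ Inl i) (\<chi> j. v $ Inr j)" by (simp add: vec_sum_eq_iff)
qed

lemma vcat_0 [simp]: "vcat 0 0 = 0"
  by (simp add: vec_sum_eq_iff)

lemma vcat_eq_0_iff [simp]: "vcat x p = 0 \<longleftrightarrow> x = 0 \<and> p = 0"
  by (metis vcat_0 vcat_eq_iff)

lemma vcat_add: "vcat x p + vcat y q = vcat (x + y) (p + q)"
  by (simp add: vec_sum_eq_iff)

lemma sum_UNIV_Plus:
  "(\<Sum>k\<in>(UNIV :: ('a::finite + 'b::finite) set). f k) = (\<Sum>i\<in>UNIV. f (Inl i)) + (\<Sum>j\<in>UNIV. f (Inr j))"
  using sum.Plus[of "UNIV :: 'a set" "UNIV :: 'b set" f] by (simp add: UNIV_Plus_UNIV)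

lemma norm_vcat_ge: "norm x \<le> norm (vcat x p)" "norm p \<le> norm (vcat x p)"
proof -
  have "(norm (vcat x p))\<^sup>2 = (norm x)\<^sup>2 + (norm p)\<^sup>2"
    unfolding norm_vec_def L2_set_def by (simp add: sum_UNIV_Plus sum_nonneg)
  then show "norm x \<le> norm (vcat x p)" "norm p \<le> norm (vcat x p)"
    by (smt (verit) norm_ge_zero power2_le_imp_le zero_le_power2)+
qed

lemma norm_vcat_le: "norm (vcat x p) \<le> norm x + norm p"
proof -
  have "(norm (vcat x p))\<^sup>2 = (norm x)\<^sup>2 + (norm p)\<^sup>2"
    unfolding norm_vec_def L2_set_def by (simp add: sum_UNIV_Plus sum_nonneg)
  also have "\<dots> \<le> (norm x + norm p)\<^sup>2" by (simp add: power2_sum)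
  finally show ?thesis by (rule power2_le_imp_le) simp
qed

lemma hcat_mult_vcat [simp]: "hcat A B *v vcat x y = A *v x + B *v y"
  by (simp add: vec_eq_iff matrix_vector_mult_def hcat_def sum_UNIV_Plus)

lemma vcat_matrix_mult_vec [simp]: "vcat A B *v x = vcat (A *v x) (B *v x)"
  by (simp add: vec_sum_eq_iff matrix_vector_mult_def)

lemma block_mat_mult_vcat [simp]:
  "block_mat A B C D *v vcat x y = vcat (A *v x + B *v y) (C *v x + D *v y)"
  by (simp add: block_mat_def)

lemma uminus_matrix_mult_vec [simp]: "(- A) *v x = - (A *v (x :: real ^ 'n))"
  by (simp add: vec_eq_iff matrix_vector_mult_def sum_negf)

lemma row_0_mult_vcat [simp]: "row_0 *v vcat x p = vcat x 0"
  by (simp add: row_0_def)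

lemma row_T_mult_vcat [simp]: "row_T S *v vcat x p = vcat 0 (p - S *v x)"
  by (simp add: row_T_def)

lemma endpoint_rows_iff:
  "row_0 *v vcat x0 p0 + row_T S *v vcat xT pT = vcat \<xi> \<pi> \<longleftrightarrow> x0 = \<xi> \<and> pT - S *v xT = \<pi>"
  by (simp add: vcat_add)

lemma mat_eqI: "(\<And>x :: real ^ 'n. A *v x = B *v x) \<Longrightarrow> A = B"
  by (simp add: matrix_eq)

lemma gamma_inf_eq: "gamma_inf S (vcat Xs Ps) (vcat Xu Pu) = block_mat Xs 0 0 (Pu - S ** Xu)"
proof (rule mat_eqI)
  fix v :: "real ^ ('a + 'a)"
  obtain x p where v: "v = vcat x p" by (rule vcat_split)
  show "gamma_inf S (vcat Xs Ps) (vcat Xu Pu) *v v = block_mat Xs 0 0 (Pu - S ** Xu) *v v"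
    unfolding v gamma_inf_def
    by (simp add: matrix_vector_mul_assoc[symmetric] vcat_add matrix_vector_mult_diff_rdistrib)
qed

lemma mat_pow_mult_vec: "mat_pow A k *v x = ((*v) A ^^ k) x"
  by (induction k) (simp_all add: mat_pow_def matrix_vector_mul_assoc[symmetric])

text \<open>\<open>norm A\<close> is the Frobenius norm, since a matrix is a vector of rows; the
  bound is Cauchy-Schwarz in each row.\<close>

lemma norm_matrix_vector_le: "norm (A *v x) \<le> norm A * norm (x :: real ^ 'n)"
proof -
  have "norm (A *v x) = L2_set (\<lambda>i. norm ((A *v x) $ i)) UNIV" by (simp add: norm_vec_def)
  also have "\<dots> \<le> L2_set (\<lambda>i. norm (A $ i) * norm x) UNIV"
    by (rule L2_set_mono) (simp_all add: matrix_mult_dot Cauchy_Schwarz_ineq2)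
  also have "\<dots> = norm A * norm x" by (simp add: norm_vec_def[of A] L2_set_left_distrib)
  finally show ?thesis .
qed

lemma invertible_iff_ker: "invertible (A :: real ^ 'n ^ 'n) \<longleftrightarrow> (\<forall>x. A *v x = 0 \<longrightarrow> x = 0)"
  by (simp add: invertible_left_inverse matrix_left_invertible_ker)

lemma invertible_iff_surj: "invertible (A :: real ^ 'n ^ 'n) \<longleftrightarrow> surj ((*v) A)"
  by (simp add: invertible_right_inverse matrix_right_invertible_surjective)

lemma matrix_inv_mult_vec:
  assumes "invertible (A :: real ^ 'n ^ 'n)"
  shows "A *v (matrix_inv A *v x) = x" "matrix_inv A *v (A *v x) = x"
  using someI_ex[OF assms[unfolded invertible_def], folded matrix_inv_def]
  by (simp_all add: matrix_vector_mul_assoc)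

section \<open>Symplectic matrices\<close>

lemma symp_J_mult_vcat [simp]: "symp_J *v vcat x p = vcat p (- x)"
  by (simp add: symp_J_def)

lemma symp_J_ker: "symp_J *v v = 0 \<Longrightarrow> v = 0"
  by (rule vcat_split[of v]) auto

lemma inner_matrix_vector: "(A *v v) \<bullet> w = v \<bullet> (transpose A *v (w :: real ^ 'n))"
  for A :: "real ^ 'm ^ 'n"
  by (metis dot_lmul_matrix inner_commute transpose_matrix_vector)

lemma symplectic_form_preserved:
  assumes "symplectic M"
  shows "(M *v v) \<bullet> (symp_J *v (M *v w)) = v \<bullet> (symp_J *v w)"
proof -
  have "(M *v v) \<bullet> (symp_J *v (M *v w)) = v \<bullet> ((transpose M ** symp_J ** M) *v w)"
    by (simp only: inner_matrix_vector matrix_vector_mul_assoc matrix_mul_assoc)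
  with assms show ?thesis by (simp only: symplectic_def)
qed

lemma symplectic_pow_form_preserved:
  assumes "symplectic M"
  shows "((*v) M ^^ k) v \<bullet> (symp_J *v ((*v) M ^^ k) w) = v \<bullet> (symp_J *v w)"
  by (induction k) (simp_all add: symplectic_form_preserved[OF assms])

lemma symplectic_inverse:
  fixes M :: "real ^ ('d::finite + 'd) ^ ('d + 'd)"
  assumes M: "symplectic M"
  obtains N where "M ** N = mat 1" "N ** M = mat 1" "symplectic N"
proof -
  have "\<forall>x. M *v x = 0 \<longrightarrow> x = 0"
  proof (intro allI impI)
    fix x assume x: "M *v x = 0"
    have "symp_J *v x = (transpose M ** symp_J) *v (M *v x)"
      using M by (simp only: symplectic_def matrix_vector_mul_assoc)
    then have "symp_J *v x = 0" unfolding x by (simp only: matrix_vector_mult_0_right)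
    then show "x = 0" by (rule symp_J_ker)
  qed
  then obtain N where N: "M ** N = mat 1" "N ** M = mat 1"
    unfolding invertible_iff_ker[symmetric] invertible_def by blast
  have "transpose N ** transpose M = mat 1"
    by (metis N(1) matrix_transpose_mul transpose_mat)
  have "transpose N ** symp_J ** N = transpose N ** (transpose M ** symp_J ** M) ** N"
    using M by (simp only: symplectic_def)
  also have "\<dots> = (transpose N ** transpose M) ** symp_J ** (M ** N)"
    by (simp only: matrix_mul_assoc)
  also have "\<dots> = symp_J"
    using \<open>transpose N ** transpose M = mat 1\<close> N by simp
  finally have "symplectic N" unfolding symplectic_def .
  with N show ?thesis by (rule that)
qed

text \<open>The form is invariant, and along decaying orbits it tends to zero.\<close>

lemma decay_space_isotropic:
  assumes M: "symplectic M" and vw: "v \<in> decay_space ((*v) M)" "w \<in> decay_space ((*v) M)"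
  shows "v \<bullet> (symp_J *v w) = 0"
proof -
  obtain C r where 1: "0 < r" "r < 1" "0 < C" "\<And>k. norm (((*v) M ^^ k) v) \<le> C * r ^ k"
    by (rule decay_spaceE[OF vw(1)], rule that)
  obtain D q where 2: "0 < q" "q < 1" "0 < D" "\<And>k. norm (((*v) M ^^ k) w) \<le> D * q ^ k"
    by (rule decay_spaceE[OF vw(2)], rule that)
  let ?J = "norm (symp_J :: real ^ ('a + 'a) ^ ('a + 'a))"
  have le: "\<bar>v \<bullet> (symp_J *v w)\<bar> \<le> C * ?J * D * (r * q) ^ k" for k
  proof -
    have "\<bar>v \<bullet> (symp_J *v w)\<bar> = \<bar>((*v) M ^^ k) v \<bullet> (symp_J *v ((*v) M ^^ k) w)\<bar>"
      by (simp add: symplectic_pow_form_preserved[OF M])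
    also have "\<dots> \<le> norm (((*v) M ^^ k) v) * norm (symp_J *v ((*v) M ^^ k) w)"
      by (rule Cauchy_Schwarz_ineq2)
    also have "\<dots> \<le> (C * r ^ k) * (?J * (D * q ^ k))"
      using 1 2
      by (intro mult_mono order_trans[OF norm_matrix_vector_le] mult_left_mono) auto
    finally show ?thesis by (simp add: power_mult_distrib algebra_simps)
  qed
  have "r * q < 1" using 1 2 by (smt (verit) mult_left_le)
  then have "(\<lambda>k. C * ?J * D * (r * q) ^ k) \<longlonglongrightarrow> C * ?J * D * 0"
    using 1 2 by (intro tendsto_intros LIMSEQ_power_zero) auto
  then have "\<bar>v \<bullet> (symp_J *v w)\<bar> \<le> C * ?J * D * 0"
    by (rule LIMSEQ_le_const) (use le in blast)
  then show ?thesis by simp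
qed

text \<open>J is injective and carries an isotropic W into its orthogonal complement, so W fits
  twice into dimension 2 d.\<close>

lemma dim_isotropic_le:
  fixes W :: "(real ^ ('d::finite + 'd)) set"
  assumes W: "subspace W" and iso: "\<And>v w. v \<in> W \<Longrightarrow> w \<in> W \<Longrightarrow> v \<bullet> (symp_J *v w) = 0"
  shows "dim W \<le> CARD('d)"
proof -
  let ?P = "{y \<in> UNIV. \<forall>x\<in>W. orthogonal x y}"
  have "inj ((*v) (symp_J :: real ^ ('d + 'd) ^ ('d + 'd)))"
    using linear_injective_0[of "(*v) symp_J"] symp_J_ker by auto
  then have "dim ((*v) symp_J ` W) = dim W"
    by (intro dim_image_eq) (auto intro: inj_on_subset)
  moreover have "(*v) symp_J ` W \<subseteq> ?P" using iso by (auto simp: orthogonal_def)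
  ultimately have "dim W \<le> dim ?P" using dim_subset[of "(*v) symp_J ` W" ?P] by (simp only:)
  moreover have "dim ?P + dim W = dim (UNIV :: (real ^ ('d + 'd)) set)"
    by (rule dim_subspace_orthogonal_to_vectors) (use W in auto)
  ultimately show ?thesis by simp
qed

text \<open>Two isotropic spaces of dimension at most d that together span dimension 2 d both have
  dimension d. This count takes the place of pairing each eigenvalue \<mu> with 1/\<mu>.\<close>

lemma lagrangian_stable_unstable:
  fixes M :: "real ^ ('d::finite + 'd) ^ ('d + 'd)"
  assumes M: "symplectic M" and hyp: "hyperbolic M"
  shows "lagrangian (stable_space M)" "lagrangian (unstable_space M)"
proof -
  obtain N where N: "M ** N = mat 1" "N ** M = mat 1" "symplectic N"
    by (rule symplectic_inverse[OF M])
  let ?S = "decay_space ((*v) M)" and ?U = "decay_space ((*v) N)"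
  have sub: "subspace ?S" "subspace ?U" by (auto intro: subspace_decay_space)
  have iso: "\<And>v w. v \<in> ?S \<Longrightarrow> w \<in> ?S \<Longrightarrow> v \<bullet> (symp_J *v w) = 0"
    "\<And>v w. v \<in> ?U \<Longrightarrow> w \<in> ?U \<Longrightarrow> v \<bullet> (symp_J *v w) = 0"
    using decay_space_isotropic M N(3) by blast+
  have "{x + y |x y. x \<in> ?S \<and> y \<in> ?U} = UNIV"
    using decay_space_sum[OF hyp N(1,2)] by blast
  then have "2 * CARD('d) \<le> dim ?S + dim ?U"
    using dim_sums_Int[OF sub] by simp
  moreover have "dim ?S \<le> CARD('d)" "dim ?U \<le> CARD('d)"
    using dim_isotropic_le[OF sub(1) iso(1)] dim_isotropic_le[OF sub(2) iso(2)] by blast+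
  ultimately have "dim ?S = CARD('d)" "dim ?U = CARD('d)" by auto
  then show "lagrangian (stable_space M)" "lagrangian (unstable_space M)"
    unfolding lagrangian_def stable_space_eq_decay[OF hyp N(1,2)] unstable_space_eq_decay[OF hyp N(1,2)]
    using sub iso by auto
qed

section \<open>Frames\<close>

lemma columns_basis_range:
  assumes "columns_basis V E"
  shows "range ((*v) V) = E"
proof
  show "range ((*v) V) \<subseteq> E"
    using assms matrix_vector_mult_in_columnspace[of V] unfolding columns_basis_def by auto
  have "subspace (range ((*v) V))" by (intro linear_subspace_image) auto
  moreover have "columns V \<subseteq> range ((*v) V)"
  proof
    fix v assume "v \<in> columns V"
    then obtain j where "v = column j V" unfolding columns_def by auto
    then have "v = V *v axis j 1" by (simp add: matrix_vector_mult_basis)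
    then show "v \<in> range ((*v) V)" by (rule range_eqI)
  qed
  ultimately show "E \<subseteq> range ((*v) V)"
    using assms unfolding columns_basis_def by (metis span_minimal)
qed

text \<open>\<open>columns V\<close> is a set and hides equal columns; injectivity of the column map
  turns independence of the set into independence of the indexed family.\<close>

lemma columns_basis_ker:
  assumes V: "columns_basis V E" and x: "V *v x = 0"
  shows "x = 0"
proof -
  have inj: "inj (\<lambda>j. column j V)" and ind: "independent (columns V)"
    using V unfolding columns_basis_def by auto
  have cols: "columns V = range (\<lambda>j. column j V)" unfolding columns_def by auto
  define u where "u v = x $ inv (\<lambda>j. column j V) v" for v
  have "(\<Sum>v\<in>columns V. u v *\<^sub>R v) = (\<Sum>j\<in>UNIV. u (column j V) *\<^sub>R column j V)"
    unfolding cols by (rule sum.reindex[OF inj, unfolded o_def])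
  also have "\<dots> = (\<Sum>j\<in>UNIV. x $ j *s column j V)"
    unfolding u_def inv_f_f[OF inj] by (simp add: scalar_mult_eq_scaleR)
  also have "\<dots> = 0" using x by (simp add: matrix_mult_sum)
  finally have "(\<Sum>v\<in>columns V. u v *\<^sub>R v) = 0" .
  with ind have "\<forall>v\<in>columns V. u v = 0"
    using independentD[of "columns V" "columns V" u] by (auto simp: cols)
  then have "x $ j = 0" for j
    unfolding cols u_def using inv_f_f[OF inj, of j] by (metis rangeI)
  then show ?thesis by (simp add: vec_eq_iff)
qed

lemma columns_basis_exists:
  fixes E :: "(real ^ 'n) set"
  assumes E: "subspace E" "dim E = CARD('k)"
  obtains V :: "real ^ 'k ^ 'n" where "columns_basis V E"
proof -
  obtain B where B: "B \<subseteq> E" "independent B" "E \<subseteq> span B" "card B = dim E"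
    using basis_exists by blast
  have "finite B" using B(2) by (rule independent_imp_finite)
  then obtain f :: "'k \<Rightarrow> real ^ 'n" where f: "bij_betw f UNIV B"
    using B(4) E(2) by (metis finite_same_card_bij finite)
  define V :: "real ^ 'k ^ 'n" where "V = (\<chi> i j. f j $ i)"
  have c: "column j V = f j" for j by (simp add: V_def column_def vec_eq_iff)
  have "columns V = B" using f unfolding columns_def c bij_betw_def by auto
  moreover have "span B = E" using B E by (metis span_minimal subset_antisym)
  ultimately have "columns_basis V E"
    using f B unfolding columns_basis_def c bij_betw_def by auto
  then show ?thesis by (rule that)
qed

text \<open>Column j of D holds the coordinates, with respect to the columns of V, of the image of
  column j.\<close>

lemma invariant_frame_matrix:
  fixes V :: "real ^ 'k ^ 'n"
  assumes "\<And>x. M *v (V *v x) \<in> range ((*v) V)"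
  obtains D where "M ** V = V ** D"
proof -
  have "\<forall>j. \<exists>y. M *v (V *v axis j 1) = V *v y" using assms by blast
  then obtain y where y: "M *v (V *v axis j 1) = V *v y j" for j by metis
  define D :: "real ^ 'k ^ 'k" where "D = (\<chi> i j. y j $ i)"
  have "D *v axis j 1 = y j" for j
    unfolding matrix_vector_mult_basis by (simp add: D_def column_def vec_eq_iff)
  then have "(M ** V) *v axis j 1 = (V ** D) *v axis j 1" for j
    using y by (simp add: matrix_vector_mul_assoc[symmetric])
  then have "column j (M ** V) = column j (V ** D)" for j
    by (simp add: matrix_vector_mult_basis)
  then have "M ** V = V ** D" by (simp add: column_def vec_eq_iff)
  then show ?thesis by (rule that)
qed

section \<open>Shooting\<close>

text \<open>Sends the initial value of an unforced solution to its boundary value. Its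
  nonsingularity expresses unique solvability; as it contains the growing powers of M, quantitative
  bounds are taken from the scaled matrices instead.\<close>

definition shoot :: "real ^ 'n ^ 'n \<Rightarrow> real ^ 'n ^ 'n \<Rightarrow> real ^ 'n ^ 'n \<Rightarrow> nat \<Rightarrow> real ^ 'n ^ 'n" where
  "shoot M B0 BT T = B0 + BT ** mat_pow M T"

primrec forced :: "real ^ 'n ^ 'n \<Rightarrow> (nat \<Rightarrow> real ^ 'n) \<Rightarrow> nat \<Rightarrow> real ^ 'n" where
  "forced M f 0 = 0"
| "forced M f (Suc t) = M *v forced M f t + f t"

lemma mat_pow_0 [simp]: "mat_pow A 0 = mat 1"
  by (simp add: mat_pow_def)

lemma mat_pow_Suc: "mat_pow A (Suc k) = A ** mat_pow A k"
  by (simp add: mat_pow_def)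

lemma linear_step_map: "linear (step_map M)"
  by (rule linearI) (auto simp: step_map_def algebra_simps)

lemma recurrence_iff_forced:
  "(\<forall>t<T. step_map M (h t, h (Suc t)) = f t) \<longleftrightarrow> (\<forall>t\<le>T. h t = mat_pow M t *v h 0 + forced M f t)"
proof
  assume L: "\<forall>t<T. step_map M (h t, h (Suc t)) = f t"
  show "\<forall>t\<le>T. h t = mat_pow M t *v h 0 + forced M f t"
  proof (intro allI impI)
    fix t assume "t \<le> T"
    then show "h t = mat_pow M t *v h 0 + forced M f t"
    proof (induction t)
      case (Suc t)
      then have "h (Suc t) = M *v h t + f t" "h t = mat_pow M t *v h 0 + forced M f t"
        using L by (auto simp: step_map_def algebra_simps dest!: spec[of _ t])
      then show ?case
        by (simp add: mat_pow_Suc matrix_vector_mul_assoc[symmetric] matrix_vector_right_distrib)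
    qed simp
  qed
next
  assume h: "\<forall>t\<le>T. h t = mat_pow M t *v h 0 + forced M f t"
  show "\<forall>t<T. step_map M (h t, h (Suc t)) = f t"
  proof (intro allI impI)
    fix t assume "t < T"
    then have "h (Suc t) = mat_pow M (Suc t) *v h 0 + forced M f (Suc t)"
      "h t = mat_pow M t *v h 0 + forced M f t" using h Suc_leI less_imp_le by blast+
    then have "h (Suc t) = M *v h t + f t"
      by (simp add: mat_pow_Suc matrix_vector_mul_assoc[symmetric] matrix_vector_right_distrib)
    then show "step_map M (h t, h (Suc t)) = f t" by (simp add: step_map_def)
  qed
qed

text \<open>Variation of constants leaves the initial value as the only unknown, constrained by one
  square linear system.\<close>

lemma bvp_solution_iff_shoot:
  "bvp_solution (step_map M) B0 BT T f b h \<longleftrightarrow>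
    (\<forall>t\<le>T. h t = mat_pow M t *v h 0 + forced M f t) \<and>
    shoot M B0 BT T *v h 0 = b - BT *v forced M f T"
proof -
  have "(B0 *v h 0 + BT *v h T = b) \<longleftrightarrow> shoot M B0 BT T *v h 0 = b - BT *v forced M f T"
    if "h T = mat_pow M T *v h 0 + forced M f T"
    unfolding that shoot_def
    by (auto simp: matrix_vector_mult_add_rdistrib matrix_vector_right_distrib
        matrix_vector_mul_assoc[symmetric] algebra_simps)
  then show ?thesis unfolding bvp_solution_def recurrence_iff_forced by blast
qed

lemma forced_zero [simp]: "forced M (\<lambda>_. 0) t = 0"
  by (induction t) simp_all

lemma bvp_unique_iff_shoot:
  fixes M :: "real ^ 'n ^ 'n"
  shows "(\<forall>f b. \<exists>!h. h \<in> extensional {..T} \<and> bvp_solution (step_map M) B0 BT T f b h) \<longleftrightarrow>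
    invertible (shoot M B0 BT T)"
proof
  assume inv: "invertible (shoot M B0 BT T)"
  show "\<forall>f b. \<exists>!h. h \<in> extensional {..T} \<and> bvp_solution (step_map M) B0 BT T f b h"
  proof (intro allI)
    fix f b
    define x where "x = matrix_inv (shoot M B0 BT T) *v (b - BT *v forced M f T)"
    have x: "shoot M B0 BT T *v x = b - BT *v forced M f T"
      unfolding x_def by (rule matrix_inv_mult_vec[OF inv])
    define h where "h = restrict (\<lambda>t. mat_pow M t *v x + forced M f t) {..T}"
    have h0: "h 0 = x" by (simp add: h_def)
    show "\<exists>!h. h \<in> extensional {..T} \<and> bvp_solution (step_map M) B0 BT T f b h"
    proof (rule ex1I[of _ h], unfold bvp_solution_iff_shoot)
      show "h \<in> extensional {..T} \<and> (\<forall>t\<le>T. h t = mat_pow M t *v h 0 + forced M f t) \<and>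
        shoot M B0 BT T *v h 0 = b - BT *v forced M f T"
        unfolding h0 using x by (simp add: h_def)
      fix g assume g: "g \<in> extensional {..T} \<and> (\<forall>t\<le>T. g t = mat_pow M t *v g 0 + forced M f t) \<and>
        shoot M B0 BT T *v g 0 = b - BT *v forced M f T"
      then have "g 0 = x" using x matrix_inv_mult_vec(2)[OF inv] by metis
      with g have gh: "g t = h t" if "t \<in> {..T}" for t using that by (simp add: h_def)
      have "h \<in> extensional {..T}" by (simp add: h_def)
      with g gh show "g = h" by (intro extensionalityI[of g "{..T}" h]) blast+
    qed
  qed
next
  assume ex: "\<forall>f b. \<exists>!h. h \<in> extensional {..T} \<and> bvp_solution (step_map M) B0 BT T f b h"
  show "invertible (shoot M B0 BT T)"
    unfolding invertible_iff_ker
  proof (intro allI impI)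
    fix x assume x: "shoot M B0 BT T *v x = 0"
    \<comment> \<open>A kernel vector and 0 both start unforced solutions with zero boundary value;
      uniqueness identifies them at time 0. The restriction makes both sequences
      extensional.\<close>
    let ?h = "\<lambda>x. restrict (\<lambda>t. mat_pow M t *v x) {..T}"
    have "?h x \<in> extensional {..T} \<and> bvp_solution (step_map M) B0 BT T (\<lambda>_. 0) 0 (?h x)"
      "?h 0 \<in> extensional {..T} \<and> bvp_solution (step_map M) B0 BT T (\<lambda>_. 0) 0 (?h 0)"
      unfolding bvp_solution_iff_shoot using x by simp_all
    with ex1E[OF ex[rule_format, of "\<lambda>_. 0" 0]] have "?h x = ?h 0" by metis
    from fun_cong[OF this, of 0] show "x = 0" by simp
  qed
qed

section \<open>The cyclic form of the Green bound\<close>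

text \<open>
  The three exponents of the Green kernel are, up to a constant, the distance on the cycle obtained
  from \<open>{0..T}\<close> by identifying the two end points; the boundary datum sits at that common point.
\<close>

definition cyc :: "nat \<Rightarrow> nat \<Rightarrow> nat \<Rightarrow> real" where
  "cyc T t s = min \<bar>real t - real s\<bar> (real T - \<bar>real t - real s\<bar>)"

lemma cyc_triangle: "t \<le> T \<Longrightarrow> s \<le> T \<Longrightarrow> r \<le> T \<Longrightarrow> cyc T t r \<le> cyc T t s + cyc T s r"
  unfolding cyc_def min_def abs_if by (auto split: if_splits)

lemma cyc_commute: "cyc T t s = cyc T s t"
  unfolding cyc_def by (simp add: abs_minus_commute)

lemma cyc_nonneg: "t \<le> T \<Longrightarrow> s \<le> T \<Longrightarrow> 0 \<le> cyc T t s"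
  unfolding cyc_def by auto

lemma cyc_end: "t \<le> T \<Longrightarrow> cyc T t T = cyc T t 0"
  unfolding cyc_def by auto

lemma exp_neg_mult_mono: "0 \<le> \<gamma> \<Longrightarrow> x \<le> y \<Longrightarrow> exp (- \<gamma> * y) \<le> exp (- \<gamma> * (x::real))"
  by (simp add: mult_left_mono)

text \<open>This is the gain from the cycle: passing through an intermediate time is bounded by the
  same kernel, with no extra constant.\<close>

lemma exp_cyc_triangle:
  assumes "0 \<le> \<gamma>" "t \<le> T" "s \<le> T" "r \<le> T"
  shows "exp (- \<gamma> * cyc T t s) * exp (- \<gamma> * cyc T s r) \<le> exp (- \<gamma> * cyc T t r)"
proof -
  have "exp (- \<gamma> * cyc T t s) * exp (- \<gamma> * cyc T s r) = exp (- \<gamma> * (cyc T t s + cyc T s r))"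
    by (simp add: exp_add[symmetric] algebra_simps)
  also have "\<dots> \<le> exp (- \<gamma> * cyc T t r)"
    using assms by (intro exp_neg_mult_mono cyc_triangle)
  finally show ?thesis .
qed

lemma geometric_sum_inj_le:
  fixes x :: real
  assumes "finite A" "inj_on g A" "0 \<le> x" "x < 1"
  shows "(\<Sum>s\<in>A. x ^ g s) \<le> 1 / (1 - x)"
proof -
  have "(\<Sum>s\<in>A. x ^ g s) = (\<Sum>k\<in>g ` A. x ^ k)" using assms by (simp add: sum.reindex)
  also have "\<dots> \<le> (\<Sum>k. x ^ k)" using assms by (intro sum_le_suminf) auto
  also have "\<dots> = 1 / (1 - x)" using assms by (simp add: suminf_geometric)
  finally show ?thesis .
qed

text \<open>Four geometric series, hence the 4: s before t, s from t on, and the two ways through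
  the identified end points, where the distance is at least T - s or at least s. The bound does not
  depend on T.\<close>

lemma sum_exp_cyc_le:
  assumes \<gamma>: "0 < \<gamma>" and t: "t \<le> T"
  shows "(\<Sum>s<T. exp (- \<gamma> * cyc T t s)) \<le> 4 / (1 - exp (- \<gamma>))"
proof -
  define x where "x = exp (- \<gamma>)"
  have x: "0 \<le> x" "x < 1" using \<gamma> by (auto simp: x_def)
  have pow: "exp (- \<gamma> * real k) = x ^ k" for k
    by (metis exp_of_nat_mult mult.commute x_def)
  have le: "exp (- \<gamma> * cyc T t s) \<le>
      (if s < t then x ^ (t - s) else 0) + (if s < t then 0 else x ^ (s - t)) + x ^ (T - s) + x ^ s"
    if s: "s < T" for s
  proof -
    have "cyc T t s = real (if s < t then t - s else s - t) \<or> real (T - s) \<le> cyc T t s \<or> real s \<le> cyc T t s"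
      using s t unfolding cyc_def min_def abs_if by (auto simp: of_nat_diff)
    then consider "cyc T t s = real (if s < t then t - s else s - t)" | "real (T - s) \<le> cyc T t s"
      | "real s \<le> cyc T t s" by blast
    then show ?thesis
    proof cases
      case 1
      then have "exp (- \<gamma> * cyc T t s) = x ^ (if s < t then t - s else s - t)" using pow by simp
      then show ?thesis using x by simp
    next
      case 2
      have "exp (- \<gamma> * cyc T t s) \<le> x ^ (T - s)"
        using exp_neg_mult_mono[OF less_imp_le[OF \<gamma>] 2] unfolding pow .
      also have "\<dots> \<le> (if s < t then x ^ (t - s) else 0) + (if s < t then 0 else x ^ (s - t)) + x ^ (T - s) + x ^ s"
        using x by simp
      finally show ?thesis .
    next
      case 3
      have "exp (- \<gamma> * cyc T t s) \<le> x ^ s"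
        using exp_neg_mult_mono[OF less_imp_le[OF \<gamma>] 3] unfolding pow .
      also have "\<dots> \<le> (if s < t then x ^ (t - s) else 0) + (if s < t then 0 else x ^ (s - t)) + x ^ (T - s) + x ^ s"
        using x by simp
      finally show ?thesis .
    qed
  qed
  have "(\<Sum>s<T. exp (- \<gamma> * cyc T t s)) \<le> (\<Sum>s<T. (if s < t then x ^ (t - s) else 0)
      + (if s < t then 0 else x ^ (s - t)) + x ^ (T - s) + x ^ s)"
    using le by (intro sum_mono) auto
  also have "\<dots> = (\<Sum>s\<in>{..<T} \<inter> {s. s < t}. x ^ (t - s)) + (\<Sum>s\<in>{..<T} \<inter> - {s. s < t}. x ^ (s - t))
      + (\<Sum>s<T. x ^ (T - s)) + (\<Sum>s<T. x ^ s)"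
    by (simp add: sum.distrib sum.If_cases)
  also have "\<dots> \<le> 1 / (1 - x) + 1 / (1 - x) + 1 / (1 - x) + 1 / (1 - x)"
    using x by (intro add_mono geometric_sum_inj_le[of _ _ x] geometric_sum_inj_le[where g="\<lambda>s. s"])
      (auto simp: inj_on_def)
  finally show ?thesis by (simp add: x_def)
qed

text \<open>The data enter as real numbers, so that the same expression serves the Euclidean norm,
  the prescribed norm and perturbation terms.\<close>

definition cyc_bound :: "real \<Rightarrow> nat \<Rightarrow> real \<Rightarrow> (nat \<Rightarrow> real) \<Rightarrow> nat \<Rightarrow> real" where
  "cyc_bound \<gamma> T \<beta> \<phi> t = exp (- \<gamma> * cyc T t 0) * \<beta> + (\<Sum>s<T. exp (- \<gamma> * cyc T t s) * \<phi> s)"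

text \<open>Working form of the Green property: Euclidean norm, one exponential for each pair of
  times, and nonsingular shooting in place of unique existence. The normalizations of C and of the
  initial horizon by 1 are restored in \<open>uniform_green_of_green_est\<close>.\<close>

definition green_est ::
  "real ^ 'n ^ 'n \<Rightarrow> real ^ 'n ^ 'n \<Rightarrow> real ^ 'n ^ 'n \<Rightarrow> real \<Rightarrow> real \<Rightarrow> nat \<Rightarrow> bool" where
  "green_est M B0 BT C \<gamma> T0 \<longleftrightarrow> 0 < C \<and> 0 < \<gamma> \<and>
    (\<forall>T\<ge>T0. invertible (shoot M B0 BT T) \<and>
      (\<forall>f b h. bvp_solution (step_map M) B0 BT T f b h \<longrightarrow>
        (\<forall>t\<le>T. norm (h t) \<le> C * cyc_bound \<gamma> T (norm b) (\<lambda>s. norm (f s)) t)))"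

lemma green_estD:
  assumes "green_est M B0 BT C \<gamma> T0" "T0 \<le> T" "bvp_solution (step_map M) B0 BT T f b h" "t \<le> T"
  shows "norm (h t) \<le> C * cyc_bound \<gamma> T (norm b) (\<lambda>s. norm (f s)) t"
  using assms unfolding green_est_def by blast

text \<open>A kernel vector of \<open>shoot\<close> starts an unforced solution with zero boundary
  value, which the bound forces to vanish. A perturbation therefore has to preserve only an
  estimate, and solvability follows.\<close>

lemma green_estI:
  assumes "0 < C" "0 < \<gamma>"
    and bound: "\<And>T f b h t. T0 \<le> T \<Longrightarrow> bvp_solution (step_map M) B0 BT T f b h \<Longrightarrow> t \<le> T \<Longrightarrow>
      norm (h t) \<le> C * cyc_bound \<gamma> T (norm b) (\<lambda>s. norm (f s)) t"
  shows "green_est M B0 BT C \<gamma> T0"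
proof -
  have "invertible (shoot M B0 BT T)" if T: "T0 \<le> T" for T
    unfolding invertible_iff_ker
  proof (intro allI impI)
    fix x assume x: "shoot M B0 BT T *v x = 0"
    have "bvp_solution (step_map M) B0 BT T (\<lambda>_. 0) 0 (\<lambda>t. mat_pow M t *v x)"
      unfolding bvp_solution_iff_shoot using x by simp
    from bound[OF T this, of 0] show "x = 0" by (simp add: cyc_bound_def)
  qed
  with assms show ?thesis unfolding green_est_def by auto
qed

lemma cyc_bound_nonneg:
  "0 \<le> \<beta> \<Longrightarrow> (\<And>s. 0 \<le> \<phi> s) \<Longrightarrow> 0 \<le> cyc_bound \<gamma> T \<beta> \<phi> t"
  unfolding cyc_bound_def by (intro add_nonneg_nonneg mult_nonneg_nonneg sum_nonneg) auto

lemma cyc_bound_mono: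
  assumes "\<gamma>' \<le> \<gamma>" "0 \<le> \<beta>" "\<beta> \<le> \<beta>'" "\<And>s. 0 \<le> \<phi> s" "\<And>s. \<phi> s \<le> \<phi>' s" "t \<le> T"
  shows "cyc_bound \<gamma> T \<beta> \<phi> t \<le> cyc_bound \<gamma>' T \<beta>' \<phi>' t"
proof -
  have "exp (- \<gamma> * cyc T t s) \<le> exp (- \<gamma>' * cyc T t s)" if "s \<le> T" for s
    using assms cyc_nonneg[OF _ that, of t] by (simp add: mult_right_mono)
  then show ?thesis
    unfolding cyc_bound_def using assms
    by (intro add_mono sum_mono mult_mono) auto
qed

lemma cyc_bound_cmult: "cyc_bound \<gamma> T (c * \<beta>) (\<lambda>s. c * \<phi> s) t = c * cyc_bound \<gamma> T \<beta> \<phi> t"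
  unfolding cyc_bound_def by (simp add: distrib_left sum_distrib_left mult.left_commute)

lemma cyc_bound_add:
  "cyc_bound \<gamma> T (\<beta> + \<beta>') (\<lambda>s. \<phi> s + \<phi>' s) t = cyc_bound \<gamma> T \<beta> \<phi> t + cyc_bound \<gamma> T \<beta>' \<phi>' t"
  unfolding cyc_bound_def by (simp add: distrib_left sum.distrib)

text \<open>A Harnack-type inequality: moving between two times changes the bound at most by the
  exponential of \<gamma> times their distance, which makes it usable as a weight.\<close>

lemma cyc_bound_slow:
  assumes "0 \<le> \<gamma>" "t \<le> T" "s \<le> T" "0 \<le> \<beta>" "\<And>s. 0 \<le> \<phi> s"
  shows "exp (- \<gamma> * cyc T t s) * cyc_bound \<gamma> T \<beta> \<phi> s \<le> cyc_bound \<gamma> T \<beta> \<phi> t"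
proof -
  have "exp (- \<gamma> * cyc T t s) * cyc_bound \<gamma> T \<beta> \<phi> s =
      (exp (- \<gamma> * cyc T t s) * exp (- \<gamma> * cyc T s 0)) * \<beta>
      + (\<Sum>r<T. (exp (- \<gamma> * cyc T t s) * exp (- \<gamma> * cyc T s r)) * \<phi> r)"
    unfolding cyc_bound_def by (simp add: distrib_left sum_distrib_left mult.assoc)
  also have "\<dots> \<le> cyc_bound \<gamma> T \<beta> \<phi> t"
    unfolding cyc_bound_def using assms
    by (intro add_mono sum_mono mult_right_mono exp_cyc_triangle) auto
  finally show ?thesis .
qed

section \<open>Robustness of the Green bound\<close>

text \<open>
  A solution of the perturbed problem solves the unperturbed one with data changed by \<open>\<epsilon>\<close> times
  itself.  Dividing by the slowly varying weight \<open>w\<close> and taking the maximum absorbs the change.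
\<close>

lemma green_est_perturb:
  fixes M :: "real ^ 'n ^ 'n"
  assumes est: "green_est M B0 BT C \<gamma> T0" and \<epsilon>: "0 \<le> \<epsilon>"
    and M': "\<And>v. norm ((M' - M) *v v) \<le> \<epsilon> * norm v"
    and BT': "\<And>v. norm ((BT' - BT) *v v) \<le> \<epsilon> * norm v"
    and small: "C * \<epsilon> * (1 + 4 / (1 - exp (- (\<gamma> / 2)))) \<le> 1 / 2"
  shows "green_est M' B0 BT' (2 * C) (\<gamma> / 2) T0"
proof -
  have C: "0 < C" and \<gamma>: "0 < \<gamma>" using est unfolding green_est_def by auto
  have bound: "norm (h t) \<le> 2 * C * cyc_bound (\<gamma> / 2) T (norm b) (\<lambda>s. norm (f s)) t"
    if T: "T0 \<le> T" and sol: "bvp_solution (step_map M') B0 BT' T f b h" and t: "t \<le> T" for T f b h t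
  proof -
    let ?g = "\<lambda>s. f s + (M' - M) *v h s" and ?c = "b - (BT' - BT) *v h T"
    let ?S = "4 / (1 - exp (- (\<gamma> / 2)))"
    have "bvp_solution (step_map M) B0 BT T ?g ?c h"
      using sol unfolding bvp_solution_def step_map_def
      by (auto simp: matrix_vector_mult_diff_rdistrib algebra_simps)
    with est T have h: "norm (h t) \<le> C * cyc_bound \<gamma> T (norm ?c) (\<lambda>s. norm (?g s)) t" if "t \<le> T" for t
      using that unfolding green_est_def by blast
    \<comment> \<open>The offset \<eta> keeps the weight positive even when all data vanish; it is
      sent to 0 at the end.\<close>
    have main: "norm (h t) \<le> 2 * C * (\<eta> + cyc_bound (\<gamma> / 2) T (norm b) (\<lambda>s. norm (f s)) t)"
      if \<eta>: "0 < \<eta>" and t: "t \<le> T" for \<eta> t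
    proof -
      define w where "w t = \<eta> + cyc_bound (\<gamma> / 2) T (norm b) (\<lambda>s. norm (f s)) t" for t
      have w0: "0 < w t" for t
        unfolding w_def using \<eta> by (intro add_pos_nonneg cyc_bound_nonneg) auto
      \<comment> \<open>Half of the rate \<gamma> pays for the variation of w, the other half
        remains to be summed over s.\<close>
      have slow: "exp (- \<gamma> * cyc T t s) * w s \<le> exp (- (\<gamma> / 2) * cyc T t s) * w t"
        if ts: "t \<le> T" "s \<le> T" for t s
      proof -
        have "exp (- (\<gamma> / 2) * cyc T t s) * w s \<le> w t"
          unfolding w_def distrib_left
        proof (rule add_mono)
          show "exp (- (\<gamma> / 2) * cyc T t s) * \<eta> \<le> \<eta>"
            using \<eta> \<gamma> cyc_nonneg[OF ts] by (simp add: mult_le_cancel_right1 mult_nonneg_nonneg)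
          show "exp (- (\<gamma> / 2) * cyc T t s) * cyc_bound (\<gamma> / 2) T (norm b) (\<lambda>s. norm (f s)) s
            \<le> cyc_bound (\<gamma> / 2) T (norm b) (\<lambda>s. norm (f s)) t"
            using \<gamma> ts by (intro cyc_bound_slow) auto
        qed
        then have "exp (- (\<gamma> / 2) * cyc T t s) * (exp (- (\<gamma> / 2) * cyc T t s) * w s)
          \<le> exp (- (\<gamma> / 2) * cyc T t s) * w t" by (rule mult_left_mono) simp
        moreover have "exp (- (\<gamma> / 2) * cyc T t s) * exp (- (\<gamma> / 2) * cyc T t s) = exp (- \<gamma> * cyc T t s)"
          by (simp add: exp_add[symmetric])
        ultimately show ?thesis unfolding mult.assoc[symmetric] by (simp only:)
      qed
      define N where "N = Max ((\<lambda>t. norm (h t) / w t) ` {..T})"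
      have N: "norm (h t) \<le> N * w t" if "t \<le> T" for t
      proof -
        have "norm (h t) / w t \<le> N" unfolding N_def using that by (intro Max_ge) auto
        then show ?thesis using w0[of t] by (simp add: divide_le_eq)
      qed
      have N0: "0 \<le> N" using N[of 0] w0[of 0] by (metis le0 norm_ge_zero order_trans zero_le_mult_iff not_less)
      have step: "norm (h t) \<le> (C + N / 2) * w t" if t: "t \<le> T" for t
      proof -
        have "norm (h t) \<le> C * cyc_bound \<gamma> T (norm b + \<epsilon> * norm (h T)) (\<lambda>s. norm (f s) + \<epsilon> * norm (h s)) t"
          using C t M' BT'
          by (intro order_trans[OF h[OF t]] mult_left_mono cyc_bound_mono)
            (auto intro!: order_trans[OF norm_triangle_ineq] order_trans[OF norm_triangle_ineq4])
        also have "\<dots> = C * (cyc_bound \<gamma> T (norm b) (\<lambda>s. norm (f s)) t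
            + \<epsilon> * cyc_bound \<gamma> T (norm (h T)) (\<lambda>s. norm (h s)) t)"
          by (simp only: cyc_bound_add cyc_bound_cmult)
        \<comment> \<open>The 1 accounts for the boundary term at time T, \<open>?S\<close> for the
          sum over the forcing times; both see h only through its bound by N w.\<close>
        also have "\<dots> \<le> C * (w t + \<epsilon> * (N * (1 + ?S) * w t))"
        proof (intro mult_left_mono add_mono)
          have "cyc_bound \<gamma> T (norm b) (\<lambda>s. norm (f s)) t \<le> cyc_bound (\<gamma> / 2) T (norm b) (\<lambda>s. norm (f s)) t"
            using t \<gamma> by (intro cyc_bound_mono) auto
          then show "cyc_bound \<gamma> T (norm b) (\<lambda>s. norm (f s)) t \<le> w t" unfolding w_def using \<eta> by simp
          have one: "exp (- \<gamma> * cyc T t s) * norm (h s) \<le> exp (- (\<gamma> / 2) * cyc T t s) * (N * w t)"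
            if s: "s \<le> T" for s
          proof -
            have "exp (- \<gamma> * cyc T t s) * norm (h s) \<le> exp (- \<gamma> * cyc T t s) * (N * w s)"
              using N[OF s] by simp
            also have "\<dots> = N * (exp (- \<gamma> * cyc T t s) * w s)" by simp
            also have "\<dots> \<le> N * (exp (- (\<gamma> / 2) * cyc T t s) * w t)"
              using slow[OF t s] N0 by (rule mult_left_mono)
            finally show ?thesis by (simp add: mult.left_commute)
          qed
          have "exp (- \<gamma> * cyc T t T) * norm (h T) \<le> 1 * (N * w t)"
            by (rule order_trans[OF one[OF order_refl]], rule mult_right_mono)
              (use cyc_nonneg[OF t order_refl] \<gamma> N0 w0[of t] in \<open>auto simp: mult_nonneg_nonneg\<close>)
          moreover have "(\<Sum>s<T. exp (- \<gamma> * cyc T t s) * norm (h s)) \<le> (\<Sum>s<T. exp (- (\<gamma> / 2) * cyc T t s)) * (N * w t)"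
            unfolding sum_distrib_right using one by (intro sum_mono) auto
          moreover have "\<dots> \<le> ?S * (N * w t)"
            using sum_exp_cyc_le[of "\<gamma> / 2" t T] \<gamma> t N0 w0[of t] by (intro mult_right_mono) auto
          ultimately show "cyc_bound \<gamma> T (norm (h T)) (\<lambda>s. norm (h s)) t \<le> N * (1 + ?S) * w t"
            unfolding cyc_bound_def cyc_end[OF t] by (simp add: algebra_simps)
        qed (use C \<epsilon> in auto)
        also have "\<dots> = (C + N * (C * \<epsilon> * (1 + ?S))) * w t" by (simp add: algebra_simps)
        also have "\<dots> \<le> (C + N * (1 / 2)) * w t"
          using small N0 w0[of t] by (intro mult_right_mono add_left_mono mult_left_mono) auto
        finally show ?thesis by simp
      qed
      have "N \<in> (\<lambda>t. norm (h t) / w t) ` {..T}" unfolding N_def by (intro Max_in) auto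
      then obtain u where u: "u \<le> T" "N = norm (h u) / w u" by blast
      \<comment> \<open>The step estimate is used at a time where the maximum is attained, so N
        appears on both sides.\<close>
      then have "N \<le> C + N / 2" using step[OF u(1)] w0[of u] by (simp add: divide_le_eq)
      then have "N \<le> 2 * C" by simp
      then have "N * w t \<le> 2 * C * w t" using w0[of t] by (intro mult_right_mono) auto
      with N[OF t] show ?thesis unfolding w_def by linarith
    qed
    show ?thesis
    proof (rule field_le_epsilon)
      fix e :: real assume e: "0 < e"
      \<comment> \<open>The offset is multiplied by 2 C in the bound, hence this choice.\<close>
      from main[of "e / (2 * C)", OF _ t] C e
      show "norm (h t) \<le> 2 * C * cyc_bound (\<gamma> / 2) T (norm b) (\<lambda>s. norm (f s)) t + e"
        by (simp add: distrib_left)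
    qed
  qed
  with C \<gamma> show ?thesis by (intro green_estI) auto
qed

section \<open>Change of norm\<close>

lemma is_norm_nonneg:
  assumes "is_norm \<nu>" shows "0 \<le> \<nu> x"
proof -
  have s: "\<nu> (c *\<^sub>R y) = \<bar>c\<bar> * \<nu> y" and t: "\<nu> (y + z) \<le> \<nu> y + \<nu> z" and z: "\<nu> 0 = 0" for c y z
    using assms unfolding is_norm_def by auto
  have "\<nu> 0 \<le> \<nu> x + \<nu> ((-1) *\<^sub>R x)" using t[of x "(-1) *\<^sub>R x"] by simp
  then show ?thesis using s[of "-1" x] z by simp
qed

lemma is_norm_equivalent:
  fixes \<nu> :: "'a::euclidean_space \<Rightarrow> real"
  assumes \<nu>: "is_norm \<nu>"
  obtains a b where "0 < a" "0 < b" "\<And>x. norm x \<le> a * \<nu> x" "\<And>x. \<nu> x \<le> b * norm x"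
proof -
  have z: "\<nu> x = 0 \<longleftrightarrow> x = 0" and s: "\<nu> (c *\<^sub>R x) = \<bar>c\<bar> * \<nu> x" and t: "\<nu> (x + y) \<le> \<nu> x + \<nu> y" for c x y
    using \<nu> unfolding is_norm_def by auto
  define b where "b = 1 + (\<Sum>i\<in>Basis. \<nu> i)"
  have b: "0 < b" unfolding b_def using is_norm_nonneg[OF \<nu>] by (intro add_pos_nonneg sum_nonneg) auto
  have sum: "\<nu> (\<Sum>i\<in>A. g i) \<le> (\<Sum>i\<in>A. \<nu> (g i))" if "finite A" for A and g :: "'a \<Rightarrow> 'a"
    using that
  proof (induction A rule: finite_induct)
    case (insert i A)
    then show ?case using t[of "g i" "\<Sum>i\<in>A. g i"] by simp
  qed (use z[of 0] in simp)
  have up: "\<nu> x \<le> b * norm x" for x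
  proof -
    have "\<nu> x = \<nu> (\<Sum>i\<in>Basis. (x \<bullet> i) *\<^sub>R i)" by (simp add: euclidean_representation)
    also have "\<dots> \<le> (\<Sum>i\<in>Basis. \<bar>x \<bullet> i\<bar> * \<nu> i)" using sum[of Basis "\<lambda>i. (x \<bullet> i) *\<^sub>R i"] by (simp add: s)
    also have "\<dots> \<le> (\<Sum>i\<in>Basis. norm x * \<nu> i)"
      using is_norm_nonneg[OF \<nu>] by (intro sum_mono mult_right_mono) (auto intro: Basis_le_norm)
    also have "\<dots> \<le> b * norm x" by (simp add: b_def sum_distrib_left algebra_simps)
    finally show ?thesis .
  qed
  \<comment> \<open>The bound by b gives Lipschitz continuity, so \<nu> attains a minimum on the
    unit sphere; its reciprocal is the other constant.\<close>
  have lip: "\<bar>\<nu> x - \<nu> y\<bar> \<le> b * norm (x - y)" for x y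
    using t[of "x - y" y] t[of "y - x" x] up[of "x - y"] up[of "y - x"] by (simp add: norm_minus_commute)
  have "continuous_on (sphere 0 1) \<nu>"
    unfolding continuous_on_iff
  proof (intro ballI allI impI)
    fix x e assume e: "0 < (e::real)"
    show "\<exists>d>0. \<forall>y\<in>sphere 0 1. dist y x < d \<longrightarrow> dist (\<nu> y) (\<nu> x) < e"
    proof (intro exI[of _ "e / b"] conjI ballI impI)
      show "0 < e / b" using e b by simp
      fix y assume "dist y x < e / b"
      then have "b * norm (y - x) < e" using b by (simp add: dist_norm field_simps)
      with lip[of y x] show "dist (\<nu> y) (\<nu> x) < e" by (simp add: dist_real_def)
    qed
  qed
  moreover have "sphere 0 1 \<noteq> ({} :: 'a set)" by simp
  ultimately obtain x0 where x0: "x0 \<in> sphere 0 1" "\<And>y. y \<in> sphere 0 1 \<Longrightarrow> \<nu> x0 \<le> \<nu> y"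
    using continuous_attains_inf[of "sphere 0 1" \<nu>] by (auto simp: compact_sphere)
  have pos: "0 < \<nu> x0" using x0(1) is_norm_nonneg[OF \<nu>, of x0] z[of x0] by (auto simp: less_le)
  have "norm x \<le> (1 / \<nu> x0) * \<nu> x" for x
  proof (cases "x = 0")
    case False
    have "\<nu> x0 \<le> \<nu> ((1 / norm x) *\<^sub>R x)" using False by (intro x0(2)) simp
    then show ?thesis using False pos by (simp add: s field_simps)
  qed (use z[of 0] in simp)
  with b pos up show ?thesis by (intro that[of "1 / \<nu> x0" b]) auto
qed

text \<open>\<open>cyc T t s\<close> is the least of the three lengths in the kernel, so the kernel
  lies between one and three times the single exponential. This lemma and the next are the two
  sides.\<close>

lemma green_kernel_le:
  assumes "0 \<le> \<gamma>" shows "green_kernel \<gamma> T t s \<le> 3 * exp (- \<gamma> * cyc T t s)"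
proof -
  have "exp (- \<gamma> * \<bar>real t - real s\<bar>) \<le> exp (- \<gamma> * cyc T t s)"
    "exp (- \<gamma> * (real t + real T - real s)) \<le> exp (- \<gamma> * cyc T t s)"
    "exp (- \<gamma> * (real T - real t + real s)) \<le> exp (- \<gamma> * cyc T t s)"
    by (rule exp_neg_mult_mono[OF assms], simp add: cyc_def min_def abs_if)+
  then show ?thesis unfolding green_kernel_def by linarith
qed

lemma green_kernel_ge: "exp (- \<gamma> * cyc T t s) \<le> green_kernel \<gamma> T t s"
proof -
  have "cyc T t s = \<bar>real t - real s\<bar> \<or> cyc T t s = real t + real T - real s
    \<or> cyc T t s = real T - real t + real s"
    unfolding cyc_def min_def abs_if by auto
  then show ?thesis unfolding green_kernel_def by (elim disjE) (simp_all add: add_nonneg_nonneg)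
qed

lemma boundary_kernel_le:
  assumes "0 \<le> \<gamma>" "t \<le> T"
  shows "exp (- \<gamma> * real t) + exp (- \<gamma> * (real T - real t)) \<le> 2 * exp (- \<gamma> * cyc T t 0)"
proof -
  have "exp (- \<gamma> * real t) \<le> exp (- \<gamma> * cyc T t 0)" "exp (- \<gamma> * (real T - real t)) \<le> exp (- \<gamma> * cyc T t 0)"
    by (rule exp_neg_mult_mono[OF assms(1)], simp add: cyc_def)+
  then show ?thesis by linarith
qed

lemma boundary_kernel_ge: "exp (- \<gamma> * cyc T t 0) \<le> exp (- \<gamma> * real t) + exp (- \<gamma> * (real T - real t))"
  unfolding cyc_def min_def by (simp add: add_nonneg_nonneg)

text \<open>The 3 comes from the kernel comparison, a and b from changing the norm of the solution
  and of the data.\<close>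

lemma green_est_of_uniform_green:
  assumes ab: "0 < a" "0 < b" "\<And>x. norm x \<le> a * \<nu> x" "\<And>x. \<nu> x \<le> b * norm x"
    and U: "uniform_green \<nu> (step_map M) B0 BT C \<gamma> T0"
  shows "green_est M B0 BT (3 * a * b * C) \<gamma> T0"
  unfolding green_est_def
proof (intro conjI allI impI)
  have C: "C \<ge> 1" "\<gamma> > 0" using U unfolding uniform_green_def by auto
  show "0 < 3 * a * b * C" "0 < \<gamma>" using ab C by auto
  fix T assume T: "T0 \<le> T"
  show "invertible (shoot M B0 BT T)"
    using U T unfolding uniform_green_def bvp_unique_iff_shoot[symmetric] by blast
  fix f \<beta> h t assume sol: "bvp_solution (step_map M) B0 BT T f \<beta> h" and t: "t \<le> T"
  have \<nu>0: "0 \<le> \<nu> x" for x using ab(1) ab(3)[of x] by (metis norm_ge_zero order_trans zero_le_mult_iff not_less)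
  have "norm (h t) \<le> a * \<nu> (h t)" by (rule ab)
  also have "\<nu> (h t) \<le> C * ((exp (- \<gamma> * real t) + exp (- \<gamma> * (real T - real t))) * \<nu> \<beta>
      + (\<Sum>s<T. green_kernel \<gamma> T t s * \<nu> (f s)))"
    using U T sol t unfolding uniform_green_def by blast
  also have "\<dots> \<le> C * ((3 * exp (- \<gamma> * cyc T t 0)) * (b * norm \<beta>)
      + (\<Sum>s<T. (3 * exp (- \<gamma> * cyc T t s)) * (b * norm (f s))))"
  proof (intro mult_left_mono add_mono sum_mono mult_mono)
    show "exp (- \<gamma> * real t) + exp (- \<gamma> * (real T - real t)) \<le> 3 * exp (- \<gamma> * cyc T t 0)"
      using boundary_kernel_le[of \<gamma> t T] C t by (smt (verit) exp_gt_zero)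
  qed (use C ab \<nu>0 green_kernel_le[of \<gamma>] in auto)
  also have "\<dots> = 3 * b * C * cyc_bound \<gamma> T (norm \<beta>) (\<lambda>s. norm (f s)) t"
    unfolding cyc_bound_def by (simp add: distrib_left sum_distrib_left mult_ac)
  finally show "norm (h t) \<le> 3 * a * b * C * cyc_bound \<gamma> T (norm \<beta>) (\<lambda>s. norm (f s)) t"
    using ab(1) by (simp add: mult_ac)
qed

text \<open>The kernel comparison has constant 1 in this direction; the maximum with 1 meets the
  normalization of the Green constant.\<close>

lemma uniform_green_of_green_est:
  assumes ab: "0 < a" "0 < b" "\<And>x. norm x \<le> a * \<nu> x" "\<And>x. \<nu> x \<le> b * norm x"
    and E: "green_est M B0 BT C \<gamma> T0" and T0: "1 \<le> T0"
  shows "uniform_green \<nu> (step_map M) B0 BT (max 1 (a * b * C)) \<gamma> T0"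
  unfolding uniform_green_def
proof (intro conjI allI impI)
  have C: "0 < C" "0 < \<gamma>" using E unfolding green_est_def by auto
  show "linear (step_map M)" by (rule linear_step_map)
  show "1 \<le> max 1 (a * b * C)" "0 < \<gamma>" "1 \<le> T0" using C T0 by auto
  fix T f \<beta> assume T: "T0 \<le> T"
  show "\<exists>!h. h \<in> extensional {..T} \<and> bvp_solution (step_map M) B0 BT T f \<beta> h"
    using E T bvp_unique_iff_shoot[of T M B0 BT] unfolding green_est_def by blast
  fix h t assume sol: "bvp_solution (step_map M) B0 BT T f \<beta> h" and t: "t \<le> T"
  have \<nu>0: "0 \<le> \<nu> x" for x using ab(1) ab(3)[of x] by (metis norm_ge_zero order_trans zero_le_mult_iff not_less)
  let ?R = "(exp (- \<gamma> * real t) + exp (- \<gamma> * (real T - real t))) * \<nu> \<beta>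
      + (\<Sum>s<T. green_kernel \<gamma> T t s * \<nu> (f s))"
  have "\<nu> (h t) \<le> b * norm (h t)" by (rule ab)
  also have "norm (h t) \<le> C * cyc_bound \<gamma> T (norm \<beta>) (\<lambda>s. norm (f s)) t"
    using E T sol t unfolding green_est_def by blast
  also have "\<dots> \<le> C * cyc_bound \<gamma> T (a * \<nu> \<beta>) (\<lambda>s. a * \<nu> (f s)) t"
    using C ab t by (intro mult_left_mono cyc_bound_mono) auto
  also have "\<dots> = C * a * cyc_bound \<gamma> T (\<nu> \<beta>) (\<lambda>s. \<nu> (f s)) t" by (simp add: cyc_bound_cmult)
  also have "\<dots> \<le> C * a * ?R"
    unfolding cyc_bound_def using C ab \<nu>0
    by (intro mult_left_mono add_mono sum_mono mult_right_mono green_kernel_ge boundary_kernel_ge) auto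
  finally have "\<nu> (h t) \<le> a * b * C * ?R" using ab(2) by (simp add: mult_ac)
  also have "\<dots> \<le> max 1 (a * b * C) * ?R"
  proof (rule mult_right_mono)
    have "0 \<le> green_kernel \<gamma> T t s" for s by (simp add: green_kernel_def add_nonneg_nonneg)
    then show "0 \<le> ?R" using \<nu>0 by (intro add_nonneg_nonneg mult_nonneg_nonneg sum_nonneg) auto
  qed simp
  finally show "\<nu> (h t) \<le> max 1 (a * b * C) * ?R" .
qed

section \<open>The Green bound from a dichotomy\<close>

lemma matrix_vector_sum: "A *v (\<Sum>i\<in>I. f i) = (\<Sum>i\<in>I. A *v (f i :: real ^ 'n))"
  by (rule linear_sum) simp

lemma mat_pow_Suc_vec: "mat_pow A (Suc k) *v x = A *v (mat_pow A k *v x)"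
  by (simp add: mat_pow_Suc matrix_vector_mul_assoc)

lemma mat_pow_intertwine:
  assumes "A ** V = V ** D"
  shows "mat_pow A k *v (V *v x) = V *v (mat_pow D k *v x)"
proof (induction k)
  case (Suc k)
  have "A *v (V *v y) = V *v (D *v y)" for y
    using assms by (simp only: matrix_vector_mul_assoc)
  with Suc show ?case by (simp only: mat_pow_Suc_vec)
qed simp

lemma forced_eq_sum: "forced M f t = (\<Sum>s<t. mat_pow M (t - 1 - s) *v f s)"
proof (induction t)
  case (Suc t)
  have "M *v (mat_pow M (t - 1 - s) *v f s) = mat_pow M (t - s) *v f s" if "s < t" for s
  proof -
    have "t - s = Suc (t - 1 - s)" using that by simp
    then show ?thesis by (simp add: mat_pow_Suc_vec)
  qed
  then show ?case by (simp add: Suc matrix_vector_sum)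
qed simp

text \<open>The matrix is arbitrary because the estimate is used twice: forwards with M on the
  stable part, and in reversed time with the inverse on the unstable part.\<close>

lemma norm_recurrence_le:
  fixes M :: "real ^ 'n ^ 'n"
  assumes rec: "\<And>t. t < T \<Longrightarrow> u (Suc t) = M *v u t + g t"
    and dec: "\<And>k t. t < T \<Longrightarrow> norm (mat_pow M k *v g t) \<le> C * r ^ k * \<phi> t"
    and t: "t \<le> T"
  shows "norm (u t - mat_pow M t *v u 0) \<le> (\<Sum>s<t. C * r ^ (t - 1 - s) * \<phi> s)"
proof -
  have "\<forall>t<T. step_map M (u t, u (Suc t)) = g t" by (simp add: step_map_def rec)
  then have "u t = mat_pow M t *v u 0 + forced M g t"
    unfolding recurrence_iff_forced using t by blast
  then have "u t - mat_pow M t *v u 0 = forced M g t"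
    by (metis add_diff_cancel_left')
  also have "norm \<dots> \<le> (\<Sum>s<t. C * r ^ (t - 1 - s) * \<phi> s)"
    unfolding forced_eq_sum using dec t by (intro sum_norm_le) auto
  finally show ?thesis .
qed

lemma power_le_exp_cyc:
  assumes "0 < \<gamma>" "cyc T t s \<le> real k"
  shows "exp (- \<gamma>) ^ k \<le> exp (- \<gamma> * cyc T t s)"
proof -
  have "exp (- \<gamma>) ^ k = exp (- \<gamma> * real k)" by (metis exp_of_nat_mult mult.commute)
  also have "\<dots> \<le> exp (- \<gamma> * cyc T t s)" using assms by (intro exp_neg_mult_mono) auto
  finally show ?thesis .
qed

text \<open>
  The stable component of a solution is computed forwards from \<open>t = 0\<close>, the unstable one backwards
  from \<open>t = T\<close>; the boundary condition then determines the two free parameters.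
\<close>

lemma green_est_of_dichotomy:
  fixes M N P Q :: "real ^ 'n ^ 'n"
  assumes inv: "N ** M = mat 1"
    and PQ: "\<And>x. P *v x + Q *v x = x"
    and comm: "\<And>x. P *v (M *v x) = M *v (P *v x)" "\<And>x. Q *v (M *v x) = M *v (Q *v x)"
    and C: "0 < C" and r: "0 < r" "r < 1"
    and decP: "\<And>k x. norm (mat_pow M k *v (P *v x)) \<le> C * r ^ k * norm (P *v x)"
    and decQ: "\<And>k x. norm (mat_pow N k *v (Q *v x)) \<le> C * r ^ k * norm (Q *v x)"
    and G: "0 \<le> G" "\<And>T x y. T0 \<le> T \<Longrightarrow>
      norm (P *v x) \<le> G * norm (B0 *v (P *v x + mat_pow N T *v (Q *v y)) + BT *v (mat_pow M T *v (P *v x) + Q *v y)) \<and>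
      norm (Q *v y) \<le> G * norm (B0 *v (P *v x + mat_pow N T *v (Q *v y)) + BT *v (mat_pow M T *v (P *v x) + Q *v y))"
  obtains C' \<gamma> where "green_est M B0 BT C' \<gamma> T0"
proof -
  \<comment> \<open>Chosen so that powers of r are the exponentials of the Green kernel.\<close>
  define \<gamma> where "\<gamma> = - ln r"
  have \<gamma>: "0 < \<gamma>" and r_eq: "r = exp (- \<gamma>)" using r by (auto simp: \<gamma>_def)
  define K where "K = 1 + norm P"
  have K: "0 < K" unfolding K_def by (intro add_pos_nonneg) auto
  have PK: "norm (P *v x) \<le> K * norm x" for x
  proof -
    have "norm (P *v x) \<le> norm P * norm x" by (rule norm_matrix_vector_le)
    also have "\<dots> \<le> K * norm x" unfolding K_def by (intro mult_right_mono) auto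
    finally show ?thesis .
  qed
  \<comment> \<open>One constant for both forced parts. The division by r pays for the exponent t -
    1 - s in the forward sum, one short of the distance t - s.\<close>
  define D where "D = C * (1 + norm Q) * K / r"
  have CKD: "C * K / r \<le> D" unfolding D_def using C K r
    by (intro divide_right_mono mult_right_mono) auto
  have D: "0 < D" unfolding D_def using C K r by (intro divide_pos_pos mult_pos_pos add_pos_nonneg) auto
  have QD: "C * norm (Q *v x) \<le> D * norm x" for x
  proof -
    have "C * norm (Q *v x) \<le> C * (norm Q * norm x)" using C norm_matrix_vector_le by simp
    also have "\<dots> \<le> D * norm x"
    proof -
      have "1 \<le> K" unfolding K_def by simp
      then have "1 \<le> K / r" using r by (simp add: le_divide_eq)
      then have "C * norm Q * 1 \<le> C * (1 + norm Q) * (K / r)" using C by (intro mult_mono) auto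
      then have "C * norm Q \<le> D" unfolding D_def by simp
      then show ?thesis using mult_right_mono[of _ D "norm x"] by (simp add: mult.assoc[symmetric])
    qed
    finally show ?thesis .
  qed
  define B where "B = norm B0 + norm BT"
  have B: "0 \<le> B" unfolding B_def by simp
  \<comment> \<open>The first summand bounds the two free modes, whose data carry b and the forced
    defects at both ends; 2 D bounds the two forced parts.\<close>
  define C' where "C' = 2 * C * G * (1 + B * D) + 2 * D"
  have "green_est M B0 BT C' \<gamma> T0"
  proof (rule green_estI)
    show "0 < C'" unfolding C'_def using C D G B by (intro add_nonneg_pos) auto
    show "0 < \<gamma>" by (rule \<gamma>)
    fix T f b h t
    assume T: "T0 \<le> T" and sol: "bvp_solution (step_map M) B0 BT T f b h" and t: "t \<le> T"
    define E where "E t s = exp (- \<gamma> * cyc T t s)" for t s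
    have E0: "0 \<le> E t s" for t s unfolding E_def by simp
    define \<Phi> where "\<Phi> t = (\<Sum>s<T. E t s * norm (f s))" for t
    have rec: "h (Suc t) = M *v h t + f t" if "t < T" for t
      using sol that unfolding bvp_solution_def step_map_def by (auto simp: algebra_simps)
    have bdry: "B0 *v h 0 + BT *v h T = b" using sol unfolding bvp_solution_def by simp
    have u: "norm (P *v h t - mat_pow M t *v (P *v h 0)) \<le> D * \<Phi> t" if t: "t \<le> T" for t
    proof -
      have "norm (P *v h t - mat_pow M t *v (P *v h 0)) \<le> (\<Sum>s<t. C * r ^ (t - 1 - s) * norm (P *v f s))"
        by (rule norm_recurrence_le[of T "\<lambda>t. P *v h t" M "\<lambda>t. P *v f t"])
          (simp_all add: rec matrix_vector_right_distrib comm decP t)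
      also have "\<dots> \<le> (\<Sum>s<t. D * (E t s * norm (f s)))"
      proof (rule sum_mono)
        fix s assume "s \<in> {..<t}"
        then have s: "s < t" by simp
        then have "r ^ (t - s) = r ^ (t - 1 - s) * r"
          by (metis Suc_diff_Suc diff_Suc_eq_diff_pred power_Suc2)
        moreover have "r ^ (t - s) \<le> E t s"
          unfolding r_eq E_def using s \<gamma> by (intro power_le_exp_cyc) (auto simp: cyc_def)
        ultimately have "r ^ (t - 1 - s) \<le> E t s / r" using r by (simp add: le_divide_eq)
        then have "C * r ^ (t - 1 - s) * norm (P *v f s) \<le> C * (E t s / r) * (K * norm (f s))"
          using C PK r E0 by (intro mult_mono mult_left_mono) auto
        also have "\<dots> = C * K / r * (E t s * norm (f s))" by simp
        also have "\<dots> \<le> D * (E t s * norm (f s))" using CKD E0 by (intro mult_right_mono) auto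
        finally show "C * r ^ (t - 1 - s) * norm (P *v f s) \<le> D * (E t s * norm (f s))" .
      qed
      also have "\<dots> \<le> (\<Sum>s<T. D * (E t s * norm (f s)))"
        using t D E0 by (intro sum_mono2) auto
      finally show ?thesis by (simp add: \<Phi>_def sum_distrib_left)
    qed
    have v: "norm (Q *v h t - mat_pow N (T - t) *v (Q *v h T)) \<le> D * \<Phi> t" if t: "t \<le> T" for t
    proof -
      have bwd: "Q *v h t = N *v (Q *v h (Suc t)) - N *v (Q *v f t)" if "t < T" for t
      proof -
        have "Q *v h (Suc t) = M *v (Q *v h t) + Q *v f t"
          by (simp add: rec[OF that] matrix_vector_right_distrib comm)
        moreover have "N *v (M *v y) = y" for y by (simp add: matrix_vector_mul_assoc inv)
        ultimately show ?thesis by (simp add: matrix_vector_right_distrib)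
      qed
      \<comment> \<open>Time is reversed. The step from T - k to T - Suc k involves the forcing at T
        - Suc k.\<close>
      let ?v = "\<lambda>k. Q *v h (T - k)" and ?g = "\<lambda>k. - (N *v (Q *v f (T - Suc k)))"
      have "norm (?v (T - t) - mat_pow N (T - t) *v ?v 0) \<le>
          (\<Sum>s<T - t. C * r ^ (T - t - 1 - s) * (r * norm (Q *v f (T - Suc s))))"
      proof (rule norm_recurrence_le[of T ?v N ?g])
        fix k assume "k < T"
        then have "Suc (T - Suc k) = T - k" "T - Suc k < T" by auto
        with bwd[of "T - Suc k"] show "?v (Suc k) = N *v ?v k + ?g k" by simp
      next
        fix k s
        have "mat_pow N k *v (N *v x) = mat_pow N (Suc k) *v x" for x
          by (simp add: mat_pow_mult_vec funpow_swap1)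
        then show "norm (mat_pow N k *v ?g s) \<le> C * r ^ k * (r * norm (Q *v f (T - Suc s)))"
          using decQ[of "Suc k"]
          by (simp add: linear_neg[OF matrix_vector_mul_linear] mult.assoc mult.left_commute)
      qed simp
      also have "\<dots> = (\<Sum>s\<in>{t..<T}. C * r ^ (s - t) * (r * norm (Q *v f s)))"
        by (rule sum.reindex_bij_witness[of _ "\<lambda>s. T - Suc s" "\<lambda>s. T - Suc s"])
          (use t in \<open>auto intro!: arg_cong[of _ _ "\<lambda>n. r ^ n"]\<close>)
      also have "\<dots> \<le> (\<Sum>s\<in>{t..<T}. D * (E t s * norm (f s)))"
      proof (rule sum_mono)
        fix s assume "s \<in> {t..<T}"
        then have s: "t \<le> s" by simp
        have "r ^ (s - t) \<le> E t s"
          unfolding r_eq E_def using s \<gamma> by (intro power_le_exp_cyc) (auto simp: cyc_def)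
        moreover have "C * (r * norm (Q *v f s)) \<le> D * norm (f s)"
          using QD[of "f s"] r C
          by (smt (verit) mult_left_le_one_le mult_left_mono norm_ge_zero)
        ultimately have "r ^ (s - t) * (C * (r * norm (Q *v f s))) \<le> E t s * (D * norm (f s))"
          by (rule mult_mono) (use C r E0 in auto)
        then show "C * r ^ (s - t) * (r * norm (Q *v f s)) \<le> D * (E t s * norm (f s))"
          by (simp add: mult_ac)
      qed
      also have "\<dots> \<le> (\<Sum>s<T. D * (E t s * norm (f s)))"
        using t D E0 by (intro sum_mono2) auto
      finally show ?thesis using t by (simp add: \<Phi>_def sum_distrib_left)
    qed
    let ?x = "P *v h 0" and ?y = "Q *v h T"
    let ?R = "B0 *v (?x + mat_pow N T *v ?y) + BT *v (mat_pow M T *v ?x + ?y)"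
    \<comment> \<open>Both ends are the same point of the cycle, so one number controls the forced
      defects at 0 and at T.\<close>
    have \<Phi>T: "\<Phi> T = \<Phi> 0"
      unfolding \<Phi>_def E_def
      by (intro sum.cong refl) (simp add: cyc_commute[of _ T] cyc_end cyc_commute[of _ 0] less_imp_le)
    \<comment> \<open>The free part meets the boundary data up to two forced defects: the unstable
      one at time 0 and the stable one at time T.\<close>
    have "?R = b - B0 *v (Q *v h 0 - mat_pow N T *v ?y) - BT *v (P *v h T - mat_pow M T *v ?x)"
      unfolding bdry[symmetric] using PQ[of "h 0"] PQ[of "h T"]
      by (simp add: algebra_simps) (metis (no_types, lifting) matrix_vector_right_distrib add.assoc add.commute)
    then have "norm ?R \<le> norm b + norm (B0 *v (Q *v h 0 - mat_pow N T *v ?y))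
        + norm (BT *v (P *v h T - mat_pow M T *v ?x))"
      using norm_triangle_ineq4 order_trans by (metis (no_types, lifting) add_right_mono)
    also have "\<dots> \<le> norm b + norm B0 * (D * \<Phi> 0) + norm BT * (D * \<Phi> 0)"
    proof (intro add_mono order_refl)
      show "norm (B0 *v (Q *v h 0 - mat_pow N T *v ?y)) \<le> norm B0 * (D * \<Phi> 0)"
        using v[of 0] by (intro order_trans[OF norm_matrix_vector_le] mult_left_mono) auto
      show "norm (BT *v (P *v h T - mat_pow M T *v ?x)) \<le> norm BT * (D * \<Phi> 0)"
        using u[of T] \<Phi>T by (intro order_trans[OF norm_matrix_vector_le] mult_left_mono) auto
    qed
    also have "\<dots> = norm b + B * D * \<Phi> 0" by (simp add: B_def algebra_simps)
    finally have R: "norm ?R \<le> norm b + B * D * \<Phi> 0" .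
    have xy: "norm ?x \<le> G * (norm b + B * D * \<Phi> 0)" "norm ?y \<le> G * (norm b + B * D * \<Phi> 0)"
      using G(2)[OF T, of "h 0" "h T"] mult_left_mono[OF R G(1)] by linarith+
    have rt: "r ^ t \<le> E t 0" "r ^ (T - t) \<le> E t 0"
      unfolding r_eq E_def using t by (intro power_le_exp_cyc[OF \<gamma>]; simp add: cyc_def)+
    \<comment> \<open>A forcing felt at an end point and carried to t by a free mode has made a
      detour on the cycle; the triangle inequality absorbs it into \<Phi> t.\<close>
    have E\<Phi>: "E t 0 * \<Phi> 0 \<le> \<Phi> t"
      unfolding \<Phi>_def sum_distrib_left mult.assoc[symmetric] E_def
      using \<gamma> t by (intro sum_mono mult_right_mono exp_cyc_triangle) auto
    have free: "norm (mat_pow M t *v ?x) \<le> C * E t 0 * (G * (norm b + B * D * \<Phi> 0))"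
      "norm (mat_pow N (T - t) *v ?y) \<le> C * E t 0 * (G * (norm b + B * D * \<Phi> 0))"
      using rt xy C E0 by (intro order_trans[OF decP] order_trans[OF decQ] mult_mono mult_left_mono; simp)+
    have "h t = mat_pow M t *v ?x + mat_pow N (T - t) *v ?y + (P *v h t - mat_pow M t *v ?x)
        + (Q *v h t - mat_pow N (T - t) *v ?y)" using PQ[of "h t"] by simp
    then have "norm (h t) \<le> norm (mat_pow M t *v ?x) + norm (mat_pow N (T - t) *v ?y)
        + norm (P *v h t - mat_pow M t *v ?x) + norm (Q *v h t - mat_pow N (T - t) *v ?y)"
      by (metis (no_types, lifting) add_mono norm_triangle_ineq norm_triangle_le order_refl)
    also have "\<dots> \<le> C * E t 0 * (G * (norm b + B * D * \<Phi> 0)) + C * E t 0 * (G * (norm b + B * D * \<Phi> 0))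
        + D * \<Phi> t + D * \<Phi> t"
      using free u[OF t] v[OF t] by (intro add_mono)
    also have "\<dots> = 2 * C * G * (E t 0 * norm b) + 2 * C * G * B * D * (E t 0 * \<Phi> 0) + 2 * D * \<Phi> t"
      by (simp add: algebra_simps)
    also have "\<dots> \<le> C' * (E t 0 * norm b) + 2 * C * G * B * D * \<Phi> t + 2 * D * \<Phi> t"
      using E\<Phi> C G B D E0[of t 0] unfolding C'_def
      by (intro add_mono mult_right_mono mult_left_mono) (auto simp: algebra_simps)
    also have "\<dots> \<le> C' * (E t 0 * norm b) + C' * \<Phi> t"
    proof -
      have "0 \<le> \<Phi> t" unfolding \<Phi>_def using E0 by (intro sum_nonneg) auto
      moreover have "2 * C * G * B * D + 2 * D \<le> C'" unfolding C'_def using C G by (simp add: algebra_simps)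
      ultimately have "(2 * C * G * B * D + 2 * D) * \<Phi> t \<le> C' * \<Phi> t" by (rule mult_right_mono[rotated])
      then show ?thesis by (simp add: algebra_simps)
    qed
    finally show "norm (h t) \<le> C' * cyc_bound \<gamma> T (norm b) (\<lambda>s. norm (f s)) t"
      unfolding cyc_bound_def \<Phi>_def E_def by (simp add: distrib_left)
  qed
  then show ?thesis by (rule that)
qed

section \<open>The Green bound and the scaled endpoint matrices\<close>

lemma norm_matrix_le_of_bound:
  fixes A :: "real ^ 'n ^ 'm"
  assumes "\<And>x. norm (A *v x) \<le> G * norm x"
  shows "norm A \<le> of_nat (CARD('m) * CARD('n)) * G"
proof -
  have "norm A \<le> (\<Sum>i\<in>UNIV. norm (A $ i))" unfolding norm_vec_def by (rule L2_set_le_sum) simp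
  also have "\<dots> \<le> (\<Sum>i\<in>(UNIV :: 'm set). \<Sum>j\<in>(UNIV :: 'n set). G)"
  proof (rule sum_mono)
    fix i
    have "norm (A $ i) \<le> (\<Sum>j\<in>UNIV. \<bar>A $ i $ j\<bar>)" by (rule norm_le_l1_cart)
    also have "\<dots> \<le> (\<Sum>j\<in>(UNIV :: 'n set). G)"
    proof (rule sum_mono)
      fix j
      have "A $ i $ j = (A *v axis j 1) $ i" by (simp add: matrix_vector_mult_basis column_def)
      also have "\<bar>\<dots>\<bar> \<le> norm (A *v axis j 1)" by (rule component_le_norm_cart)
      also have "\<dots> \<le> G" using assms[of "axis j 1"] by simp
      finally show "\<bar>A $ i $ j\<bar> \<le> G" .
    qed
    finally show "norm (A $ i) \<le> (\<Sum>j\<in>(UNIV :: 'n set). G)" .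
  qed
  also have "\<dots> = of_nat (CARD('m) * CARD('n)) * G" by simp
  finally show ?thesis .
qed

text \<open>A uniform lower bound encodes nonsingularity and bounded inverses together, and is
  easier to pass to the limit and to compare with solutions.\<close>

lemma horizon_cutoff_iff:
  "horizon_cutoff S Vs Vu Ds Du Tc \<longleftrightarrow>
    (\<exists>G\<ge>0. \<forall>T\<ge>Tc. \<forall>v. norm v \<le> G * norm (gamma_fin S Vs Vu Ds Du T *v v))"
  (is "?H \<longleftrightarrow> ?B")
proof
  assume H: ?H
  then obtain G where G: "\<And>T. T \<ge> Tc \<Longrightarrow> norm (matrix_inv (gamma_fin S Vs Vu Ds Du T)) \<le> G"
    unfolding horizon_cutoff_def bounded_iff by auto
  have "norm v \<le> G * norm (gamma_fin S Vs Vu Ds Du T *v v)" if T: "T \<ge> Tc" for T v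
  proof -
    have "v = matrix_inv (gamma_fin S Vs Vu Ds Du T) *v (gamma_fin S Vs Vu Ds Du T *v v)"
      using H T unfolding horizon_cutoff_def by (simp add: matrix_inv_mult_vec)
    then have "norm v \<le> norm (matrix_inv (gamma_fin S Vs Vu Ds Du T)) * norm (gamma_fin S Vs Vu Ds Du T *v v)"
      by (metis norm_matrix_vector_le)
    also have "\<dots> \<le> G * norm (gamma_fin S Vs Vu Ds Du T *v v)"
      using G[OF T] by (rule mult_right_mono) simp
    finally show ?thesis .
  qed
  moreover have "0 \<le> G" using G[OF order_refl] norm_ge_zero order_trans by blast
  ultimately show ?B by blast
next
  assume ?B
  then obtain G where G: "G \<ge> 0" "\<And>T v. T \<ge> Tc \<Longrightarrow> norm v \<le> G * norm (gamma_fin S Vs Vu Ds Du T *v v)"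
    by blast
  have inv: "invertible (gamma_fin S Vs Vu Ds Du T)" if "T \<ge> Tc" for T
    unfolding invertible_iff_ker using G(2)[OF that] by (metis mult_zero_right norm_le_zero_iff norm_zero)
  have "norm (matrix_inv (gamma_fin S Vs Vu Ds Du T)) \<le> of_nat (CARD('a + 'a) * CARD('a + 'a)) * G"
    if T: "T \<ge> Tc" for T
    using G(2)[OF T, of "matrix_inv (gamma_fin S Vs Vu Ds Du T) *v _"] matrix_inv_mult_vec(1)[OF inv[OF T]]
    by (intro norm_matrix_le_of_bound) metis
  with inv show ?H unfolding horizon_cutoff_def bounded_iff by blast
qed

text \<open>Only finitely many inverses are added, so boundedness is kept.\<close>

lemma horizon_cutoff_extend:
  assumes "horizon_cutoff S Vs Vu Ds Du Tc"
    and "\<And>T. T0 \<le> T \<Longrightarrow> T < Tc \<Longrightarrow> invertible (gamma_fin S Vs Vu Ds Du T)"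
  shows "horizon_cutoff S Vs Vu Ds Du T0"
  unfolding horizon_cutoff_def
proof
  show "\<forall>T\<ge>T0. invertible (gamma_fin S Vs Vu Ds Du T)"
    using assms unfolding horizon_cutoff_def by (meson not_less)
  let ?f = "\<lambda>T. matrix_inv (gamma_fin S Vs Vu Ds Du T)"
  have "bounded (?f ` {Tc..} \<union> ?f ` {..<Tc})"
    using assms(1) unfolding horizon_cutoff_def by (simp add: finite_imp_bounded)
  moreover have "{T0..} \<subseteq> {Tc..} \<union> {..<Tc}" by auto
  ultimately show "bounded (?f ` {T0..})"
    unfolding image_Un[symmetric] by (metis bounded_subset image_mono)
qed

section \<open>Estimates in one fixed frame\<close>

locale endpoint_frame =
  fixes M N :: "real ^ ('d::finite + 'd) ^ ('d + 'd)" and S :: "real ^ 'd ^ 'd"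
    and Vs Vu :: "real ^ 'd ^ ('d + 'd)" and Ds Du :: "real ^ 'd ^ 'd"
  assumes hyp: "hyperbolic M" and MN: "M ** N = mat 1" and NM: "N ** M = mat 1"
    and frame: "hyperbolic_frame M Vs Vu Ds Du"
begin

abbreviation "\<Gamma> \<equiv> gamma_fin S Vs Vu Ds Du"
abbreviation "W \<equiv> hcat Vs Vu"

lemma bases: "columns_basis Vs (stable_space M)" "columns_basis Vu (unstable_space M)"
  and MVs: "M ** Vs = Vs ** Ds" and MVu: "M ** Vu = Vu ** Du"
  using frame unfolding hyperbolic_frame_def by auto

lemma range_Vs: "range ((*v) Vs) = decay_space ((*v) M)"
  and range_Vu: "range ((*v) Vu) = decay_space ((*v) N)"
  using columns_basis_range[OF bases(1)] columns_basis_range[OF bases(2)]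
    stable_space_eq_decay[OF hyp MN NM] unstable_space_eq_decay[OF hyp MN NM] by auto

text \<open>Surjectivity is the stable-unstable splitting; both blocks have d columns, so W is
  square and surjectivity is enough.\<close>

lemma invertible_W: "invertible W"
  unfolding invertible_iff_surj
  unfolding surj_def
proof
  fix v
  obtain s u where "s \<in> decay_space ((*v) M)" "u \<in> decay_space ((*v) N)" "v = s + u"
    using decay_space_sum[OF hyp MN NM] by blast
  then obtain \<alpha> \<beta> where "v = Vs *v \<alpha> + Vu *v \<beta>" unfolding range_Vs[symmetric] range_Vu[symmetric] by blast
  then show "\<exists>w. v = W *v w" by (intro exI[of _ "vcat \<alpha> \<beta>"]) simp
qed

lemma W_coords: "matrix_inv W *v (Vs *v \<alpha> + Vu *v \<beta>) = vcat \<alpha> \<beta>"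
  using matrix_inv_mult_vec(2)[OF invertible_W, of "vcat \<alpha> \<beta>"] by simp

lemma W_decomp: obtains \<alpha> \<beta> where "x = Vs *v \<alpha> + Vu *v \<beta>"
proof -
  obtain \<alpha> \<beta> where ab: "matrix_inv W *v x = vcat \<alpha> \<beta>" by (rule vcat_split)
  have "x = W *v vcat \<alpha> \<beta>" unfolding ab[symmetric] by (simp add: matrix_inv_mult_vec[OF invertible_W])
  then show ?thesis by (intro that) simp
qed

text \<open>M and Vu are injective, so Du has no kernel and \<open>matrix_inv Du\<close> is a
  genuine inverse; the relation for M can then be inverted.\<close>

lemma NVu: "N ** Vu = Vu ** matrix_inv Du"
proof (rule mat_eqI)
  fix x
  have NMv: "N *v (M *v y) = y" for y by (simp add: matrix_vector_mul_assoc NM)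
  have MVuv: "M *v (Vu *v y) = Vu *v (Du *v y)" for y
    using MVu by (simp only: matrix_vector_mul_assoc)
  have "invertible Du"
    unfolding invertible_iff_ker
  proof (intro allI impI)
    fix y assume "Du *v y = 0"
    then have "M *v (Vu *v y) = 0" by (simp add: MVuv)
    then have "Vu *v y = 0" using NMv[of "Vu *v y"] by simp
    then show "y = 0" by (rule columns_basis_ker[OF bases(2)])
  qed
  then have "N *v (Vu *v x) = N *v (Vu *v (Du *v (matrix_inv Du *v x)))"
    by (simp add: matrix_inv_mult_vec)
  also have "\<dots> = Vu *v (matrix_inv Du *v x)" unfolding MVuv[symmetric] by (rule NMv)
  finally show "(N ** Vu) *v x = (Vu ** matrix_inv Du) *v x" by (simp add: matrix_vector_mul_assoc)
qed

text \<open>On the frame, powers of Ds and of the inverse of Du act as powers of M and N. This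
  exhibits the left side as the boundary value of the unforced solution with stable datum at 0 and
  unstable datum at T.\<close>

lemma gamma_fin_mult:
  "\<Gamma> T *v vcat \<alpha> \<beta> = row_0 *v (Vs *v \<alpha> + mat_pow N T *v (Vu *v \<beta>))
    + row_T S *v (mat_pow M T *v (Vs *v \<alpha>) + Vu *v \<beta>)"
  unfolding mat_pow_intertwine[OF MVs] mat_pow_intertwine[OF NVu] gamma_fin_def
  by (simp add: matrix_vector_mul_assoc[symmetric] matrix_vector_right_distrib matrix_vector_mult_add_rdistrib)

lemma gamma_inf_mult: "gamma_inf S Vs Vu *v vcat \<alpha> \<beta> = row_0 *v (Vs *v \<alpha>) + row_T S *v (Vu *v \<beta>)"
  unfolding gamma_inf_def by (simp add: matrix_vector_mul_assoc[symmetric])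

lemma decay_estimates:
  obtains C r where "0 < C" "0 < r" "r < 1"
    "\<And>k \<alpha>. norm (mat_pow M k *v (Vs *v \<alpha>)) \<le> C * r ^ k * norm (Vs *v \<alpha>)"
    "\<And>k \<beta>. norm (mat_pow N k *v (Vu *v \<beta>)) \<le> C * r ^ k * norm (Vu *v \<beta>)"
proof -
  obtain C r where 1: "0 < C" "0 < r" "r < 1"
    "\<And>w k. w \<in> decay_space ((*v) M) \<Longrightarrow> norm (((*v) M ^^ k) w) \<le> C * r ^ k * norm w"
    by (rule decay_space_uniform[of "(*v) M"]) (simp, rule that)
  obtain D q where 2: "0 < D" "0 < q" "q < 1"
    "\<And>w k. w \<in> decay_space ((*v) N) \<Longrightarrow> norm (((*v) N ^^ k) w) \<le> D * q ^ k * norm w"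
    by (rule decay_space_uniform[of "(*v) N"]) (simp, rule that)
  have le: "C * r ^ k * x \<le> max C D * max r q ^ k * x" "D * q ^ k * x \<le> max C D * max r q ^ k * x"
    if "0 \<le> x" for k x
    using 1 2 that by (auto intro!: mult_right_mono mult_mono power_mono)
  show ?thesis
  proof (rule that[of "max C D" "max r q"])
    fix k x
    have "Vs *v x \<in> decay_space ((*v) M)" "Vu *v x \<in> decay_space ((*v) N)"
      unfolding range_Vs[symmetric] range_Vu[symmetric] by auto
    then show "norm (mat_pow M k *v (Vs *v x)) \<le> max C D * max r q ^ k * norm (Vs *v x)"
      "norm (mat_pow N k *v (Vu *v x)) \<le> max C D * max r q ^ k * norm (Vu *v x)"
      unfolding mat_pow_mult_vec using 1(4) 2(4) le norm_ge_zero order_trans by blast+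
  qed (use 1 2 in auto)
qed

text \<open>Only the cross terms differ from the limit: the unstable datum seen at time 0 and the
  stable datum seen at time T, each after T steps of decay.\<close>

lemma gamma_fin_converges:
  obtains K r where "0 < K" "0 < r" "r < 1"
    "\<And>T v. norm (\<Gamma> T *v v - gamma_inf S Vs Vu *v v) \<le> K * r ^ T * norm v"
proof -
  obtain C r where C: "0 < C" "0 < r" "r < 1"
    "\<And>k \<alpha>. norm (mat_pow M k *v (Vs *v \<alpha>)) \<le> C * r ^ k * norm (Vs *v \<alpha>)"
    "\<And>k \<beta>. norm (mat_pow N k *v (Vu *v \<beta>)) \<le> C * r ^ k * norm (Vu *v \<beta>)"
    by (rule decay_estimates, rule that)
  let ?B0 = "norm (row_0 :: real ^ ('d + 'd) ^ ('d + 'd))" and ?BT = "norm (row_T S)"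
  define K where "K = 1 + ?B0 * C * norm Vu + ?BT * C * norm Vs"
  have K: "0 < K" unfolding K_def using C by (intro add_pos_nonneg) auto
  have "norm (\<Gamma> T *v v - gamma_inf S Vs Vu *v v) \<le> K * r ^ T * norm v" for T v
  proof -
    obtain \<alpha> \<beta> where v: "v = vcat \<alpha> \<beta>" by (rule vcat_split)
    have "\<Gamma> T *v v - gamma_inf S Vs Vu *v v =
        row_0 *v (mat_pow N T *v (Vu *v \<beta>)) + row_T S *v (mat_pow M T *v (Vs *v \<alpha>))"
      unfolding v gamma_fin_mult gamma_inf_mult by (simp add: matrix_vector_right_distrib)
    also have "norm \<dots> \<le> ?B0 * (C * r ^ T * (norm Vu * norm v)) + ?BT * (C * r ^ T * (norm Vs * norm v))"
    proof (rule order_trans[OF norm_triangle_ineq], rule add_mono)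
      have "norm (Vu *v \<beta>) \<le> norm Vu * norm v" "norm (Vs *v \<alpha>) \<le> norm Vs * norm v"
        unfolding v by (intro order_trans[OF norm_matrix_vector_le] mult_left_mono norm_vcat_ge norm_ge_zero)+
      then have "norm (mat_pow N T *v (Vu *v \<beta>)) \<le> C * r ^ T * (norm Vu * norm v)"
        "norm (mat_pow M T *v (Vs *v \<alpha>)) \<le> C * r ^ T * (norm Vs * norm v)"
        using C by (auto intro: order_trans[OF C(5) mult_left_mono] order_trans[OF C(4) mult_left_mono])
      then show "norm (row_0 *v (mat_pow N T *v (Vu *v \<beta>))) \<le> ?B0 * (C * r ^ T * (norm Vu * norm v))"
        "norm (row_T S *v (mat_pow M T *v (Vs *v \<alpha>))) \<le> ?BT * (C * r ^ T * (norm Vs * norm v))"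
        by (auto intro: order_trans[OF norm_matrix_vector_le mult_left_mono])
    qed
    also have "\<dots> = (K - 1) * r ^ T * norm v" unfolding K_def by (simp add: algebra_simps)
    also have "\<dots> \<le> K * r ^ T * norm v" using C by (intro mult_right_mono) auto
    finally show ?thesis .
  qed
  with K C show ?thesis by (intro that[of K r]) auto
qed

text \<open>A uniform lower bound survives the limit; conversely, a nonsingular limit has a lower
  bound that survives a small error. The second direction needs the convergence to be uniform over
  unit vectors.\<close>

lemma horizon_cutoff_exists_iff: "(\<exists>Tc. horizon_cutoff S Vs Vu Ds Du Tc) \<longleftrightarrow> invertible (gamma_inf S Vs Vu)"
proof -
  obtain K r where K: "0 < K" "0 < r" "r < 1"
    "\<And>T v. norm (\<Gamma> T *v v - gamma_inf S Vs Vu *v v) \<le> K * r ^ T * norm v"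
    by (rule gamma_fin_converges, rule that)
  have lim: "(\<lambda>T. c * (K * r ^ T) * x) \<longlonglongrightarrow> 0" for c x
  proof -
    have "(\<lambda>T. c * (K * r ^ T) * x) \<longlonglongrightarrow> c * (K * 0) * x"
      using K by (intro tendsto_intros LIMSEQ_power_zero) auto
    then show ?thesis by simp
  qed
  show ?thesis
  proof
    assume "\<exists>Tc. horizon_cutoff S Vs Vu Ds Du Tc"
    then obtain Tc G where G: "G \<ge> 0" "\<And>T v. T \<ge> Tc \<Longrightarrow> norm v \<le> G * norm (\<Gamma> T *v v)"
      unfolding horizon_cutoff_iff by blast
    show "invertible (gamma_inf S Vs Vu)"
      unfolding invertible_iff_ker
    proof (intro allI impI)
      fix v assume v: "gamma_inf S Vs Vu *v v = 0"
      have "norm v \<le> G * (K * r ^ T) * norm v" if "T \<ge> Tc" for T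
        using order_trans[OF G(2)[OF that, of v] mult_left_mono[OF _ G(1)]] K(4)[of T v] v
        by (simp add: mult.assoc)
      then have "norm v \<le> 0" by (intro LIMSEQ_le_const[OF lim[of G "norm v"]]) blast
      then show "v = 0" by simp
    qed
  next
    assume inv: "invertible (gamma_inf S Vs Vu)"
    define G where "G = norm (matrix_inv (gamma_inf S Vs Vu))"
    have G: "norm v \<le> G * norm (gamma_inf S Vs Vu *v v)" for v
      using norm_matrix_vector_le[of "matrix_inv (gamma_inf S Vs Vu)" "gamma_inf S Vs Vu *v v"]
      by (simp add: G_def matrix_inv_mult_vec[OF inv])
    \<comment> \<open>From this horizon on the error uses up at most half of the lower bound, hence
      the 2 G below.\<close>
    have "eventually (\<lambda>T. G * (K * r ^ T) * 1 < 1 / 2) sequentially"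
      using lim[of G 1] by (rule order_tendstoD) simp
    then obtain Tc where Tc: "\<And>T. T \<ge> Tc \<Longrightarrow> G * (K * r ^ T) < 1 / 2"
      unfolding eventually_sequentially by auto
    have "norm v \<le> 2 * G * norm (\<Gamma> T *v v)" if T: "T \<ge> Tc" for T v
    proof -
      have "norm (gamma_inf S Vs Vu *v v) \<le> norm (\<Gamma> T *v v) + K * r ^ T * norm v"
        using norm_triangle_sub[of "gamma_inf S Vs Vu *v v" "\<Gamma> T *v v"] K(4)[of T v]
        by (simp add: norm_minus_commute)
      from order_trans[OF G mult_left_mono[OF this]]
      have "norm v \<le> G * norm (\<Gamma> T *v v) + G * (K * r ^ T) * norm v"
        by (simp add: G_def algebra_simps)
      also have "\<dots> \<le> G * norm (\<Gamma> T *v v) + 1 / 2 * norm v"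
        using Tc[OF T] by (intro add_left_mono mult_right_mono) auto
      finally show ?thesis by simp
    qed
    then show "\<exists>Tc. horizon_cutoff S Vs Vu Ds Du Tc"
      unfolding horizon_cutoff_iff by (intro exI[of _ Tc] exI[of _ "2 * G"]) (auto simp: G_def)
  qed
qed

lemma green_est_of_horizon_cutoff:
  assumes "horizon_cutoff S Vs Vu Ds Du T0"
  obtains C \<gamma> where "green_est M row_0 (row_T S) C \<gamma> T0"
proof -
  obtain G where G: "G \<ge> 0" "\<And>T v. T \<ge> T0 \<Longrightarrow> norm v \<le> G * norm (\<Gamma> T *v v)"
    using assms unfolding horizon_cutoff_iff by blast
  obtain C r where C: "0 < C" "0 < r" "r < 1"
    "\<And>k \<alpha>. norm (mat_pow M k *v (Vs *v \<alpha>)) \<le> C * r ^ k * norm (Vs *v \<alpha>)"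
    "\<And>k \<beta>. norm (mat_pow N k *v (Vu *v \<beta>)) \<le> C * r ^ k * norm (Vu *v \<beta>)"
    by (rule decay_estimates, rule that)
  \<comment> \<open>Reading off frame coordinates, dropping one block and mapping back gives the
    projections onto E_s and E_u along each other.\<close>
  define P where "P = hcat Vs 0 ** matrix_inv W"
  define Q where "Q = hcat 0 Vu ** matrix_inv W"
  have P: "P *v (Vs *v \<alpha> + Vu *v \<beta>) = Vs *v \<alpha>" and Q: "Q *v (Vs *v \<alpha> + Vu *v \<beta>) = Vu *v \<beta>" for \<alpha> \<beta>
    unfolding P_def Q_def matrix_vector_mul_assoc[symmetric] W_coords by simp_all
  have M: "M *v (Vs *v \<alpha> + Vu *v \<beta>) = Vs *v (Ds *v \<alpha>) + Vu *v (Du *v \<beta>)" for \<alpha> \<beta>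
    using MVs MVu by (simp only: matrix_vector_right_distrib matrix_vector_mul_assoc)
  have Ms: "M *v (Vs *v \<alpha>) = Vs *v (Ds *v \<alpha>)" and Mu: "M *v (Vu *v \<beta>) = Vu *v (Du *v \<beta>)" for \<alpha> \<beta>
    using MVs MVu by (simp_all only: matrix_vector_mul_assoc)
  have Pex: "\<exists>\<alpha>. P *v x = Vs *v \<alpha>" and Qex: "\<exists>\<beta>. Q *v x = Vu *v \<beta>" for x
    by (rule W_decomp[of x]; metis P Q)+
  show ?thesis
  \<comment> \<open>The norms of Vs and Vu convert the bound G on coordinates into a bound on
    vectors of E_s and E_u.\<close>
  proof (rule green_est_of_dichotomy[of N M P Q C r "(norm Vs + norm Vu) * G" T0 row_0 "row_T S"])
    show "N ** M = mat 1" by (rule NM)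
    show "P *v x + Q *v x = x" "P *v (M *v x) = M *v (P *v x)" "Q *v (M *v x) = M *v (Q *v x)" for x
      by (rule W_decomp[of x]; simp only: P Q M Ms Mu)+
    show "norm (mat_pow M k *v (P *v x)) \<le> C * r ^ k * norm (P *v x)"
      "norm (mat_pow N k *v (Q *v x)) \<le> C * r ^ k * norm (Q *v x)" for k x
      using Pex[of x] Qex[of x] C(4,5) by auto
    show "0 \<le> (norm Vs + norm Vu) * G" using G by simp
    fix T x y assume T: "T0 \<le> T"
    obtain \<alpha> \<beta> where ab: "P *v x = Vs *v \<alpha>" "Q *v y = Vu *v \<beta>" using Pex Qex by blast
    let ?R = "\<Gamma> T *v vcat \<alpha> \<beta>"
    have "norm (Vs *v \<alpha>) \<le> norm Vs * (G * norm ?R)"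
      by (intro order_trans[OF norm_matrix_vector_le] mult_left_mono order_trans[OF norm_vcat_ge(1) G(2)[OF T]]) simp
    moreover have "norm (Vu *v \<beta>) \<le> norm Vu * (G * norm ?R)"
      by (intro order_trans[OF norm_matrix_vector_le] mult_left_mono order_trans[OF norm_vcat_ge(2) G(2)[OF T]]) simp
    moreover have "0 \<le> norm Vs * (G * norm ?R)" "0 \<le> norm Vu * (G * norm ?R)" using G(1) by auto
    ultimately have "norm (Vs *v \<alpha>) \<le> (norm Vs + norm Vu) * G * norm ?R \<and>
        norm (Vu *v \<beta>) \<le> (norm Vs + norm Vu) * G * norm ?R"
      by (simp add: algebra_simps)
    then show "norm (P *v x) \<le> (norm Vs + norm Vu) * G * norm (row_0 *v (P *v x + mat_pow N T *v (Q *v y))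
        + row_T S *v (mat_pow M T *v (P *v x) + Q *v y)) \<and>
      norm (Q *v y) \<le> (norm Vs + norm Vu) * G * norm (row_0 *v (P *v x + mat_pow N T *v (Q *v y))
        + row_T S *v (mat_pow M T *v (P *v x) + Q *v y))"
      unfolding ab gamma_fin_mult .
  qed (use C that in auto)
qed

text \<open>The Green bound is tested on the unforced solution built from v, whose boundary value is
  \<open>\<Gamma> T *v v\<close>. Its values at the two ends carry the two coordinates of v
  undamped, one at each end.\<close>

lemma horizon_cutoff_of_green_est:
  assumes est: "green_est M row_0 (row_T S) C \<gamma> T0"
  shows "horizon_cutoff S Vs Vu Ds Du T0"
  unfolding horizon_cutoff_iff
proof (intro exI[of _ "2 * (norm (matrix_inv W) * C)"] conjI allI impI)
  have C: "0 < C" using est unfolding green_est_def by auto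
  then show "0 \<le> 2 * (norm (matrix_inv W) * C)" by simp
  fix T and v :: "real ^ ('d + 'd)" assume T: "T0 \<le> T"
  obtain \<alpha> \<beta> where v: "v = vcat \<alpha> \<beta>" by (rule vcat_split)
  define h where "h t = mat_pow M t *v (Vs *v \<alpha>) + mat_pow N (T - t) *v (Vu *v \<beta>)" for t
  have "bvp_solution (step_map M) row_0 (row_T S) T (\<lambda>_. 0) (\<Gamma> T *v v) h"
    unfolding bvp_solution_def
  proof (intro conjI allI impI)
    fix t assume t: "t < T"
    then have "h t = mat_pow M t *v (Vs *v \<alpha>) + N *v (mat_pow N (T - Suc t) *v (Vu *v \<beta>))"
      unfolding h_def by (simp add: mat_pow_Suc_vec[symmetric] Suc_diff_Suc)
    moreover have "M *v (N *v y) = y" for y by (simp add: matrix_vector_mul_assoc MN)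
    ultimately have "M *v h t = h (Suc t)"
      by (simp add: h_def matrix_vector_right_distrib mat_pow_Suc_vec)
    then show "step_map M (h t, h (Suc t)) = 0" by (simp add: step_map_def)
  next
    show "row_0 *v h 0 + row_T S *v h T = \<Gamma> T *v v" unfolding h_def v gamma_fin_mult by simp
  qed
  \<comment> \<open>At both ends the cyclic distance to 0 is 0, so the bound is C times the boundary
    norm.\<close>
  from green_estD[OF est T this, of 0] green_estD[OF est T this, of T] have h: "norm (h 0) \<le> C * norm (\<Gamma> T *v v)" "norm (h T) \<le> C * norm (\<Gamma> T *v v)"
    by (simp_all add: cyc_bound_def cyc_def)
  have "matrix_inv W *v h 0 = vcat \<alpha> (mat_pow (matrix_inv Du) T *v \<beta>)"
    "matrix_inv W *v h T = vcat (mat_pow Ds T *v \<alpha>) \<beta>"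
    unfolding h_def by (simp_all add: mat_pow_intertwine[OF MVs] mat_pow_intertwine[OF NVu] W_coords)
  then have "norm \<alpha> \<le> norm (matrix_inv W *v h 0)" "norm \<beta> \<le> norm (matrix_inv W *v h T)"
    by (simp_all add: norm_vcat_ge)
  moreover have "norm (matrix_inv W *v h t) \<le> norm (matrix_inv W) * (C * norm (\<Gamma> T *v v))"
    if "norm (h t) \<le> C * norm (\<Gamma> T *v v)" for t
    using that by (intro order_trans[OF norm_matrix_vector_le] mult_left_mono) auto
  ultimately have "norm \<alpha> + norm \<beta> \<le> 2 * (norm (matrix_inv W) * (C * norm (\<Gamma> T *v v)))"
    using h by (smt (verit))
  then show "norm v \<le> 2 * (norm (matrix_inv W) * C) * norm (\<Gamma> T *v v)"
    unfolding v using norm_vcat_le[of \<alpha> \<beta>] by (simp add: mult.assoc)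
qed

end

section \<open>The graph conditions in frame coordinates\<close>

lemma graph_cond_s_iff:
  fixes Xs Ps :: "real ^ 'd ^ 'd"
  assumes "columns_basis (vcat Xs Ps) (stable_space M)"
  shows "graph_cond_s M \<longleftrightarrow> invertible Xs"
proof -
  have E: "stable_space M = range ((*v) (vcat Xs Ps))" using columns_basis_range[OF assms] by simp
  show ?thesis
  proof
    assume G: "graph_cond_s M"
    show "invertible Xs"
      unfolding invertible_iff_ker
    proof (intro allI impI)
      fix x assume "Xs *v x = 0"
      \<comment> \<open>A kernel vector of Xs gives a vertical vector of E_s, which vanishes only if
        x does, by independence of the columns.\<close>
      then have x: "vcat Xs Ps *v x = vcat 0 (Ps *v x)" by simp
      then have "vcat Xs Ps *v x \<in> stable_space M \<inter> range (vcat 0)" unfolding E by blast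
      with G have "vcat Xs Ps *v x = 0" unfolding graph_cond_s_def by blast
      then show "x = 0" by (rule columns_basis_ker[OF assms])
    qed
  next
    assume inv: "invertible Xs"
    have "vcat Xs Ps *v x = 0" if "vcat Xs Ps *v x = vcat 0 p" for x p
      using that inv unfolding invertible_iff_ker by auto
    moreover have "0 \<in> range ((*v) (vcat Xs Ps))" "0 \<in> range (vcat 0 :: real ^ 'd \<Rightarrow> _)"
      by (rule range_eqI[of _ _ 0], simp)+
    ultimately show "graph_cond_s M"
      unfolding graph_cond_s_def E by blast
  qed
qed

text \<open>If the combination of the columns by x is (y, q), the block sends x to q - S y, the
  offset from the graph of S; so its kernel parametrizes the intersection.\<close>

lemma graph_cond_u_iff:
  fixes Xu Pu S :: "real ^ 'd ^ 'd"
  assumes "columns_basis (vcat Xu Pu) (unstable_space M)"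
  shows "graph_cond_u M S \<longleftrightarrow> invertible (Pu - S ** Xu)"
proof -
  have E: "unstable_space M = range ((*v) (vcat Xu Pu))" using columns_basis_range[OF assms] by simp
  have D: "(Pu - S ** Xu) *v x = Pu *v x - S *v (Xu *v x)" for x
    by (simp add: matrix_vector_mult_diff_rdistrib matrix_vector_mul_assoc)
  show ?thesis
  proof
    assume G: "graph_cond_u M S"
    show "invertible (Pu - S ** Xu)"
      unfolding invertible_iff_ker
    proof (intro allI impI)
      fix x assume "(Pu - S ** Xu) *v x = 0"
      then have x: "vcat Xu Pu *v x = vcat (Xu *v x) (S *v (Xu *v x))" by (simp add: D)
      then have "vcat Xu Pu *v x \<in> unstable_space M \<inter> range (\<lambda>x. vcat x (S *v x))" unfolding E by blast
      with G have "vcat Xu Pu *v x = 0" unfolding graph_cond_u_def by blast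
      then show "x = 0" by (rule columns_basis_ker[OF assms])
    qed
  next
    assume inv: "invertible (Pu - S ** Xu)"
    have "vcat Xu Pu *v x = 0" if "vcat Xu Pu *v x = vcat y (S *v y)" for x y
    proof -
      have "(Pu - S ** Xu) *v x = 0" using that by (auto simp: D)
      with inv have "x = 0" unfolding invertible_iff_ker by blast
      then show ?thesis by simp
    qed
    moreover have "0 \<in> range ((*v) (vcat Xu Pu))" "0 \<in> range (\<lambda>x. vcat x (S *v x))"
      by (rule range_eqI[of _ _ 0], simp)+
    ultimately show "graph_cond_u M S"
      unfolding graph_cond_u_def E by blast
  qed
qed

lemma invertible_block_diag:
  fixes A B :: "real ^ 'd ^ 'd"
  shows "invertible (block_mat A 0 0 B) \<longleftrightarrow> invertible A \<and> invertible B"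
  unfolding invertible_iff_ker
proof
  assume L: "\<forall>v. block_mat A 0 0 B *v v = 0 \<longrightarrow> v = 0"
  have "x = 0" if "A *v x = 0" for x using L[rule_format, of "vcat x 0"] that by simp
  moreover have "x = 0" if "B *v x = 0" for x using L[rule_format, of "vcat 0 x"] that by simp
  ultimately show "(\<forall>x. A *v x = 0 \<longrightarrow> x = 0) \<and> (\<forall>x. B *v x = 0 \<longrightarrow> x = 0)" by blast
next
  assume R: "(\<forall>x. A *v x = 0 \<longrightarrow> x = 0) \<and> (\<forall>x. B *v x = 0 \<longrightarrow> x = 0)"
  show "\<forall>v. block_mat A 0 0 B *v v = 0 \<longrightarrow> v = 0"
  proof (intro allI impI)
    fix v assume v: "block_mat A 0 0 B *v v = 0"
    obtain x y where xy: "v = vcat x y" by (rule vcat_split)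
    from v have "A *v x = 0" "B *v y = 0" unfolding xy by simp_all
    with R have "x = 0" "y = 0" by blast+
    then show "v = 0" unfolding xy by simp
  qed
qed

text \<open>Lets statements that mention no frame be proved through one. The Lagrangian dimension
  provides exactly d columns for each block.\<close>

lemma hyperbolic_frame_exists:
  fixes M :: "real ^ ('d::finite + 'd) ^ ('d + 'd)"
  assumes M: "symplectic M" and hyp: "hyperbolic M"
  obtains Vs Vu :: "real ^ 'd ^ ('d + 'd)" and Ds Du where "hyperbolic_frame M Vs Vu Ds Du"
proof -
  obtain N where N: "M ** N = mat 1" "N ** M = mat 1" by (rule symplectic_inverse[OF M])
  have MN: "M *v (N *v x) = x" "N *v (M *v x) = x" for x
    using N by (simp_all add: matrix_vector_mul_assoc)
  note lag = lagrangian_stable_unstable[OF M hyp]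
  obtain Vs :: "real ^ 'd ^ ('d + 'd)" where Vs: "columns_basis Vs (stable_space M)"
    using lag(1) unfolding lagrangian_def by (blast elim: columns_basis_exists)
  obtain Vu :: "real ^ 'd ^ ('d + 'd)" where Vu: "columns_basis Vu (unstable_space M)"
    using lag(2) unfolding lagrangian_def by (blast elim: columns_basis_exists)
  have bl: "bounded_linear ((*v) M)" by (simp add: linear_conv_bounded_linear[symmetric])
  have Ms: "M *v w \<in> stable_space M" if "w \<in> stable_space M" for w
    using that unfolding stable_space_eq_decay[OF hyp N]
    by (rule decay_space_image[OF _ bl]) (simp add: funpow_swap1)
  have comm: "((*v) N ^^ k) (M *v w) = M *v ((*v) N ^^ k) w" for k w
    by (induction k) (simp_all add: MN)
  have Mu: "M *v w \<in> unstable_space M" if "w \<in> unstable_space M" for w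
    using that unfolding unstable_space_eq_decay[OF hyp N]
    by (rule decay_space_image[OF _ bl comm])
  have "M *v (Vs *v x) \<in> range ((*v) Vs)" "M *v (Vu *v x) \<in> range ((*v) Vu)" for x
    unfolding columns_basis_range[OF Vs] columns_basis_range[OF Vu]
    using Ms[of "Vs *v x"] Mu[of "Vu *v x"] columns_basis_range[OF Vs] columns_basis_range[OF Vu] by blast+
  then obtain Ds Du where "M ** Vs = Vs ** Ds" "M ** Vu = Vu ** Du"
    using invariant_frame_matrix[of M Vs] invariant_frame_matrix[of M Vu] by metis
  then show ?thesis using Vs Vu by (intro that) (auto simp: hyperbolic_frame_def)
qed

lemma endpoint_frame_of_region:
  assumes "(M, S) \<in> hyperbolic_region" "hyperbolic_frame M Vs Vu Ds Du"
  obtains N where "endpoint_frame M N Vs Vu Ds Du"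
proof -
  have M: "symplectic M" "hyperbolic M" using assms(1) unfolding hyperbolic_region_def by auto
  obtain N where "M ** N = mat 1" "N ** M = mat 1" by (rule symplectic_inverse[OF M(1)])
  with assms(2) M(2) show ?thesis by (intro that) (unfold_locales, auto)
qed

text \<open>The initial horizon is the same on both sides, which makes the statements about a
  prescribed horizon exact.\<close>

lemma green_est_iff_horizon_cutoff:
  assumes "(M, S) \<in> hyperbolic_region" "hyperbolic_frame M Vs Vu Ds Du"
  shows "(\<exists>C \<gamma>. green_est M row_0 (row_T S) C \<gamma> T0) \<longleftrightarrow> horizon_cutoff S Vs Vu Ds Du T0"
proof -
  obtain N where "endpoint_frame M N Vs Vu Ds Du" by (rule endpoint_frame_of_region[OF assms])
  then interpret endpoint_frame M N S Vs Vu Ds Du .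
  show ?thesis using horizon_cutoff_of_green_est green_est_of_horizon_cutoff by metis
qed

lemma horizon_cutoff_exists_iff_graph_cond:
  assumes "(M, S) \<in> hyperbolic_region" "hyperbolic_frame M Vs Vu Ds Du"
  shows "(\<exists>Tc. horizon_cutoff S Vs Vu Ds Du Tc) \<longleftrightarrow> graph_cond_s M \<and> graph_cond_u M S"
proof -
  obtain N where "endpoint_frame M N Vs Vu Ds Du" by (rule endpoint_frame_of_region[OF assms])
  then interpret endpoint_frame M N S Vs Vu Ds Du .
  obtain Xs Ps where s: "Vs = vcat Xs Ps" by (rule vcat_split)
  obtain Xu Pu where u: "Vu = vcat Xu Pu" by (rule vcat_split)
  show ?thesis
    unfolding horizon_cutoff_exists_iff graph_cond_s_iff[OF bases(1)[unfolded s]]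
      graph_cond_u_iff[OF bases(2)[unfolded u]]
    by (simp add: s u gamma_inf_eq invertible_block_diag)
qed

section \<open>Openness and uniformity on compact sets\<close>

definition endpoint_est :: "(real ^ ('d + 'd) ^ ('d + 'd)) \<times> (real ^ 'd ^ 'd) \<Rightarrow> real \<Rightarrow> real \<Rightarrow> nat \<Rightarrow> bool" where
  "endpoint_est q = green_est (fst q) row_0 (row_T (snd q))"

text \<open>Frames have disappeared from this description, so openness of the graph region becomes
  openness of a Green bound.\<close>

lemma graph_region_iff_endpoint_est:
  assumes "q \<in> hyperbolic_region"
  shows "q \<in> graph_region \<longleftrightarrow> (\<exists>C \<gamma> T. endpoint_est q C \<gamma> T)"
proof -
  obtain M S where q: "q = (M, S)" by (cases q)
  have r: "(M, S) \<in> hyperbolic_region" using assms q by simp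
  then have "symplectic M" "hyperbolic M" unfolding hyperbolic_region_def by auto
  then obtain Vs Vu :: "real ^ 'a ^ ('a + 'a)" and Ds Du where F: "hyperbolic_frame M Vs Vu Ds Du"
    by (rule hyperbolic_frame_exists)
  have "q \<in> graph_region \<longleftrightarrow> graph_cond_s M \<and> graph_cond_u M S"
    using r unfolding graph_region_def q by simp
  also have "\<dots> \<longleftrightarrow> (\<exists>T. \<exists>C \<gamma>. endpoint_est q C \<gamma> T)"
    unfolding endpoint_est_def q fst_conv snd_conv green_est_iff_horizon_cutoff[OF r F]
    by (rule horizon_cutoff_exists_iff_graph_cond[OF r F, symmetric])
  finally show ?thesis by blast
qed

lemma endpoint_est_mono:
  assumes est: "endpoint_est q C \<gamma> T" and le: "C \<le> C'" "0 < \<gamma>'" "\<gamma>' \<le> \<gamma>" "T \<le> T'"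
  shows "endpoint_est q C' \<gamma>' T'"
proof -
  have C: "0 < C" using est unfolding endpoint_est_def green_est_def by simp
  show ?thesis
    unfolding endpoint_est_def
  proof (rule green_estI)
    fix U f b h t
    assume U: "T' \<le> U" and sol: "bvp_solution (step_map (fst q)) row_0 (row_T (snd q)) U f b h" and t: "t \<le> U"
    have "norm (h t) \<le> C * cyc_bound \<gamma> U (norm b) (\<lambda>s. norm (f s)) t"
      using green_estD[OF est[unfolded endpoint_est_def] _ sol t] U le by simp
    also have "\<dots> \<le> C' * cyc_bound \<gamma>' U (norm b) (\<lambda>s. norm (f s)) t"
      using C le t by (intro mult_mono cyc_bound_mono cyc_bound_nonneg) auto
    finally show "norm (h t) \<le> C' * cyc_bound \<gamma>' U (norm b) (\<lambda>s. norm (f s)) t" .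
  qed (use C le in auto)
qed

lemma endpoint_est_nearby:
  assumes est: "endpoint_est q C \<gamma> T"
  obtains \<delta> where "0 < \<delta>" "\<And>q'. dist q' q < \<delta> \<Longrightarrow> endpoint_est q' (2 * C) (\<gamma> / 2) T"
proof -
  have C: "0 < C" "0 < \<gamma>" using est unfolding endpoint_est_def green_est_def by auto
  define L where "L = 1 + 4 / (1 - exp (- (\<gamma> / 2)))"
  have L: "0 < L" unfolding L_def using C by (intro add_pos_nonneg) auto
  \<comment> \<open>The radius at which the smallness condition of \<open>green_est_perturb\<close>
    becomes an equality.\<close>
  define \<delta> where "\<delta> = 1 / (2 * C * L)"
  have \<delta>: "0 < \<delta>" unfolding \<delta>_def using C L by simp
  have "endpoint_est q' (2 * C) (\<gamma> / 2) T" if q': "dist q' q < \<delta>" for q'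
    unfolding endpoint_est_def
  proof (rule green_est_perturb[OF est[unfolded endpoint_est_def], of \<delta>])
    show "0 \<le> \<delta>" using \<delta> by simp
    have M: "norm (fst q' - fst q) \<le> \<delta>" and S: "norm (snd q' - snd q) \<le> \<delta>"
      using q' dist_fst_le[of q' q] dist_snd_le[of q' q] by (auto simp: dist_norm)
    show "norm ((fst q' - fst q) *v v) \<le> \<delta> * norm v" for v
      by (rule order_trans[OF norm_matrix_vector_le mult_right_mono[OF M]]) simp
    show "norm ((row_T (snd q') - row_T (snd q)) *v v) \<le> \<delta> * norm v" for v
    proof -
      obtain x p where v: "v = vcat x p" by (rule vcat_split)
      have "(row_T (snd q') - row_T (snd q)) *v v = vcat 0 (- ((snd q' - snd q) *v x))"
        unfolding v matrix_vector_mult_diff_rdistrib row_T_mult_vcat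
        by (simp add: vec_sum_eq_iff)
      then have "norm ((row_T (snd q') - row_T (snd q)) *v v) \<le> norm ((snd q' - snd q) *v x)"
        using norm_vcat_le[of 0 "- ((snd q' - snd q) *v x)"] by simp
      also have "\<dots> \<le> \<delta> * norm x"
        by (rule order_trans[OF norm_matrix_vector_le mult_right_mono[OF S]]) simp
      also have "\<dots> \<le> \<delta> * norm v" unfolding v using \<delta> norm_vcat_ge(1)[of x p] by simp
      finally show ?thesis .
    qed
    show "C * \<delta> * (1 + 4 / (1 - exp (- (\<gamma> / 2)))) \<le> 1 / 2"
      unfolding L_def[symmetric] \<delta>_def using C L by simp
  qed
  with \<delta> show ?thesis by (rule that)
qed

text \<open>Openness holds in the whole space of pairs, for each horizon separately; intersecting
  with the hyperbolic region comes later.\<close>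

lemma open_endpoint_est: "open {q. \<exists>C \<gamma>. endpoint_est q C \<gamma> T}"
  unfolding open_dist
proof
  fix q assume "q \<in> {q. \<exists>C \<gamma>. endpoint_est q C \<gamma> T}"
  then obtain C \<gamma> where q: "endpoint_est q C \<gamma> T" by blast
  obtain \<delta> where "0 < \<delta>" "\<And>q'. dist q' q < \<delta> \<Longrightarrow> endpoint_est q' (2 * C) (\<gamma> / 2) T"
    by (rule endpoint_est_nearby[OF q], rule that)
  then show "\<exists>e>0. \<forall>y. dist y q < e \<longrightarrow> y \<in> {q. \<exists>C \<gamma>. endpoint_est q C \<gamma> T}" by blast
qed

text \<open>The function \<tau> serves two purposes: the identity yields one common initial horizon,
  a constant function keeps a prescribed one.\<close>

lemma endpoint_est_compact_uniform:
  fixes \<tau> :: "nat \<Rightarrow> nat" and K :: "((real ^ ('d::finite + 'd) ^ ('d + 'd)) \<times> (real ^ 'd ^ 'd)) set"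
  assumes K: "compact K" and \<tau>: "mono \<tau>"
    and est: "\<And>q. q \<in> K \<Longrightarrow> \<exists>C \<gamma> n. endpoint_est q C \<gamma> (\<tau> n)"
  obtains C \<gamma> n where "\<And>q. q \<in> K \<Longrightarrow> endpoint_est q C \<gamma> (\<tau> n)"
proof -
  \<comment> \<open>One index loosens all constants together, so the sets increase. Interiors are
    taken because nearby pairs satisfy the bound only with worse constants, so a set with fixed
    constants need not be open.\<close>
  define U where "U n = interior {q :: (real ^ ('d + 'd) ^ ('d + 'd)) \<times> (real ^ 'd ^ 'd). endpoint_est q (real n) (1 / real (Suc n)) (\<tau> n)}" for n
  have mono: "U m \<subseteq> U n" if "m \<le> n" for m n
    unfolding U_def using that \<tau>
    by (intro interior_mono subsetI CollectI) (auto elim!: endpoint_est_mono simp: frac_le monoD)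
  have "K \<subseteq> (\<Union>n. U n)"
  proof
    fix q assume "q \<in> K"
    then obtain C \<gamma> m where q: "endpoint_est q C \<gamma> (\<tau> m)" using est by blast
    then have \<gamma>: "0 < \<gamma>" unfolding endpoint_est_def green_est_def by auto
    obtain \<delta> where \<delta>: "0 < \<delta>" "\<And>q'. dist q' q < \<delta> \<Longrightarrow> endpoint_est q' (2 * C) (\<gamma> / 2) (\<tau> m)"
      by (rule endpoint_est_nearby[OF q], rule that)
    \<comment> \<open>The index must dominate that of the horizon, the doubled constant and the
      reciprocal of the halved rate.\<close>
    obtain n where n: "max (real m) (max (2 * C) (2 / \<gamma>)) \<le> real n" using real_arch_simple by blast
    have "2 / \<gamma> \<le> real (Suc n)" using n by simp
    then have le: "1 / real (Suc n) \<le> \<gamma> / 2" using \<gamma> by (simp add: field_simps)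
    have "\<tau> m \<le> \<tau> n" using monoD[OF \<tau>] n by simp
    then have "endpoint_est q' (real n) (1 / real (Suc n)) (\<tau> n)" if "dist q' q < \<delta>" for q'
      using n le by (intro endpoint_est_mono[OF \<delta>(2)[OF that]]) auto
    then have "ball q \<delta> \<subseteq> {q. endpoint_est q (real n) (1 / real (Suc n)) (\<tau> n)}"
      by (auto simp: dist_commute)
    then have "q \<in> U n" unfolding U_def using \<delta>(1) by (meson centre_in_ball interior_maximal open_ball subsetD)
    then show "q \<in> (\<Union>n. U n)" by blast
  qed
  moreover have "open (U n)" for n unfolding U_def by simp
  ultimately obtain F where F: "finite F" "K \<subseteq> (\<Union>n\<in>F. U n)"
    by (elim compactE_image[OF K, of UNIV U, rotated 1]) auto
  \<comment> \<open>The largest index dominates by monotonicity; the inserted 0 covers an empty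
    F.\<close>
  have sub: "U n \<subseteq> U (Max (insert 0 F))" if "n \<in> F" for n
    using that F(1) by (intro mono Max_ge) auto
  show ?thesis
  proof (rule that)
    fix q assume "q \<in> K"
    then have "q \<in> U (Max (insert 0 F))" using F(2) sub by blast
    then show "endpoint_est q (real (Max (insert 0 F))) (1 / real (Suc (Max (insert 0 F)))) (\<tau> (Max (insert 0 F)))"
      unfolding U_def using interior_subset by blast
  qed
qed

text \<open>The factor c depends on the norm alone, so uniformity over pairs carries over in both
  directions.\<close>

lemma green_endpoint_iff_est:
  assumes "is_norm \<nu>"
  obtains c where "0 < c"
    "\<And>q C \<gamma> T0. green_endpoint \<nu> q C \<gamma> T0 \<Longrightarrow> endpoint_est q (3 * c * C) \<gamma> T0"
    "\<And>q C \<gamma> T0. endpoint_est q C \<gamma> T0 \<Longrightarrow> 1 \<le> T0 \<Longrightarrow> green_endpoint \<nu> q (max 1 (c * C)) \<gamma> T0"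
proof -
  obtain a b where ab: "0 < a" "0 < b" "\<And>x. norm x \<le> a * \<nu> x" "\<And>x. \<nu> x \<le> b * norm x"
    by (rule is_norm_equivalent[OF assms], rule that)
  show ?thesis
  proof (rule that[of "a * b"])
    fix q C \<gamma> T0
    show "endpoint_est q (3 * (a * b) * C) \<gamma> T0" if "green_endpoint \<nu> q C \<gamma> T0"
      using green_est_of_uniform_green[OF ab] that
      unfolding green_endpoint_def endpoint_est_def by (auto simp: case_prod_beta mult.assoc)
    show "green_endpoint \<nu> q (max 1 (a * b * C)) \<gamma> T0" if "endpoint_est q C \<gamma> T0" "1 \<le> T0"
      using uniform_green_of_green_est[OF ab] that
      unfolding green_endpoint_def endpoint_est_def by (auto simp: case_prod_beta)
  qed (use ab in auto)
qed

theorem proposition6p1: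
  fixes \<nu> :: "real ^ ('d::finite + 'd) \<Rightarrow> real"
  assumes "is_norm \<nu>"
  shows
    "(\<forall>(M :: real ^ ('d + 'd) ^ ('d + 'd)). symplectic M \<and> hyperbolic M \<longrightarrow>
        lagrangian (stable_space M) \<and> lagrangian (unstable_space M))
   \<and> (\<forall>(S :: real ^ 'd ^ 'd) x0 p0 xT pT \<xi> \<pi>. transpose S = S \<longrightarrow>
        (row_0 *v vcat x0 p0 + row_T S *v vcat xT pT = vcat \<xi> \<pi>
           \<longleftrightarrow> x0 = \<xi> \<and> pT - S *v xT = \<pi>))
   \<and> (\<forall>(M :: real ^ ('d + 'd) ^ ('d + 'd)) (S :: real ^ 'd ^ 'd) Xs Ps Xu Pu Ds Du.
        (M, S) \<in> hyperbolic_region \<and> hyperbolic_frame M (vcat Xs Ps) (vcat Xu Pu) Ds Du \<longrightarrow>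
          gamma_inf S (vcat Xs Ps) (vcat Xu Pu) = block_mat Xs 0 0 (Pu - S ** Xu)
        \<and> (invertible Xs \<longleftrightarrow> graph_cond_s M)
        \<and> (invertible (Pu - S ** Xu) \<longleftrightarrow> graph_cond_u M S)
        \<and> (graph_cond_s M \<and> graph_cond_u M S \<longrightarrow>
              (\<exists>Tc. horizon_cutoff S (vcat Xs Ps) (vcat Xu Pu) Ds Du Tc)
            \<and> (\<forall>T0\<ge>1. \<forall>Tc. horizon_cutoff S (vcat Xs Ps) (vcat Xu Pu) Ds Du Tc \<longrightarrow>
                 (\<forall>T. T0 \<le> T \<and> T < Tc \<longrightarrow>
                    invertible (gamma_fin S (vcat Xs Ps) (vcat Xu Pu) Ds Du T)) \<longrightarrow>
                 (\<exists>C \<gamma>. green_endpoint \<nu> (M, S) C \<gamma> T0))))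
   \<and> (\<forall>(M :: real ^ ('d + 'd) ^ ('d + 'd)) (S :: real ^ 'd ^ 'd).
        (M, S) \<in> hyperbolic_region \<and> graph_cond_s M \<and> graph_cond_u M S \<longrightarrow>
          (\<exists>C \<gamma> T1. green_endpoint \<nu> (M, S) C \<gamma> T1))
   \<and> openin (top_of_set hyperbolic_region)
        (graph_region :: ((real ^ ('d + 'd) ^ ('d + 'd)) \<times> (real ^ 'd ^ 'd)) set)
   \<and> openin (top_of_set hyperbolic_region)
        {q \<in> hyperbolic_region. \<exists>C \<gamma> T1. green_endpoint \<nu> q C \<gamma> T1}
   \<and> (\<forall>T0\<ge>1. openin (top_of_set hyperbolic_region)
        {q \<in> hyperbolic_region. \<exists>C \<gamma>. green_endpoint \<nu> q C \<gamma> T0})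
   \<and> (\<forall>K. compact K \<and> K \<subseteq> graph_region \<longrightarrow>
        (\<exists>C \<gamma> T1. \<forall>q\<in>K. green_endpoint \<nu> q C \<gamma> T1)
      \<and> (\<forall>Vs Vu Ds Du.
           (\<forall>q\<in>K. hyperbolic_frame (fst q) (Vs q) (Vu q) (Ds q) (Du q)) \<longrightarrow>
             (\<exists>Tc. \<forall>q\<in>K. horizon_cutoff (snd q) (Vs q) (Vu q) (Ds q) (Du q) Tc)
           \<and> (\<forall>T0\<ge>1. \<forall>Tc.
                (\<forall>q\<in>K. horizon_cutoff (snd q) (Vs q) (Vu q) (Ds q) (Du q) Tc) \<longrightarrow>
                ((\<exists>C \<gamma>. \<forall>q\<in>K. green_endpoint \<nu> q C \<gamma> T0) \<longleftrightarrow>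
                 (\<forall>q\<in>K. \<forall>T. T0 \<le> T \<and> T < Tc \<longrightarrow>
                    invertible (gamma_fin (snd q) (Vs q) (Vu q) (Ds q) (Du q) T))))))"
  (is "?Lagrangian \<and> ?Rows \<and> ?Frames \<and> ?Large \<and> ?OpenGraph \<and> ?OpenLarge \<and> ?OpenFixed \<and> ?Compact")
proof -
  obtain c where c: "0 < c"
    and to_est: "\<And>q C \<gamma> T0. green_endpoint \<nu> q C \<gamma> T0 \<Longrightarrow> endpoint_est q (3 * c * C) \<gamma> T0"
    and of_est: "\<And>q C \<gamma> T0. endpoint_est q C \<gamma> T0 \<Longrightarrow> 1 \<le> T0 \<Longrightarrow>
      green_endpoint \<nu> q (max 1 (c * C)) \<gamma> T0"
    by (rule green_endpoint_iff_est[OF assms], rule that)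
  have iff_fixed: "(\<exists>C \<gamma>. green_endpoint \<nu> q C \<gamma> T0) \<longleftrightarrow> (\<exists>C \<gamma>. endpoint_est q C \<gamma> T0)" if "1 \<le> T0" for q T0
    using to_est of_est that by blast
  \<comment> \<open>The Green property asks for an initial horizon of at least 1, and starting later
    keeps the bound.\<close>
  have of_est_max: "green_endpoint \<nu> q (max 1 (c * C)) \<gamma> (max 1 T)" if "endpoint_est q C \<gamma> T" for q C \<gamma> T
  proof -
    have "0 < \<gamma>" using that unfolding endpoint_est_def green_est_def by simp
    then show ?thesis by (intro of_est endpoint_est_mono[OF that]) auto
  qed
  have iff_large: "(\<exists>C \<gamma> T. green_endpoint \<nu> q C \<gamma> T) \<longleftrightarrow> (\<exists>C \<gamma> T. endpoint_est q C \<gamma> T)" for q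
    using to_est of_est_max by blast
  have graph_est: "(\<exists>C \<gamma> T. endpoint_est q C \<gamma> T)" if "q \<in> graph_region" for q
  proof -
    have "q \<in> hyperbolic_region" using that unfolding graph_region_def by auto
    from graph_region_iff_endpoint_est[OF this] that show ?thesis by blast
  qed
  have est_cutoff: "(\<exists>C \<gamma>. endpoint_est q C \<gamma> T0) \<longleftrightarrow> horizon_cutoff (snd q) Vs Vu Ds Du T0"
    if "q \<in> hyperbolic_region" "hyperbolic_frame (fst q) Vs Vu Ds Du" for q Vs Vu Ds Du T0
    unfolding endpoint_est_def using that by (intro green_est_iff_horizon_cutoff) simp_all

  have Lagrangian: ?Lagrangian using lagrangian_stable_unstable by blast
  have Rows: ?Rows using endpoint_rows_iff by blast
  have Frames: ?Frames
  proof (intro allI impI)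
    fix M :: "real ^ ('d + 'd) ^ ('d + 'd)" and S Xs Ps Xu Pu Ds Du :: "real ^ 'd ^ 'd"
    assume A: "(M, S) \<in> hyperbolic_region \<and> hyperbolic_frame M (vcat Xs Ps) (vcat Xu Pu) Ds Du"
    then have R: "(M, S) \<in> hyperbolic_region" and F: "hyperbolic_frame M (vcat Xs Ps) (vcat Xu Pu) Ds Du"
      by auto
    have bases: "columns_basis (vcat Xs Ps) (stable_space M)" "columns_basis (vcat Xu Pu) (unstable_space M)"
      using F unfolding hyperbolic_frame_def by auto
    have "\<exists>C \<gamma>. green_endpoint \<nu> (M, S) C \<gamma> T0"
      if "1 \<le> T0" "horizon_cutoff S (vcat Xs Ps) (vcat Xu Pu) Ds Du Tc"
        "\<forall>T. T0 \<le> T \<and> T < Tc \<longrightarrow> invertible (gamma_fin S (vcat Xs Ps) (vcat Xu Pu) Ds Du T)" for T0 Tc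
    proof -
      have "horizon_cutoff S (vcat Xs Ps) (vcat Xu Pu) Ds Du T0"
        using horizon_cutoff_extend that(2,3) by blast
      then show ?thesis using iff_fixed[OF that(1)] est_cutoff[of "(M, S)"] R F by auto
    qed
    then show "gamma_inf S (vcat Xs Ps) (vcat Xu Pu) = block_mat Xs 0 0 (Pu - S ** Xu)
        \<and> (invertible Xs \<longleftrightarrow> graph_cond_s M)
        \<and> (invertible (Pu - S ** Xu) \<longleftrightarrow> graph_cond_u M S)
        \<and> (graph_cond_s M \<and> graph_cond_u M S \<longrightarrow>
              (\<exists>Tc. horizon_cutoff S (vcat Xs Ps) (vcat Xu Pu) Ds Du Tc)
            \<and> (\<forall>T0\<ge>1. \<forall>Tc. horizon_cutoff S (vcat Xs Ps) (vcat Xu Pu) Ds Du Tc \<longrightarrow>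
                 (\<forall>T. T0 \<le> T \<and> T < Tc \<longrightarrow>
                    invertible (gamma_fin S (vcat Xs Ps) (vcat Xu Pu) Ds Du T)) \<longrightarrow>
                 (\<exists>C \<gamma>. green_endpoint \<nu> (M, S) C \<gamma> T0)))"
      using gamma_inf_eq graph_cond_s_iff[OF bases(1)] graph_cond_u_iff[OF bases(2)]
        horizon_cutoff_exists_iff_graph_cond[OF R F] by blast
  qed
  have Large: ?Large
    using graph_est iff_large unfolding graph_region_def by blast
  have open_large: "open {q :: (real ^ ('d + 'd) ^ ('d + 'd)) \<times> (real ^ 'd ^ 'd). \<exists>C \<gamma> T. endpoint_est q C \<gamma> T}"
  proof -
    have "open (\<Union>T. {q :: (real ^ ('d + 'd) ^ ('d + 'd)) \<times> (real ^ 'd ^ 'd). \<exists>C \<gamma>. endpoint_est q C \<gamma> T})"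
      using open_endpoint_est by (intro open_UN) blast
    moreover have "(\<Union>T. {q :: (real ^ ('d + 'd) ^ ('d + 'd)) \<times> (real ^ 'd ^ 'd). \<exists>C \<gamma>. endpoint_est q C \<gamma> T}) =
      {q. \<exists>C \<gamma> T. endpoint_est q C \<gamma> T}" by blast
    ultimately show ?thesis by simp
  qed
  have OpenGraph: ?OpenGraph
  proof -
    have "graph_region \<subseteq> hyperbolic_region" unfolding graph_region_def by auto
    then have "graph_region = hyperbolic_region \<inter>
        {q :: (real ^ ('d + 'd) ^ ('d + 'd)) \<times> (real ^ 'd ^ 'd). \<exists>C \<gamma> T. endpoint_est q C \<gamma> T}"
      using graph_region_iff_endpoint_est by blast
    then show ?thesis using openin_open_Int[OF open_large] by metis
  qed
  have OpenLarge: ?OpenLarge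
    unfolding iff_large using openin_open_Int[OF open_large] by (simp add: Int_def)
  have OpenFixed: ?OpenFixed
  proof (intro allI impI)
    fix T0 :: nat assume "1 \<le> T0"
    from iff_fixed[OF this]
    show "openin (top_of_set hyperbolic_region) {q \<in> hyperbolic_region. \<exists>C \<gamma>. green_endpoint \<nu> q C \<gamma> T0}"
      using openin_open_Int[OF open_endpoint_est, of hyperbolic_region T0] by (simp add: Int_def)
  qed
  have Compact: ?Compact
  proof (intro allI impI)
    fix K :: "((real ^ ('d + 'd) ^ ('d + 'd)) \<times> (real ^ 'd ^ 'd)) set"
    assume "compact K \<and> K \<subseteq> graph_region"
    then have K: "compact K" "K \<subseteq> graph_region" by auto
    then have region: "q \<in> hyperbolic_region" if "q \<in> K" for q
      using that unfolding graph_region_def by auto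
    have "mono (\<lambda>n :: nat. n)" by (rule monoI)
    then obtain C \<gamma> T1 where unif: "\<And>q. q \<in> K \<Longrightarrow> endpoint_est q C \<gamma> T1"
      using endpoint_est_compact_uniform[OF K(1), of "\<lambda>n. n"] graph_est K(2) by (metis subsetD)
    \<comment> \<open>Pointwise bounds from the prescribed horizon become uniform by compactness,
      with a constant \<tau>.\<close>
    have fixed_unif: "\<exists>C \<gamma>. \<forall>q\<in>K. green_endpoint \<nu> q C \<gamma> T0"
      if T0: "1 \<le> T0" and ex: "\<And>q. q \<in> K \<Longrightarrow> \<exists>C \<gamma>. endpoint_est q C \<gamma> T0" for T0
    proof -
      obtain C \<gamma> n where "\<And>q. q \<in> K \<Longrightarrow> endpoint_est q C \<gamma> ((\<lambda>_. T0) (n::nat))"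
        by (rule endpoint_est_compact_uniform[OF K(1), of "\<lambda>_. T0"]) (use ex in \<open>auto simp: mono_def\<close>)
      then show ?thesis using of_est T0 by blast
    qed
    show "(\<exists>C \<gamma> T1. \<forall>q\<in>K. green_endpoint \<nu> q C \<gamma> T1)
      \<and> (\<forall>Vs Vu Ds Du.
           (\<forall>q\<in>K. hyperbolic_frame (fst q) (Vs q) (Vu q) (Ds q) (Du q)) \<longrightarrow>
             (\<exists>Tc. \<forall>q\<in>K. horizon_cutoff (snd q) (Vs q) (Vu q) (Ds q) (Du q) Tc)
           \<and> (\<forall>T0\<ge>1. \<forall>Tc.
                (\<forall>q\<in>K. horizon_cutoff (snd q) (Vs q) (Vu q) (Ds q) (Du q) Tc) \<longrightarrow>
                ((\<exists>C \<gamma>. \<forall>q\<in>K. green_endpoint \<nu> q C \<gamma> T0) \<longleftrightarrow>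
                 (\<forall>q\<in>K. \<forall>T. T0 \<le> T \<and> T < Tc \<longrightarrow>
                    invertible (gamma_fin (snd q) (Vs q) (Vu q) (Ds q) (Du q) T)))))"
    proof (intro conjI allI impI)
      show "\<exists>C \<gamma> T1. \<forall>q\<in>K. green_endpoint \<nu> q C \<gamma> T1" using of_est_max unif by blast
    next
      fix Vs Vu :: "(real ^ ('d + 'd) ^ ('d + 'd)) \<times> (real ^ 'd ^ 'd) \<Rightarrow> real ^ 'd ^ ('d + 'd)"
        and Ds Du :: "(real ^ ('d + 'd) ^ ('d + 'd)) \<times> (real ^ 'd ^ 'd) \<Rightarrow> real ^ 'd ^ 'd"
      assume F: "\<forall>q\<in>K. hyperbolic_frame (fst q) (Vs q) (Vu q) (Ds q) (Du q)"
      have cutoff: "(\<exists>C \<gamma>. endpoint_est q C \<gamma> T0) \<longleftrightarrow> horizon_cutoff (snd q) (Vs q) (Vu q) (Ds q) (Du q) T0"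
        if "q \<in> K" for q T0
        using est_cutoff[OF region] that F by blast
      show "\<exists>Tc. \<forall>q\<in>K. horizon_cutoff (snd q) (Vs q) (Vu q) (Ds q) (Du q) Tc"
        using unif cutoff by blast
      fix T0 Tc :: nat assume T0: "1 \<le> T0" and Tc: "\<forall>q\<in>K. horizon_cutoff (snd q) (Vs q) (Vu q) (Ds q) (Du q) Tc"
      show "(\<exists>C \<gamma>. \<forall>q\<in>K. green_endpoint \<nu> q C \<gamma> T0) \<longleftrightarrow>
        (\<forall>q\<in>K. \<forall>T. T0 \<le> T \<and> T < Tc \<longrightarrow> invertible (gamma_fin (snd q) (Vs q) (Vu q) (Ds q) (Du q) T))"
      proof
        assume "\<exists>C \<gamma>. \<forall>q\<in>K. green_endpoint \<nu> q C \<gamma> T0"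
        \<comment> \<open>A Green bound from T0 on makes T0 itself a cutoff, which includes the
          short horizons.\<close>
        then have "horizon_cutoff (snd q) (Vs q) (Vu q) (Ds q) (Du q) T0" if "q \<in> K" for q
          using to_est cutoff[OF that] that by blast
        then show "\<forall>q\<in>K. \<forall>T. T0 \<le> T \<and> T < Tc \<longrightarrow> invertible (gamma_fin (snd q) (Vs q) (Vu q) (Ds q) (Du q) T)"
          unfolding horizon_cutoff_def by blast
      next
        assume inv: "\<forall>q\<in>K. \<forall>T. T0 \<le> T \<and> T < Tc \<longrightarrow>
          invertible (gamma_fin (snd q) (Vs q) (Vu q) (Ds q) (Du q) T)"
        \<comment> \<open>Filling in the short horizons gives each q its own constants;
          \<open>fixed_unif\<close> then makes them common.\<close>
        have "\<exists>C \<gamma>. endpoint_est q C \<gamma> T0" if "q \<in> K" for q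
          unfolding cutoff[OF that] using that Tc inv by (blast intro: horizon_cutoff_extend)
        then show "\<exists>C \<gamma>. \<forall>q\<in>K. green_endpoint \<nu> q C \<gamma> T0" by (rule fixed_unif[OF T0])
      qed
    qed
  qed
  from Lagrangian Rows Frames Large OpenGraph OpenLarge OpenFixed Compact show ?thesis by (intro conjI)
qed

end
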